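(* Let $U\subset M$ be open and suppose that there exist constants $R_0>0$, $C_0\in(0,1)$, $C_1>1$, $C_2,\dots,C_7>0$ and a function $\phi:U\times(0,R_0)\to(0,\infty)$, with $\phi(z,\cdot)$ increasing and continuous for every $z\in U$, such that for every $x\in U$ and every $0<r<R_0\wedge(C_0\delta_U(x))$: (CE) $C_1^{-1}\phi(y,r)\le\phi(x,r)\le C_1\phi(y,r)$ for all $y\in B(x,r)$; (US) $\lim_{s\to0}\phi(x,s)=0$ and $\phi(x,r)\le C_2\,\phi(x,r/2)$; (Tail) $J(x,M_\partial\setminus B(x,r))\le C_3/\phi(x,r)$; (SP) $C_4e^{-C_5n}\le\mathbb P^x\big(\tau_{B(x,r)}\ge n\phi(x,r)\big)\le C_6e^{-C_7n}$ for all integers $n\ge1$. Let $f_0:U\times(0,\infty)\to[0,1]$ be the deterministic function such that for every $x\in U$ and $\kappa>0$, $$\limsup_{r\to0}\frac{\mathcal U\big(B(x,r),\,\kappa\phi(x,r)\log|\log\phi(x,r)|\big)}{\kappa\phi(x,r)\log|\log\phi(x,r)|}=f_0(x,\kappa),\qquad\mathbb P^x\text{-a.s.}$$ (which is well-defined by Blumenthal's zero-one law). Then: (P1) For each fixed $x\in U$, the map $\kappa\mapsto f_0(x,\kappa)$ is strictly positive and non-increasing. (P2) There exists a constant $\kappa_0>0$ such that $f_0(x,\kappa)=1$ for all $x\in U$ and all $\kappa\le\kappa_0$. (P3) $\lim_{\kappa\to\infty}f_0(x,\kappa)=0$ uniformly in $x\in U$.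
   Context: $(M,d)$ is a locally compact separable metric space, $\mu$ is a positive Radon measure on $M$ with full support, and $B(x,r)$ is the open ball with center $x$ and radius $r$. For a Borel set $D\subset M$, $\delta_D(x)=\inf\{d(x,y):y\in M\setminus D\}$. $\partial$ is a cemetery point added to $M$, $M_\partial=M\cup\{\partial\}$; functions $f$ on $M$ are extended by $f(\partial)=0$. $X=(\Omega,\mathcal F_t,X_t,t\ge0;\mathbb P^x,x\in M_\partial)$ is a Borel standard Markov process on $M_\partial$ with a Lévy system of the form $(J(x,\cdot),ds)$: $(J(x,dy):x\in M)$ is a family of Borel measures on $M_\partial$ such that for all $z\in M$, $t>0$ and all non-negative Borel functions $F$ on $M\times M_\partial$ vanishing on the diagonal, $\mathbb E^z[\sum_{s\le t}F(X_{s-},X_s)]=\mathbb E^z[\int_0^t\int_{M_\partial}F(X_s,y)J(X_s,dy)ds]$. The first exit time from a Borel set $D$ is $\tau_D=\inf\{t>0:X_t\in M_\partial\setminus D\}$. For a Borel set $D\subset M$ and $t\in[0,\infty]$, $\mathcal U(D,t)=\int_0^t\mathbf 1_D(X_s)\,ds$ is the occupation time. $a\wedge b=\min\{a,b\}$. *)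

theory Defs
  imports "HOL-Probability.Probability"
begin

section \<open>The state space\<close>

text \<open>
  The state space \<open>M\<close> is a type \<open>'m\<close>; \<open>M\<^sub>\<partial>\<close> is \<open>'m option\<close> with \<open>None\<close> as the cemetery. As usual,
  \<open>None\<close> is the point at infinity if \<open>M\<close> is not compact, and an isolated point if \<open>M\<close> is compact;
  the Alexandroff compactification covers both cases.
\<close>

abbreviation cemetery_top :: "'m::topological_space option topology" where
  "cemetery_top \<equiv> Alexandroff_compactification euclidean"

definition cemetery_borel :: "'m::topological_space option measure" where
  "cemetery_borel = sigma UNIV {S. openin cemetery_top S}"

definition radon_measure :: "'m::topological_space measure \<Rightarrow> bool" where
  "radon_measure \<mu> \<longleftrightarrow>
     sets \<mu> = sets borel \<and>
     (\<forall>K. compact K \<longrightarrow> emeasure \<mu> K < \<infinity>) \<and>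
     (\<forall>A\<in>sets borel. emeasure \<mu> A = (SUP K\<in>{K. compact K \<and> K \<subseteq> A}. emeasure \<mu> K))"

definition full_support :: "'m::topological_space measure \<Rightarrow> bool" where
  "full_support \<mu> \<longleftrightarrow> (\<forall>S. open S \<and> S \<noteq> {} \<longrightarrow> emeasure \<mu> S > 0)"

text \<open>Extended-real valued, so that the infimum over the empty set is \<open>\<infinity>\<close> (the case \<open>D = M\<close>).\<close>

definition dist_compl :: "'m::metric_space set \<Rightarrow> 'm \<Rightarrow> ereal" where
  "dist_compl D x = (INF y\<in>- D. ereal (dist x y))"


section \<open>Borel standard processes\<close>

text \<open>
  Time runs through \<open>[0,\<infinity>]\<close> (type \<^typ>\<open>ennreal\<close>), with the convention \<open>X\<^sub>\<infinity> = \<partial>\<close>. \<open>F t\<close> carries the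
  \<open>\<sigma>\<close>-algebra \<open>\<F>\<^sub>t\<close>, and \<open>F \<infinity>\<close> is the ambient \<open>\<sigma>\<close>-algebra on which the laws \<open>P x\<close> live.
\<close>

definition lifetime :: "(ennreal \<Rightarrow> 'w \<Rightarrow> 'm option) \<Rightarrow> 'w \<Rightarrow> ennreal" where
  "lifetime X \<omega> = Inf {t. X t \<omega> = None}"

text \<open>The laws \<open>P\<^sup>\<nu>(A) = \<integral> P\<^sup>x(A) \<nu>(dx)\<close>; for \<open>A\<close> in the (completed) ambient \<open>\<sigma>\<close>-algebra the
  integrand is in general only universally measurable, whence the completion of \<open>\<nu>\<close>.\<close>

definition law_from ::
    "('m option \<Rightarrow> 'w measure) \<Rightarrow> 'm option measure \<Rightarrow> 'w set \<Rightarrow> ennreal" where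
  "law_from P \<nu> A = (\<integral>\<^sup>+ x. emeasure (P x) A \<partial>completion \<nu>)"

definition initial_dist :: "'m::topological_space option measure \<Rightarrow> bool" where
  "initial_dist \<nu> \<longleftrightarrow> prob_space \<nu> \<and> sets \<nu> = sets cemetery_borel"

text \<open>
  The definition of Blumenthal and Getoor. It needs no shift operators: the strong Markov property
  is stated for \<open>X\<^bsub>T+t\<^esub>\<close>; for \<open>T = \<infinity>\<close> it is consistent because of \<open>X\<^sub>\<infinity> = \<partial>\<close>. ``Borel'' refers to
  \<open>borel_transition\<close>. \<open>F_complete\<close> says that \<open>\<F>\<^sub>t\<close> contains every set that, for every initial
  distribution \<open>\<nu>\<close>, differs from a member of \<open>\<F>\<^sub>t\<close> by a subset of a \<open>P\<^sup>\<nu>\<close>-null set.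
\<close>

locale borel_standard_process = filtration \<Omega> F
  for \<Omega> :: "'w set" and F :: "ennreal \<Rightarrow> 'w measure"
    and X :: "ennreal \<Rightarrow> 'w \<Rightarrow> 'm::{metric_space, second_countable_topology} option"
    and P :: "'m option \<Rightarrow> 'w measure" +
  assumes locally_compact: "locally_compact_space (euclidean :: 'm topology)"
    and prob_P: "\<And>x. prob_space (P x)"
    and sets_P: "\<And>x. sets (P x) = sets (F \<infinity>)"
    and universally_measurable_P:
      "\<And>\<nu> A. initial_dist \<nu> \<Longrightarrow> A \<in> sets (F \<infinity>) \<Longrightarrow>
         (\<lambda>x. emeasure (P x) A) \<in> borel_measurable (completion \<nu>)"
    and F_right_continuous: "\<And>t. t < \<infinity> \<Longrightarrow> sets (F t) = (\<Inter>s\<in>{t<..}. sets (F s))"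
    and F_complete:
      "\<And>t A. A \<subseteq> \<Omega> \<Longrightarrow>
         (\<And>\<nu>. initial_dist \<nu> \<Longrightarrow>
            \<exists>B\<in>sets (F t). \<exists>N\<in>sets (F \<infinity>). law_from P \<nu> N = 0 \<and> (A - B) \<union> (B - A) \<subseteq> N) \<Longrightarrow>
         A \<in> sets (F t)"
    and adapted: "\<And>t. X t \<in> F t \<rightarrow>\<^sub>M cemetery_borel"
    and borel_transition:
      "\<And>t A. A \<in> sets cemetery_borel \<Longrightarrow>
         (\<lambda>x. emeasure (P x) {\<omega>\<in>\<Omega>. X t \<omega> \<in> A}) \<in> borel_measurable cemetery_borel"
    and normal: "\<And>x. AE \<omega> in P x. X 0 \<omega> = x"
    and X_infinity: "\<And>\<omega>. \<omega> \<in> \<Omega> \<Longrightarrow> X \<infinity> \<omega> = None"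
    and cemetery_absorbing: "\<And>\<omega> s t. \<omega> \<in> \<Omega> \<Longrightarrow> s \<le> t \<Longrightarrow> X s \<omega> = None \<Longrightarrow> X t \<omega> = None"
    and right_continuous:
      "\<And>\<omega> t. \<omega> \<in> \<Omega> \<Longrightarrow> limitin cemetery_top (\<lambda>s. X s \<omega>) (X t \<omega>) (at_right t)"
    and left_limits:
      "\<And>x. AE \<omega> in P x. \<forall>t. 0 < t \<and> t < lifetime X \<omega> \<longrightarrow>
         (\<exists>y. limitin cemetery_top (\<lambda>s. X s \<omega>) (Some y) (at_left t))"
    and stopped_measurable:
      "\<And>T. stopping_time F T \<Longrightarrow> (\<lambda>\<omega>. X (T \<omega>) \<omega>) \<in> pre_sigma T \<rightarrow>\<^sub>M cemetery_borel"
    and strong_markov: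
      "\<And>x T t A L. stopping_time F T \<Longrightarrow> A \<in> sets cemetery_borel \<Longrightarrow> L \<in> sets (pre_sigma T) \<Longrightarrow>
         emeasure (P x) {\<omega>\<in>L. X (T \<omega> + t) \<omega> \<in> A} =
         (\<integral>\<^sup>+ \<omega>\<in>L. emeasure (P (X (T \<omega>) \<omega>)) {\<omega>'\<in>\<Omega>. X t \<omega>' \<in> A} \<partial>P x)"
    and quasi_left_continuous:
      "\<And>x T. (\<And>n. stopping_time F (T n)) \<Longrightarrow> (\<And>n \<omega>. \<omega> \<in> \<Omega> \<Longrightarrow> T n \<omega> \<le> T (Suc n) \<omega>) \<Longrightarrow>
         AE \<omega> in P x. (SUP n. T n \<omega>) < lifetime X \<omega> \<longrightarrow>
           limitin cemetery_top (\<lambda>n. X (T n \<omega>) \<omega>) (X (SUP n. T n \<omega>) \<omega>) sequentially"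


section \<open>Levy systems\<close>

text \<open>\<open>X\<^bsub>s-\<^esub>\<close>, with value \<open>\<partial>\<close> if the path has no left limit in \<open>M\<close> at \<open>s\<close> (which may happen at the
  lifetime).\<close>

definition left_lim ::
    "(ennreal \<Rightarrow> 'w \<Rightarrow> 'm::topological_space option) \<Rightarrow> ennreal \<Rightarrow> 'w \<Rightarrow> 'm option" where
  "left_lim X s \<omega> =
     (if \<exists>y. limitin cemetery_top (\<lambda>u. X u \<omega>) (Some y) (at_left s)
      then Some (THE y. limitin cemetery_top (\<lambda>u. X u \<omega>) (Some y) (at_left s))
      else None)"

text \<open>Functions on \<open>M\<close> extended by \<open>0\<close> to the cemetery.\<close>

definition extend0 :: "('m \<Rightarrow> 'b::zero) \<Rightarrow> 'm option \<Rightarrow> 'b" where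
  "extend0 f z = (case z of None \<Rightarrow> 0 | Some x \<Rightarrow> f x)"

text \<open>\<open>X\<close> has the Levy system \<open>(J(x,\<cdot>), ds)\<close>. The sum over the jump times is an integral with
  respect to counting measure.\<close>

definition levy_system ::
    "(ennreal \<Rightarrow> 'w \<Rightarrow> 'm::metric_space option) \<Rightarrow> ('m option \<Rightarrow> 'w measure) \<Rightarrow>
     ('m \<Rightarrow> 'm option measure) \<Rightarrow> bool" where
  "levy_system X P J \<longleftrightarrow>
     (\<forall>x. sets (J x) = sets cemetery_borel) \<and>
     (\<forall>z. \<forall>t>0. \<forall>G::'m \<times> 'm option \<Rightarrow> ennreal.
        G \<in> borel_measurable (borel \<Otimes>\<^sub>M cemetery_borel) \<and> (\<forall>x. G (x, Some x) = 0) \<longrightarrow>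
        (\<integral>\<^sup>+ \<omega>. (\<integral>\<^sup>+ s. extend0 (\<lambda>x. G (x, X (ennreal s) \<omega>)) (left_lim X (ennreal s) \<omega>)
                 \<partial>count_space {0<..t}) \<partial>P (Some z)) =
        (\<integral>\<^sup>+ \<omega>. (\<integral>\<^sup>+ s\<in>{0..t}. extend0 (\<lambda>x. \<integral>\<^sup>+ y. G (x, y) \<partial>J x) (X (ennreal s) \<omega>)
                 \<partial>lborel) \<partial>P (Some z)))"


section \<open>Exit and occupation times\<close>

definition exit_time :: "(ennreal \<Rightarrow> 'w \<Rightarrow> 'm option) \<Rightarrow> 'm set \<Rightarrow> 'w \<Rightarrow> ennreal" where
  "exit_time X D \<omega> = Inf {t. 0 < t \<and> X t \<omega> \<in> UNIV - Some ` D}"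

definition occupation_time ::
    "(ennreal \<Rightarrow> 'w \<Rightarrow> 'm option) \<Rightarrow> 'm set \<Rightarrow> ennreal \<Rightarrow> 'w \<Rightarrow> ennreal" where
  "occupation_time X D t \<omega> =
     (\<integral>\<^sup>+ s\<in>{s. 0 \<le> s \<and> ennreal s \<le> t}. extend0 (indicator D) (X (ennreal s) \<omega>) \<partial>lborel)"

definition limsup_occupation ::
    "(ennreal \<Rightarrow> 'w \<Rightarrow> 'm::metric_space option) \<Rightarrow> ('m \<Rightarrow> real \<Rightarrow> real) \<Rightarrow> 'm \<Rightarrow> real \<Rightarrow> 'w \<Rightarrow> ennreal"
  where
  "limsup_occupation X \<phi> x \<kappa> \<omega> =
     Limsup (at_right 0)
       (\<lambda>r. let t = ennreal (\<kappa> * \<phi> x r * ln \<bar>ln (\<phi> x r)\<bar>)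
            in occupation_time X (ball x r) t \<omega> / t)"

end

theory Submission
  imports Defs
begin

text \<open>
  The limsup is measurable with respect to \<open>\<F>\<^sub>0\<close> and to the paths, so that by the Markov property at time
  \<open>0\<close> it is independent of itself and hence constant.

  Monotonicity in \<open>\<kappa>\<close> holds pathwise: given \<open>r\<close> and \<open>\<kappa> < \<kappa>'\<close>, continuity of \<open>\<phi>\<close> yields \<open>r' \<ge> r\<close> for which the
  time of \<open>(r', \<kappa>)\<close> is that of \<open>(r, \<kappa>')\<close>, and the larger ball is occupied longer.

  For small \<open>\<kappa>\<close>, take \<open>\<phi>(x, r\<^sub>k) = exp (- k\<^sup>2)\<close>. By (SP), given the past at time about \<open>\<phi>(x, r\<^sub>k)\<close>, the process
  stays in \<open>B(x, r\<^sub>k)\<close> for the required time with conditional probability at least \<open>c / k\<close> whenever it is close to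
  \<open>x\<close> at that time, which has probability at least \<open>q\<close>. This gives infinitely many successes with positive
  probability, hence with probability one.

  For large \<open>\<kappa>\<close>, the point is that \<open>E\<^sup>y \<U>(B(x, r), K \<phi>(x, r)) \<le> \<epsilon> K \<phi>(x, r)\<close> for all starting points \<open>y\<close>. Choose
  \<open>R\<^sub>0 = r\<close> and \<open>\<phi>(x, R\<^sub>i\<^sub>+\<^sub>1) = \<beta> \<phi>(x, R\<^sub>i)\<close>. From \<open>B(x, 2 R\<^sub>i)\<close> the process soon leaves \<open>B(x, 4 R\<^sub>i)\<close>, by (Tail) it
  is unlikely to do so by jumping beyond scale \<open>R\<^sub>i\<^sub>+\<^sub>1\<close>, and by (SP) it then stays where it has landed for a time
  comparable to \<open>\<phi>(x, R\<^sub>i)\<close> (or it is dead). Integrating this along the occupation time gives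
  \<open>(1 + c) A\<^sub>i(t) \<le> A\<^sub>i\<^sub>+\<^sub>1(t + s\<^sub>i) + s\<^sub>i\<close> for the expected occupation times \<open>A\<^sub>i\<close> at scale \<open>R\<^sub>i\<close>, which is iterated.
  A large deviation bound over blocks of length \<open>K \<phi>(x, r)\<close> and Borel--Cantelli conclude.
\<close>

section \<open>The state space and the strong Markov property\<close>

text \<open>The process comes without shift operators: its strong Markov property speaks of a single
  later time. Arguments therefore run through one-time expectations, integrated in time by Fubini,
  or through finite-dimensional laws. Fubini needs joint measurability in time and path, which
  right-continuity supplies for functions that are right-continuous along paths; hence the recursion
  works with continuous cutoffs of the distance to x instead of ball indicators.

  A single scale only bounds the fraction of time near x away from 1. As the fraction must become
  arbitrarily small, a fixed gain is compounded over m scales, and m is chosen after the tolerance.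
  A killed process is credited to the outer shell at every scale, so the step from one scale to the
  next treats death as a success.

  Only the radius below which the hypotheses are available depends on x. The number of scales, their
  ratio and the gain depend on \<open>C1\<close> to \<open>C7\<close> and the tolerance alone; this
  gives uniformity in x.

  Positivity comes last: a limsup vanishing at some \<kappa> above the threshold of (P2) would be
  less than 1 at that threshold, where it equals 1.\<close>

lemma space_cemetery_borel [simp]: "space (cemetery_borel :: 'm::topological_space option measure) = UNIV"
  by (simp add: cemetery_borel_def)

lemma openin_cemetery_borel:
  "openin cemetery_top S \<Longrightarrow> S \<in> sets (cemetery_borel :: 'm::topological_space option measure)"
  by (auto simp: cemetery_borel_def)

text \<open>\<open>Some\<close> is an open embedding, so it maps Borel sets to measurable sets, and
  \<open>{None}\<close> is the complement of the open set of living states. Measurability on the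
  compactification can thus be checked on M alone.\<close>

lemma sets_cemetery_borel_iff:
  fixes A :: "'m::t2_space option set"
  shows "A \<in> sets cemetery_borel \<longleftrightarrow> Some -` A \<in> sets borel"
proof
  have "Some \<in> (borel :: 'm measure) \<rightarrow>\<^sub>M cemetery_borel"
    unfolding cemetery_borel_def
  proof (rule measurable_measure_of)
    fix S :: "'m option set" assume "S \<in> {S. openin cemetery_top S}"
    then have "open (Some -` S)"
      using openin_continuous_map_preimage[OF continuous_map_Some, of euclidean S]
      by (simp add: vimage_def)
    then show "Some -` S \<inter> space borel \<in> sets borel" by simp
  qed auto
  from measurable_sets[OF this, of A] show "A \<in> sets cemetery_borel \<Longrightarrow> Some -` A \<in> sets borel"
    by simp
next
  have Some_open: "Some ` S \<in> sets cemetery_borel" if "open S" for S :: "'m set"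
    using that by (intro openin_cemetery_borel) simp
  have "Some ` B \<in> sets cemetery_borel" if "B \<in> sigma_sets UNIV {S::'m set. open S}" for B
    using that
  proof induction
    case (Basic a) then show ?case using Some_open by simp
  next
    case (Compl a)
    have "Some ` (UNIV - a) = Some ` UNIV - Some ` a" by auto
    then show ?case using Compl.IH Some_open[OF open_UNIV] by (simp only: sets.Diff)
  next
    case (Union a)
    have "Some ` (\<Union>i. a i) = (\<Union>i. Some ` a i)" by auto
    then show ?case using Union.IH by (simp only: sets.countable_UN[OF image_subsetI])
  qed simp
  then have *: "Some ` B \<in> sets cemetery_borel" if "B \<in> sets (borel :: 'm measure)" for B
    using that by (simp add: borel_def)
  have None: "{None :: 'm option} \<in> sets cemetery_borel"
  proof -
    have "{None :: 'm option} = space cemetery_borel - Some ` UNIV"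
      by (rule set_eqI) (simp add: notin_range_Some)
    then show ?thesis using Some_open[OF open_UNIV] by (metis sets.compl_sets)
  qed
  assume "Some -` A \<in> sets borel"
  then have Some_A: "Some ` (Some -` A) \<in> sets cemetery_borel" by (rule *)
  have A_eq: "A = (if None \<in> A then {None} else {}) \<union> Some ` (Some -` A)"
  proof (rule set_eqI)
    show "z \<in> A \<longleftrightarrow> z \<in> (if None \<in> A then {None} else {}) \<union> Some ` (Some -` A)" for z
      by (cases z) auto
  qed
  have "(if None \<in> A then {None :: 'm option} else {}) \<in> sets cemetery_borel"
    using None by simp
  from sets.Un[OF this Some_A] show "A \<in> sets cemetery_borel"
    unfolding A_eq[symmetric] .
qed

lemma sets_Some_image:
  fixes A :: "'m::t2_space set"
  shows "A \<in> sets borel \<Longrightarrow> Some ` A \<in> sets cemetery_borel"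
  by (simp add: sets_cemetery_borel_iff inj_vimage_image_eq)

lemma measurable_from_cemetery_borel:
  fixes f :: "'m::t2_space option \<Rightarrow> 'b"
  assumes "f \<circ> Some \<in> borel \<rightarrow>\<^sub>M N" and "f None \<in> space N"
  shows "f \<in> cemetery_borel \<rightarrow>\<^sub>M N"
proof (rule measurableI)
  show "f z \<in> space N" for z
    using assms measurable_space[OF assms(1)] by (cases z) auto
  show "f -` A \<inter> space cemetery_borel \<in> sets cemetery_borel" if "A \<in> sets N" for A
    using measurable_sets[OF assms(1) that] by (simp add: sets_cemetery_borel_iff vimage_def)
qed

text \<open>The cap gives the cemetery a finite value that agrees with the far part of M. This makes
  the distance to x continuous at \<open>None\<close> as soon as \<open>cball x \<rho>\<close> is
  compact.\<close>

definition trunc_dist :: "'m::metric_space \<Rightarrow> real \<Rightarrow> 'm option \<Rightarrow> real" where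
  "trunc_dist x \<rho> z = (case z of None \<Rightarrow> \<rho> | Some y \<Rightarrow> min (dist x y) \<rho>)"

lemma trunc_dist_simps [simp]:
  "trunc_dist x \<rho> None = \<rho>" "trunc_dist x \<rho> (Some y) = min (dist x y) \<rho>"
  by (simp_all add: trunc_dist_def)

lemma measurable_trunc_dist [measurable]: "trunc_dist x \<rho> \<in> borel_measurable cemetery_borel"
  by (rule measurable_from_cemetery_borel)
    (auto simp: comp_def intro!: borel_measurable_continuous_onI continuous_intros)

text \<open>For levels below \<rho>, superlevel sets are complements of compact balls together with
  \<open>None\<close>; for levels up to \<rho>, sublevel sets are open balls of M. Both are open in
  the compactification, whether or not M is compact.\<close>

lemma tendsto_trunc_dist:
  assumes "compact (cball x \<rho>)" and lim: "limitin cemetery_top f l G"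
  shows "((\<lambda>s. trunc_dist x \<rho> (f s)) \<longlongrightarrow> trunc_dist x \<rho> l) G"
proof (rule order_tendstoI)
  fix a assume a: "a < trunc_dist x \<rho> l"
  have "a < \<rho>" using a by (cases l) auto
  have eq: "{z. a < trunc_dist x \<rho> z} = insert None (Some ` (UNIV - cball x a))"
  proof (rule set_eqI)
    show "z \<in> {z. a < trunc_dist x \<rho> z} \<longleftrightarrow> z \<in> insert None (Some ` (UNIV - cball x a))" for z
      using \<open>a < \<rho>\<close> by (cases z) auto
  qed
  have "cball x a = cball x \<rho> \<inter> cball x a" using \<open>a < \<rho>\<close> by auto
  then have "compact (cball x a)" using assms(1) by (metis closed_cball compact_Int_closed)
  then have "openin cemetery_top {z. a < trunc_dist x \<rho> z}"
    unfolding eq openin_Alexandroff_compactification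
    by (intro disjI2 exI[of _ "cball x a"]) auto
  then show "\<forall>\<^sub>F s in G. a < trunc_dist x \<rho> (f s)"
    using lim a unfolding limitin_def by auto
next
  fix b assume b: "trunc_dist x \<rho> l < b"
  show "\<forall>\<^sub>F s in G. trunc_dist x \<rho> (f s) < b"
  proof (cases "\<rho> < b")
    case True
    have "trunc_dist x \<rho> z < b" for z
      using True by (cases z) (auto simp: min_less_iff_disj)
    then show ?thesis by simp
  next
    case False
    have "z \<in> {z. trunc_dist x \<rho> z < b} \<longleftrightarrow> z \<in> Some ` ball x b" for z
      using False by (cases z) (auto simp: min_less_iff_disj)
    then have "{z. trunc_dist x \<rho> z < b} = Some ` ball x b"
      by blast
    then have "openin cemetery_top {z. trunc_dist x \<rho> z < b}"
      by simp
    then show ?thesis using lim b unfolding limitin_def by auto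
  qed
qed

text \<open>Floor plus one, and not the ceiling: the grid point must lie strictly to the right of v
  even if v is itself on the grid, since only limits along \<open>at_right\<close> are
  available.\<close>

lemma right_grid_greater: "v < (of_int \<lfloor>real (Suc n) * v\<rfloor> + 1) / real (Suc n)"
  by (metis floor_correct mult.commute of_int_1 of_int_add of_nat_0_less_iff pos_less_divide_eq zero_less_Suc)

lemma filterlim_right_grid:
  "filterlim (\<lambda>n. (of_int \<lfloor>real (Suc n) * v\<rfloor> + 1) / real (Suc n)) (at_right v) sequentially"
  unfolding filterlim_at
proof
  show "\<forall>\<^sub>F n in sequentially. (of_int \<lfloor>real (Suc n) * v\<rfloor> + 1) / real (Suc n) \<in> {v<..} \<and>
    (of_int \<lfloor>real (Suc n) * v\<rfloor> + 1) / real (Suc n) \<noteq> v"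
    using right_grid_greater[of v] by (auto simp del: of_nat_Suc simp: less_imp_neq[symmetric])
  show "(\<lambda>n. (of_int \<lfloor>real (Suc n) * v\<rfloor> + 1) / real (Suc n)) \<longlonglongrightarrow> v"
  proof (rule tendsto_sandwich[of "\<lambda>_. v" _ _ "\<lambda>n. v + 1 / real (Suc n)"])
    have "(of_int \<lfloor>real (Suc n) * v\<rfloor> + 1) / real (Suc n) \<le> v + 1 / real (Suc n)" for n
      by (simp add: field_simps del: of_nat_Suc)
    then show "\<forall>\<^sub>F n in sequentially. (of_int \<lfloor>real (Suc n) * v\<rfloor> + 1) / real (Suc n) \<le> v + 1 / real (Suc n)"
      by (intro always_eventually allI)
    show "(\<lambda>n. v + 1 / real (Suc n)) \<longlonglongrightarrow> v"
      using tendsto_add[OF tendsto_const LIMSEQ_inverse_real_of_nat, of v] by (simp add: divide_inverse)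
    show "\<forall>\<^sub>F n in sequentially. v \<le> (of_int \<lfloor>real (Suc n) * v\<rfloor> + 1) / real (Suc n)"
      using right_grid_greater[of v] by (intro always_eventually allI less_imp_le)
  qed simp
qed

text \<open>Evaluating at the next grid point takes countably many times only, so each approximation
  is jointly measurable; right-continuity makes them converge pointwise.\<close>

lemma right_continuous_jointly_measurable:
  fixes Z :: "real \<Rightarrow> 'a \<Rightarrow> ennreal"
  assumes [measurable]: "\<And>v. Z v \<in> borel_measurable G"
    and cont: "\<And>\<omega> v. \<omega> \<in> space G \<Longrightarrow> ((\<lambda>s. Z s \<omega>) \<longlongrightarrow> Z v \<omega>) (at_right v)"
  shows "(\<lambda>(v, \<omega>). Z v \<omega>) \<in> borel_measurable (borel \<Otimes>\<^sub>M G)"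
proof (rule borel_measurable_LIMSEQ_order)
  show "(\<lambda>n. (\<lambda>(v, \<omega>). Z ((of_int \<lfloor>real (Suc n) * v\<rfloor> + 1) / real (Suc n)) \<omega>) p) \<longlonglongrightarrow> (\<lambda>(v, \<omega>). Z v \<omega>) p"
    if "p \<in> space (borel \<Otimes>\<^sub>M G)" for p
    using that filterlim_compose[OF cont filterlim_right_grid] by (auto simp: space_pair_measure)
  show "(\<lambda>(v, \<omega>). Z ((of_int \<lfloor>real (Suc n) * v\<rfloor> + 1) / real (Suc n)) \<omega>) \<in> borel_measurable (borel \<Otimes>\<^sub>M G)" for n
  proof -
    have [measurable]: "(\<lambda>p. \<lfloor>real (Suc n) * fst p\<rfloor>) \<in> (borel \<Otimes>\<^sub>M G) \<rightarrow>\<^sub>M count_space UNIV"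
      by measurable
    have "(\<lambda>p. Z ((of_int \<lfloor>real (Suc n) * fst p\<rfloor> + 1) / real (Suc n)) (snd p)) \<in> borel_measurable (borel \<Otimes>\<^sub>M G)"
      by (rule measurable_compose_countable[where f="\<lambda>i p. Z ((of_int i + 1) / real (Suc n)) (snd p)"]) measurable
    then show ?thesis by (simp add: case_prod_beta')
  qed
qed

lemma measurable_larger_sigma:
  assumes f: "f \<in> M \<rightarrow>\<^sub>M N" and "space M = space M'" and sub: "\<And>A. A \<in> sets M \<Longrightarrow> A \<in> sets M'"
  shows "f \<in> M' \<rightarrow>\<^sub>M N"
proof (rule measurableI)
  show "f x \<in> space N" if "x \<in> space M'" for x
    using measurable_space[OF f] that assms(2) by simp
  show "f -` A \<inter> space M' \<in> sets M'" if "A \<in> sets N" for A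
    using sub[OF measurable_sets[OF f that]] assms(2) by simp
qed

section \<open>Transition kernels and the strong Markov property for functions\<close>

context borel_standard_process
begin

lemma space_P [simp]: "space (P x) = \<Omega>"
  using sets_eq_imp_space_eq[OF sets_P] space_F by simp

lemma sets_P_cong [measurable_cong]: "sets (P x) = sets (F \<infinity>)"
  by (rule sets_P)

lemma sets_F_le: "A \<in> sets (F t) \<Longrightarrow> A \<in> sets (F \<infinity>)"
  using sets_F_mono[of t \<infinity>] by auto

lemma measurable_F_mono: "s \<le> t \<Longrightarrow> f \<in> F s \<rightarrow>\<^sub>M N \<Longrightarrow> f \<in> F t \<rightarrow>\<^sub>M N"
  using sets_F_mono[of s t] by (elim measurable_larger_sigma) (simp_all add: space_F subset_iff)

lemma measurable_X [measurable]: "X t \<in> F \<infinity> \<rightarrow>\<^sub>M cemetery_borel"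
  using measurable_F_mono[OF _ adapted, of t \<infinity>] by simp

text \<open>As an element of the Giry monad it yields measurability of the expectation of f(X t) in
  the starting point for all Borel f at once, from \<open>borel_transition\<close> on sets.\<close>

definition trans_kernel :: "ennreal \<Rightarrow> 'm option \<Rightarrow> 'm option measure" where
  "trans_kernel t z = distr (P z) cemetery_borel (X t)"

lemma measurable_trans_kernel [measurable]:
  "trans_kernel t \<in> cemetery_borel \<rightarrow>\<^sub>M subprob_algebra cemetery_borel"
proof (rule measurable_subprob_algebra)
  fix z
  interpret prob_space "P z" by (rule prob_P)
  show "subprob_space (trans_kernel t z)"
    unfolding trans_kernel_def by (intro prob_space_imp_subprob_space prob_space_distr) measurable
  show "sets (trans_kernel t z) = sets cemetery_borel"
    by (simp add: trans_kernel_def)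
next
  fix A :: "'m option set" assume A: "A \<in> sets cemetery_borel"
  have "(\<lambda>z. emeasure (trans_kernel t z) A) = (\<lambda>z. emeasure (P z) {\<omega>\<in>\<Omega>. X t \<omega> \<in> A})"
    unfolding trans_kernel_def using A
    by (subst emeasure_distr) (auto intro!: ext arg_cong[where f="emeasure _"])
  then show "(\<lambda>z. emeasure (trans_kernel t z) A) \<in> borel_measurable cemetery_borel"
    using borel_transition[OF A] by simp
qed

lemma nn_integral_trans_kernel:
  assumes "f \<in> borel_measurable cemetery_borel"
  shows "(\<integral>\<^sup>+ y. f y \<partial>trans_kernel t z) = (\<integral>\<^sup>+ \<omega>. f (X t \<omega>) \<partial>P z)"
  unfolding trans_kernel_def using assms by (intro nn_integral_distr) auto

lemma measurable_expectation_X [measurable]: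
  assumes "f \<in> borel_measurable cemetery_borel"
  shows "(\<lambda>z. \<integral>\<^sup>+ \<omega>. f (X t \<omega>) \<partial>P z) \<in> borel_measurable cemetery_borel"
  using measurable_compose[OF measurable_trans_kernel nn_integral_measurable_subprob_algebra[OF assms]]
  by (simp add: nn_integral_trans_kernel[OF assms])

lemma sets_pre_sigma_le: "stopping_time F T \<Longrightarrow> A \<in> sets (pre_sigma T) \<Longrightarrow> A \<in> sets (F \<infinity>)"
  using sets_pre_sigmaD[of T A \<infinity>] by simp

lemma measurable_pre_sigma_le: "stopping_time F T \<Longrightarrow> f \<in> pre_sigma T \<rightarrow>\<^sub>M N \<Longrightarrow> f \<in> F \<infinity> \<rightarrow>\<^sub>M N"
  by (elim measurable_larger_sigma sets_pre_sigma_le) (simp_all add: space_F space_pre_sigma sets_pre_sigma_le)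

lemma measurable_X_stopping: "stopping_time F T \<Longrightarrow> (\<lambda>\<omega>. X (T \<omega>) \<omega>) \<in> F \<infinity> \<rightarrow>\<^sub>M cemetery_borel"
  using measurable_pre_sigma_le stopped_measurable by auto

lemma stopping_time_plus:
  assumes "stopping_time F T" "t < \<infinity>"
  shows "stopping_time F (\<lambda>\<omega>. T \<omega> + t)"
proof
  fix s
  show "Measurable.pred (F s) (\<lambda>\<omega>. T \<omega> + t \<le> s)"
  proof (cases "t \<le> s")
    case True
    have eq: "T \<omega> + t \<le> s \<longleftrightarrow> T \<omega> \<le> s - t" for \<omega>
      using True assms(2) by (cases s; cases t; cases "T \<omega>")
        (auto simp: ennreal_plus[symmetric] ennreal_minus top_unique simp del: ennreal_plus)
    have "Measurable.pred (F s) (\<lambda>\<omega>. T \<omega> \<le> s - t)"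
      by (rule stopping_time_le_const[OF assms(1)]) (rule diff_le_self_ennreal)
    then show ?thesis unfolding eq .
  next
    case False
    then have "\<not> T \<omega> + t \<le> s" for \<omega>
      by (metis add.commute add_increasing2 order.trans order_refl zero_le)
    then show ?thesis by simp
  qed
qed

lemma sets_pre_sigma_const: "sets (pre_sigma (\<lambda>_. t)) = sets (F t)"
proof -
  have "A \<in> sets (pre_sigma (\<lambda>_. t)) \<longleftrightarrow> A \<in> sets (F t)" for A
  proof
    assume "A \<in> sets (pre_sigma (\<lambda>_. t))"
    then show "A \<in> sets (F t)"
      using sets_pre_sigmaD[OF stopping_time_const, of A t t] by simp
  next
    assume "A \<in> sets (F t)"
    then show "A \<in> sets (pre_sigma (\<lambda>_. t))"
    proof (intro sets_pre_sigmaI[OF stopping_time_const])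
      show "{\<omega> \<in> A. t \<le> s} \<in> sets (F s)" for s
        using sets_F_mono[of t s] \<open>A \<in> sets (F t)\<close> by (cases "t \<le> s") auto
    qed
  qed
  then show ?thesis by blast
qed

lemma measurable_pre_sigma_const: "f \<in> F t \<rightarrow>\<^sub>M N \<Longrightarrow> f \<in> pre_sigma (\<lambda>_. t) \<rightarrow>\<^sub>M N"
  by (elim measurable_larger_sigma) (simp_all add: space_F space_pre_sigma sets_pre_sigma_const)

text \<open>The locale provides the identity for indicators. It is extended in f for a fixed event
  (\<open>step\<close>) and then in the weight \<open>Z\<close>, each time by monotone
  approximation. General weights are needed because the large deviation bound conditions on products
  of functions of the past.\<close>

lemma strong_markov_fun:
  assumes T: "stopping_time F T" and t: "t < \<infinity>"
    and Z: "Z \<in> borel_measurable (pre_sigma T)" and f: "f \<in> borel_measurable cemetery_borel"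
  shows "(\<integral>\<^sup>+ \<omega>. Z \<omega> * f (X (T \<omega> + t) \<omega>) \<partial>P x) =
         (\<integral>\<^sup>+ \<omega>. Z \<omega> * (\<integral>\<^sup>+ \<omega>'. f (X t \<omega>') \<partial>P (X (T \<omega>) \<omega>)) \<partial>P x)"
proof -
  note [measurable] = measurable_X_stopping[OF T] measurable_X_stopping[OF stopping_time_plus[OF T t]]
  have step: "(\<integral>\<^sup>+ \<omega>. indicator L \<omega> * f (X (T \<omega> + t) \<omega>) \<partial>P x) =
         (\<integral>\<^sup>+ \<omega>. indicator L \<omega> * (\<integral>\<^sup>+ \<omega>'. f (X t \<omega>') \<partial>P (X (T \<omega>) \<omega>)) \<partial>P x)"
    if L: "L \<in> sets (pre_sigma T)" for L
    using f
  proof induction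
    case (cong f g)
    then show ?case by simp
  next
    case (set A)
    have LF [measurable]: "L \<in> sets (F \<infinity>)" using sets_pre_sigma_le[OF T L] .
    note set [measurable]
    have sub: "L \<subseteq> \<Omega>" using sets.sets_into_space[OF LF] by (simp add: space_F)
    have "(\<integral>\<^sup>+ \<omega>. indicator L \<omega> * indicator A (X (T \<omega> + t) \<omega>) \<partial>P x) =
        (\<integral>\<^sup>+ \<omega>. indicator {\<omega>\<in>L. X (T \<omega> + t) \<omega> \<in> A} \<omega> \<partial>P x)"
      by (intro nn_integral_cong) (auto split: split_indicator)
    also have "\<dots> = emeasure (P x) {\<omega>\<in>L. X (T \<omega> + t) \<omega> \<in> A}"
    proof (rule nn_integral_indicator)
      have "{\<omega>\<in>L. X (T \<omega> + t) \<omega> \<in> A} = L \<inter> {\<omega>\<in>space (F \<infinity>). X (T \<omega> + t) \<omega> \<in> A}"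
        using sub by (auto simp: space_F)
      moreover have "L \<inter> {\<omega>\<in>space (F \<infinity>). X (T \<omega> + t) \<omega> \<in> A} \<in> sets (F \<infinity>)"
        by measurable
      ultimately show "{\<omega>\<in>L. X (T \<omega> + t) \<omega> \<in> A} \<in> sets (P x)"
        unfolding sets_P by (simp only:)
    qed
    also have "\<dots> = (\<integral>\<^sup>+ \<omega>\<in>L. emeasure (P (X (T \<omega>) \<omega>)) {\<omega>'\<in>\<Omega>. X t \<omega>' \<in> A} \<partial>P x)"
      by (rule strong_markov[OF T set L])
    also have "\<dots> = (\<integral>\<^sup>+ \<omega>. indicator L \<omega> * (\<integral>\<^sup>+ \<omega>'. indicator A (X t \<omega>') \<partial>P (X (T \<omega>) \<omega>)) \<partial>P x)"
    proof (rule nn_integral_cong)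
      fix \<omega>
      have "emeasure (P z) {\<omega>'\<in>\<Omega>. X t \<omega>' \<in> A} = (\<integral>\<^sup>+ \<omega>'. indicator A (X t \<omega>') \<partial>P z)" for z
      proof -
        have "(\<integral>\<^sup>+ \<omega>'. indicator A (X t \<omega>') \<partial>P z) = (\<integral>\<^sup>+ \<omega>'. indicator {\<omega>'\<in>\<Omega>. X t \<omega>' \<in> A} \<omega>' \<partial>P z)"
          by (intro nn_integral_cong) (auto split: split_indicator)
        also have "\<dots> = emeasure (P z) {\<omega>'\<in>\<Omega>. X t \<omega>' \<in> A}"
        proof (rule nn_integral_indicator)
          have "{\<omega>'\<in>space (F \<infinity>). X t \<omega>' \<in> A} \<in> sets (F \<infinity>)" by measurable
          then show "{\<omega>'\<in>\<Omega>. X t \<omega>' \<in> A} \<in> sets (P z)" unfolding sets_P space_F .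
        qed
        finally show ?thesis by simp
      qed
      then show "emeasure (P (X (T \<omega>) \<omega>)) {\<omega>' \<in> \<Omega>. X t \<omega>' \<in> A} * indicator L \<omega> =
        indicator L \<omega> * (\<integral>\<^sup>+ \<omega>'. indicator A (X t \<omega>') \<partial>P (X (T \<omega>) \<omega>))"
        by (simp add: mult.commute)
    qed
    finally show ?case .
  next
    case (mult u c)
    have LF [measurable]: "L \<in> sets (F \<infinity>)" using sets_pre_sigma_le[OF T L] .
    note mult(2) [measurable]
    show ?case
      using mult by (simp add: nn_integral_cmult mult.left_commute[of _ c])
  next
    case (add u v)
    have LF [measurable]: "L \<in> sets (F \<infinity>)" using sets_pre_sigma_le[OF T L] .
    note add(1,3) [measurable]
    show ?case
      using add by (simp add: nn_integral_add distrib_left)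
  next
    case (seq U)
    have LF [measurable]: "L \<in> sets (F \<infinity>)" using sets_pre_sigma_le[OF T L] .
    note seq(1) [measurable]
    have inc: "incseq (\<lambda>i \<omega>. U i (g \<omega>))" for g :: "'w \<Rightarrow> _"
      using \<open>incseq U\<close> by (auto simp: incseq_def le_fun_def)
    have inc2: "incseq (\<lambda>i. \<integral>\<^sup>+ \<omega>'. U i (X t \<omega>') \<partial>P z)" for z
      using inc by (auto simp: incseq_def le_fun_def intro!: nn_integral_mono)
    have incm: "incseq (\<lambda>i \<omega>. indicator L \<omega> * U i (X (T \<omega> + t) \<omega>))"
      using \<open>incseq U\<close> by (auto simp: incseq_def le_fun_def intro!: mult_left_mono)
    have incm2: "incseq (\<lambda>i \<omega>. indicator L \<omega> * (\<integral>\<^sup>+ \<omega>'. U i (X t \<omega>') \<partial>P (X (T \<omega>) \<omega>)))"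
      using inc2 by (auto simp: incseq_def le_fun_def intro!: mult_left_mono)
    have "(\<integral>\<^sup>+ \<omega>. indicator L \<omega> * (SUP i. U i) (X (T \<omega> + t) \<omega>) \<partial>P x) =
          (\<integral>\<^sup>+ \<omega>. (SUP i. indicator L \<omega> * U i (X (T \<omega> + t) \<omega>)) \<partial>P x)"
      by (simp add: SUP_mult_left_ennreal image_comp)
    also have "\<dots> = (SUP i. \<integral>\<^sup>+ \<omega>. indicator L \<omega> * U i (X (T \<omega> + t) \<omega>) \<partial>P x)"
      by (rule nn_integral_monotone_convergence_SUP[OF incm]) measurable
    also have "\<dots> = (SUP i. \<integral>\<^sup>+ \<omega>. indicator L \<omega> * (\<integral>\<^sup>+ \<omega>'. U i (X t \<omega>') \<partial>P (X (T \<omega>) \<omega>)) \<partial>P x)"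
      using seq.IH by simp
    also have "\<dots> = (\<integral>\<^sup>+ \<omega>. (SUP i. indicator L \<omega> * (\<integral>\<^sup>+ \<omega>'. U i (X t \<omega>') \<partial>P (X (T \<omega>) \<omega>))) \<partial>P x)"
      by (rule nn_integral_monotone_convergence_SUP[symmetric, OF incm2]) measurable
    also have "\<dots> = (\<integral>\<^sup>+ \<omega>. indicator L \<omega> * (\<integral>\<^sup>+ \<omega>'. (SUP i. U i) (X t \<omega>') \<partial>P (X (T \<omega>) \<omega>)) \<partial>P x)"
    proof (intro nn_integral_cong)
      fix \<omega>
      have "(\<integral>\<^sup>+ \<omega>'. (SUP i. U i) (X t \<omega>') \<partial>P z) = (SUP i. \<integral>\<^sup>+ \<omega>'. U i (X t \<omega>') \<partial>P z)" for z
        using nn_integral_monotone_convergence_SUP[OF inc, of "X t" "P z"] by (simp add: image_comp)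
      then show "(SUP i. indicator L \<omega> * (\<integral>\<^sup>+ \<omega>'. U i (X t \<omega>') \<partial>P (X (T \<omega>) \<omega>))) =
         indicator L \<omega> * (\<integral>\<^sup>+ \<omega>'. (SUP i. U i) (X t \<omega>') \<partial>P (X (T \<omega>) \<omega>))"
        by (simp add: SUP_mult_left_ennreal)
    qed
    finally show ?case by simp
  qed
  note f [measurable]
  show ?thesis
    using Z
  proof induction
    case (cong g h)
    then have "(\<integral>\<^sup>+ \<omega>. h \<omega> * k \<omega> \<partial>P x) = (\<integral>\<^sup>+ \<omega>. g \<omega> * k \<omega> \<partial>P x)" for k
      by (intro nn_integral_cong) (simp add: space_pre_sigma)
    then show ?case using cong by simp
  next
    case (set A)
    then show ?case by (rule step)
  next
    case (mult u c)
    note [measurable] = measurable_pre_sigma_le[OF T mult(2)]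
    show ?case
      using mult by (simp add: nn_integral_cmult mult.assoc)
  next
    case (add u v)
    note [measurable] = measurable_pre_sigma_le[OF T add(1)] measurable_pre_sigma_le[OF T add(3)]
    show ?case
      using add by (simp add: nn_integral_add distrib_right)
  next
    case (seq U)
    note [measurable] = measurable_pre_sigma_le[OF T seq(1)]
    have inc: "incseq (\<lambda>i \<omega>. U i \<omega> * g \<omega>)" for g
      using \<open>incseq U\<close> by (auto simp: incseq_def le_fun_def intro!: mult_right_mono)
    have *: "(\<integral>\<^sup>+ \<omega>. (SUP i. U i) \<omega> * g \<omega> \<partial>P x) = (SUP i. \<integral>\<^sup>+ \<omega>. U i \<omega> * g \<omega> \<partial>P x)"
      if [measurable]: "g \<in> borel_measurable (F \<infinity>)" for g
      using nn_integral_monotone_convergence_SUP[OF inc, of g "P x"] by (simp add: image_comp SUP_mult_right_ennreal)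
    show ?case
      
      by (subst (1 2) *) (measurable, use seq.IH in simp)
  qed
qed

section \<open>Integrals and finite-dimensional laws of the path\<close>

lemma limitin_X_real:
  assumes "\<omega> \<in> \<Omega>" "0 \<le> v"
  shows "limitin cemetery_top (\<lambda>s. X (ennreal s) \<omega>) (X (ennreal v) \<omega>) (at_right v)"
proof -
  have "filterlim ennreal (at_right (ennreal v)) (at_right v)"
    unfolding filterlim_at
  proof
    show "\<forall>\<^sub>F s in at_right v. ennreal s \<in> {ennreal v<..} \<and> ennreal s \<noteq> ennreal v"
      using eventually_at_right_less[of v] by eventually_elim (use assms(2) in \<open>auto simp: ennreal_less_iff ennreal_inj\<close>)
  qed (intro tendsto_intros)
  then show ?thesis
    using right_continuous[OF assms(1), of "ennreal v"]
    unfolding limitin_def by (auto dest: filterlim_iff[THEN iffD1])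
qed

definition right_cont :: "('m option \<Rightarrow> ennreal) \<Rightarrow> bool" where
  "right_cont w \<longleftrightarrow> w \<in> borel_measurable cemetery_borel \<and>
     (\<forall>\<omega>\<in>\<Omega>. \<forall>v\<ge>0. ((\<lambda>s. w (X (ennreal s) \<omega>)) \<longlongrightarrow> w (X (ennreal v) \<omega>)) (at_right v))"

lemma right_cont_measurable: "right_cont w \<Longrightarrow> w \<in> borel_measurable cemetery_borel"
  by (simp add: right_cont_def)

lemma right_cont_trunc_dist:
  assumes "compact (cball x \<rho>)" "continuous_on UNIV f"
  shows "right_cont (\<lambda>z. ennreal (f (trunc_dist x \<rho> z)))"
  unfolding right_cont_def
proof (intro conjI ballI allI impI)
  have [measurable]: "f \<in> borel_measurable borel" using assms(2) by (rule borel_measurable_continuous_onI)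
  show "(\<lambda>z. ennreal (f (trunc_dist x \<rho> z))) \<in> borel_measurable cemetery_borel" by measurable
  fix \<omega> v assume "\<omega> \<in> \<Omega>" "0 \<le> (v::real)"
  have "isCont f a" for a using assms(2) by (simp add: continuous_on_eq_continuous_at)
  from isCont_tendsto_compose[OF this tendsto_trunc_dist[OF assms(1) limitin_X_real[OF \<open>\<omega> \<in> \<Omega>\<close> \<open>0 \<le> v\<close>]]]
  show "((\<lambda>s. ennreal (f (trunc_dist x \<rho> (X (ennreal s) \<omega>)))) \<longlongrightarrow> ennreal (f (trunc_dist x \<rho> (X (ennreal v) \<omega>)))) (at_right v)"
    by (intro tendsto_intros)
qed

lemma eventually_alive:
  assumes "\<omega> \<in> \<Omega>" "0 \<le> v" "X (ennreal v) \<omega> \<noteq> None"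
  shows "\<forall>\<^sub>F s in at_right v. X (ennreal s) \<omega> \<noteq> None"
proof -
  have "openin cemetery_top (Some ` (UNIV :: 'm set))" by simp
  moreover have "X (ennreal v) \<omega> \<in> Some ` UNIV" using assms(3) by auto
  ultimately have "\<forall>\<^sub>F s in at_right v. X (ennreal s) \<omega> \<in> Some ` UNIV"
    using limitin_X_real[OF assms(1,2)] unfolding limitin_def by blast
  then show ?thesis by eventually_elim auto
qed

text \<open>A living path stays alive for a while because M is open in its compactification, and a
  dead one stays dead because the cemetery is absorbing.\<close>

lemma right_cont_dead: "right_cont (indicator {None})"
  unfolding right_cont_def
proof (intro conjI ballI allI impI)
  show "indicator {None} \<in> borel_measurable (cemetery_borel :: 'm option measure)"
  proof (intro borel_measurable_indicator)
    have "Some -` {None :: 'm option} = {}" by auto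
    then show "{None :: 'm option} \<in> sets cemetery_borel" by (simp add: sets_cemetery_borel_iff)
  qed
  fix \<omega> v assume *: "\<omega> \<in> \<Omega>" "0 \<le> (v::real)"
  have "\<forall>\<^sub>F s in at_right v. (indicator {None} (X (ennreal v) \<omega>) :: ennreal) = indicator {None} (X (ennreal s) \<omega>)"
  proof (cases "X (ennreal v) \<omega> = None")
    case True
    show ?thesis
      using eventually_at_right_less[of v]
    proof eventually_elim
      case (elim s)
      have "X (ennreal s) \<omega> = None"
        by (rule cemetery_absorbing[OF *(1) _ True]) (use elim in \<open>auto intro: ennreal_leI\<close>)
      then show ?case using True by simp
    qed
  next
    case False
    show ?thesis
      using eventually_alive[OF * False] by eventually_elim (use False in auto)
  qed
  then show "((\<lambda>s. indicator {None} (X (ennreal s) \<omega>) :: ennreal) \<longlongrightarrow> indicator {None} (X (ennreal v) \<omega>)) (at_right v)"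
    by (rule Lim_transform_eventually[OF tendsto_const])
qed

lemma right_cont_add:
  assumes "right_cont w" "right_cont w'"
  shows "right_cont (\<lambda>z. w z + w' z)"
  using assms unfolding right_cont_def by (auto intro!: tendsto_add)

lemma tendsto_right_cont_shift:
  assumes w: "right_cont w" and \<omega>: "\<omega> \<in> \<Omega>"
  shows "((\<lambda>s. w (X (t + ennreal s) \<omega>)) \<longlongrightarrow> w (X (t + ennreal v) \<omega>)) (at_right v)"
proof (cases "v < 0 \<or> t = \<infinity>")
  case True
  have "\<forall>\<^sub>F s in at_right v. w (X (t + ennreal v) \<omega>) = w (X (t + ennreal s) \<omega>)"
  proof (cases "v < 0")
    case True
    then have "\<forall>\<^sub>F s in at_right v. s < 0"
      by (auto simp: eventually_at_right_field)
    then show ?thesis by eventually_elim (use True in \<open>simp add: ennreal_neg\<close>)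
  qed (use True in simp)
  then show ?thesis
    by (rule Lim_transform_eventually[OF tendsto_const])
next
  case False
  then obtain \<tau> where \<tau>: "t = ennreal \<tau>" "0 \<le> \<tau>" by (cases t) auto
  have v: "0 \<le> v" using False by simp
  have *: "((\<lambda>s. w (X (ennreal s) \<omega>)) \<longlongrightarrow> w (X (ennreal (\<tau> + v)) \<omega>)) (at_right (\<tau> + v))"
    using w \<omega> v \<tau> by (auto simp: right_cont_def simp del: ennreal_plus)
  have "filterlim (\<lambda>s. \<tau> + s) (at_right (\<tau> + v)) (at_right v)"
    unfolding filterlim_at using eventually_at_right_less[of v] by (auto elim!: eventually_mono intro!: tendsto_intros)
  from filterlim_compose[OF * this]
  have **: "((\<lambda>s. w (X (ennreal (\<tau> + s)) \<omega>)) \<longlongrightarrow> w (X (ennreal (\<tau> + v)) \<omega>)) (at_right v)" .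
  have "\<forall>\<^sub>F s in at_right v. w (X (ennreal (\<tau> + s)) \<omega>) = w (X (t + ennreal s) \<omega>)"
    using eventually_at_right_less[of v] by eventually_elim (use \<tau> v in \<open>simp add: ennreal_plus[symmetric] del: ennreal_plus\<close>)
  from Lim_transform_eventually[OF ** this]
  show ?thesis using \<tau> v by (simp add: ennreal_plus[symmetric] del: ennreal_plus)
qed

lemma measurable_right_cont_path:
  assumes w: "right_cont w" and G: "space G = \<Omega>" "\<And>v. X (ennreal v) \<in> G \<rightarrow>\<^sub>M cemetery_borel"
  shows "(\<lambda>(v, \<omega>). w (X (ennreal v) \<omega>)) \<in> borel_measurable (borel \<Otimes>\<^sub>M G)"
proof (rule right_continuous_jointly_measurable)
  show "(\<lambda>\<omega>. w (X (ennreal v) \<omega>)) \<in> borel_measurable G" for v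
    by (rule measurable_compose[OF G(2) right_cont_measurable[OF w]])
  show "((\<lambda>s. w (X (ennreal s) \<omega>)) \<longlongrightarrow> w (X (ennreal v) \<omega>)) (at_right v)" if "\<omega> \<in> space G" for \<omega> v
    using tendsto_right_cont_shift[OF w, of \<omega> 0 v] that G(1) by simp
qed

text \<open>Progressive measurability: freezing the path at time u keeps the discretisation from the
  right from looking beyond u, so that information up to u suffices.\<close>

lemma measurable_right_cont_path_upto:
  assumes w: "right_cont w" and G: "space G = \<Omega>"
    and X: "\<And>v. 0 \<le> v \<Longrightarrow> v \<le> u \<Longrightarrow> X (ennreal v) \<in> G \<rightarrow>\<^sub>M cemetery_borel" and u: "0 \<le> u"
  shows "(\<lambda>(v, \<omega>). w (X (ennreal (min v u)) \<omega>)) \<in> borel_measurable (borel \<Otimes>\<^sub>M G)"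
proof (rule right_continuous_jointly_measurable)
  show "(\<lambda>\<omega>. w (X (ennreal (min v u)) \<omega>)) \<in> borel_measurable G" for v
  proof -
    \<comment> \<open>Negative v stand for time 0, since \<open>ennreal\<close> sends them to
      0.\<close>
    have "X (ennreal (min v u)) \<in> G \<rightarrow>\<^sub>M cemetery_borel"
      using X[of "max 0 (min v u)"] u by (cases "0 \<le> v") (auto simp: ennreal_neg min_def max_def)
    then show ?thesis by (rule measurable_compose[OF _ right_cont_measurable[OF w]])
  qed
  show "((\<lambda>s. w (X (ennreal (min s u)) \<omega>)) \<longlongrightarrow> w (X (ennreal (min v u)) \<omega>)) (at_right v)" if "\<omega> \<in> space G" for \<omega> v
  proof (cases "v < u")
    case True
    then have "\<forall>\<^sub>F s in at_right v. s < u" by (auto simp: eventually_at_right_field)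
    then have "\<forall>\<^sub>F s in at_right v. w (X (ennreal s) \<omega>) = w (X (ennreal (min s u)) \<omega>)"
      by eventually_elim (simp add: min_def)
    from Lim_transform_eventually[OF _ this] show ?thesis
      using tendsto_right_cont_shift[OF w, of \<omega> 0 v] that G(1) True by (simp add: min_def)
  next
    case False
    have "\<forall>\<^sub>F s in at_right v. w (X (ennreal (min v u)) \<omega>) = w (X (ennreal (min s u)) \<omega>)"
      using eventually_at_right_less[of v] by eventually_elim (use False in \<open>simp add: min_def\<close>)
    then show ?thesis by (rule Lim_transform_eventually[OF tendsto_const])
  qed
qed

text \<open>Dominated convergence, with dominating function 1, carries right-continuity in time over
  from the paths to their expectation.\<close>

lemma measurable_expectation_path:
  assumes w: "right_cont w" and bd: "\<And>z. w z \<le> 1"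
  shows "(\<lambda>(v, z). \<integral>\<^sup>+ \<omega>. w (X (ennreal v) \<omega>) \<partial>P z) \<in> borel_measurable (borel \<Otimes>\<^sub>M cemetery_borel)"
proof (rule right_continuous_jointly_measurable)
  note [measurable] = right_cont_measurable[OF w]
  show "(\<lambda>z. \<integral>\<^sup>+ \<omega>. w (X (ennreal v) \<omega>) \<partial>P z) \<in> borel_measurable cemetery_borel" for v
    by measurable
  fix z v
  interpret prob_space "P z" by (rule prob_P)
  show "((\<lambda>s. \<integral>\<^sup>+ \<omega>. w (X (ennreal s) \<omega>) \<partial>P z) \<longlongrightarrow> (\<integral>\<^sup>+ \<omega>. w (X (ennreal v) \<omega>) \<partial>P z)) (at_right v)"
    unfolding tendsto_at_iff_sequentially comp_def
  proof (intro allI impI)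
    fix S :: "nat \<Rightarrow> real" assume S: "\<forall>i. S i \<in> {v<..} - {v}" "S \<longlonglongrightarrow> v"
    then have lim: "filterlim S (at_right v) sequentially"
      by (auto simp: filterlim_at less_imp_neq[symmetric])
    show "(\<lambda>n. \<integral>\<^sup>+ \<omega>. w (X (ennreal (S n)) \<omega>) \<partial>P z) \<longlonglongrightarrow> (\<integral>\<^sup>+ \<omega>. w (X (ennreal v) \<omega>) \<partial>P z)"
    proof (rule nn_integral_dominated_convergence[where w="\<lambda>_. 1"])
      show "AE \<omega> in P z. (\<lambda>n. w (X (ennreal (S n)) \<omega>)) \<longlonglongrightarrow> w (X (ennreal v) \<omega>)"
        using filterlim_compose[OF tendsto_right_cont_shift[OF w, of _ 0 v] lim] by (intro AE_I2) simp
    qed (use bd in \<open>auto simp: emeasure_space_1[simplified]\<close>)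
  qed
qed

lemma measurable_path_shift:
  assumes T: "stopping_time F T" and w: "right_cont w"
  shows "(\<lambda>(v, \<omega>). w (X (T \<omega> + ennreal v) \<omega>)) \<in> borel_measurable (borel \<Otimes>\<^sub>M F \<infinity>)"
proof (rule right_continuous_jointly_measurable)
  show "(\<lambda>\<omega>. w (X (T \<omega> + ennreal v) \<omega>)) \<in> borel_measurable (F \<infinity>)" for v
    by (rule measurable_compose[OF measurable_X_stopping[OF stopping_time_plus[OF T]] right_cont_measurable[OF w]]) simp
  show "((\<lambda>s. w (X (T \<omega> + ennreal s) \<omega>)) \<longlongrightarrow> w (X (T \<omega> + ennreal v) \<omega>)) (at_right v)"
    if "\<omega> \<in> space (F \<infinity>)" for \<omega> v
    using tendsto_right_cont_shift[OF w] that space_F by auto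
qed

text \<open>Fubini reduces the time integral to single times, where the strong Markov property
  applies. The first form suits bounds at each fixed time v, the second suits bounds on the
  conditional expectation of the whole integral.\<close>

lemma strong_markov_integral:
  assumes T: "stopping_time F T" and w: "right_cont w" and bd: "\<And>z. w z \<le> 1"
    and Z: "Z \<in> borel_measurable (pre_sigma T)" and [measurable]: "B \<in> sets borel"
  shows "(\<integral>\<^sup>+ \<omega>. Z \<omega> * (\<integral>\<^sup>+ v\<in>B. w (X (T \<omega> + ennreal v) \<omega>) \<partial>lborel) \<partial>P x) =
         (\<integral>\<^sup>+ v\<in>B. (\<integral>\<^sup>+ \<omega>. Z \<omega> * (\<integral>\<^sup>+ \<omega>'. w (X (ennreal v) \<omega>') \<partial>P (X (T \<omega>) \<omega>)) \<partial>P x) \<partial>lborel)"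
    and "(\<integral>\<^sup>+ \<omega>. Z \<omega> * (\<integral>\<^sup>+ v\<in>B. w (X (T \<omega> + ennreal v) \<omega>) \<partial>lborel) \<partial>P x) =
         (\<integral>\<^sup>+ \<omega>. Z \<omega> * (\<integral>\<^sup>+ v\<in>B. (\<integral>\<^sup>+ \<omega>'. w (X (ennreal v) \<omega>') \<partial>P (X (T \<omega>) \<omega>)) \<partial>lborel) \<partial>P x)"
proof -
  interpret prob_space "P x" by (rule prob_P)
  interpret pair_sigma_finite lborel "P x" by standard
  note [measurable] = measurable_pre_sigma_le[OF T Z] measurable_X_stopping[OF T]
  have [measurable]: "(\<lambda>(v, \<omega>). w (X (T \<omega> + ennreal v) \<omega>)) \<in> borel_measurable (lborel \<Otimes>\<^sub>M P x)"
    using measurable_path_shift[OF T w]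
    unfolding measurable_cong_sets[OF sets_pair_measure_cong[OF sets_lborel sets_P] refl] .
  have [measurable]: "(\<lambda>(v, \<omega>). \<integral>\<^sup>+ \<omega>'. w (X (ennreal v) \<omega>') \<partial>P (X (T \<omega>) \<omega>)) \<in> borel_measurable (lborel \<Otimes>\<^sub>M P x)"
  proof -
    have "(\<lambda>p. (\<lambda>(v, z). \<integral>\<^sup>+ \<omega>. w (X (ennreal v) \<omega>) \<partial>P z) (fst p, X (T (snd p)) (snd p)))
      \<in> borel_measurable (lborel \<Otimes>\<^sub>M P x)"
      by (rule measurable_compose[OF _ measurable_expectation_path[OF w bd]]) measurable
    then show ?thesis by (simp add: case_prod_beta')
  qed
  have swap: "(\<integral>\<^sup>+ \<omega>. Z \<omega> * (\<integral>\<^sup>+ v\<in>B. g v \<omega> \<partial>lborel) \<partial>P x) = (\<integral>\<^sup>+ v\<in>B. (\<integral>\<^sup>+ \<omega>. Z \<omega> * g v \<omega> \<partial>P x) \<partial>lborel)"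
    if [measurable]: "(\<lambda>(v, \<omega>). g v \<omega>) \<in> borel_measurable (lborel \<Otimes>\<^sub>M P x)" for g
  proof -
    have "(\<integral>\<^sup>+ \<omega>. Z \<omega> * (\<integral>\<^sup>+ v\<in>B. g v \<omega> \<partial>lborel) \<partial>P x) =
      (\<integral>\<^sup>+ \<omega>. (\<integral>\<^sup>+ v. Z \<omega> * (g v \<omega> * indicator B v) \<partial>lborel) \<partial>P x)"
    proof (intro nn_integral_cong)
      fix \<omega> assume "\<omega> \<in> space (P x)"
      then have [measurable]: "(\<lambda>v. g v \<omega>) \<in> borel_measurable lborel"
        using measurable_Pair1[OF that] by simp
      show "Z \<omega> * (\<integral>\<^sup>+ v\<in>B. g v \<omega> \<partial>lborel) = (\<integral>\<^sup>+ v. Z \<omega> * (g v \<omega> * indicator B v) \<partial>lborel)"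
        by (subst nn_integral_cmult) measurable
    qed
    also have "\<dots> = (\<integral>\<^sup>+ v. (\<integral>\<^sup>+ \<omega>. Z \<omega> * (g v \<omega> * indicator B v) \<partial>P x) \<partial>lborel)"
      by (rule Fubini') measurable
    also have "\<dots> = (\<integral>\<^sup>+ v\<in>B. (\<integral>\<^sup>+ \<omega>. Z \<omega> * g v \<omega> \<partial>P x) \<partial>lborel)"
      by (intro nn_integral_cong) (auto split: split_indicator)
    finally show ?thesis .
  qed
  have "(\<integral>\<^sup>+ \<omega>. Z \<omega> * w (X (T \<omega> + ennreal v) \<omega>) \<partial>P x) =
        (\<integral>\<^sup>+ \<omega>. Z \<omega> * (\<integral>\<^sup>+ \<omega>'. w (X (ennreal v) \<omega>') \<partial>P (X (T \<omega>) \<omega>)) \<partial>P x)" for v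
    by (rule strong_markov_fun[OF T _ Z right_cont_measurable[OF w]]) simp
  then show *: "(\<integral>\<^sup>+ \<omega>. Z \<omega> * (\<integral>\<^sup>+ v\<in>B. w (X (T \<omega> + ennreal v) \<omega>) \<partial>lborel) \<partial>P x) =
         (\<integral>\<^sup>+ v\<in>B. (\<integral>\<^sup>+ \<omega>. Z \<omega> * (\<integral>\<^sup>+ \<omega>'. w (X (ennreal v) \<omega>') \<partial>P (X (T \<omega>) \<omega>)) \<partial>P x) \<partial>lborel)"
    by (subst swap) simp_all
  show "(\<integral>\<^sup>+ \<omega>. Z \<omega> * (\<integral>\<^sup>+ v\<in>B. w (X (T \<omega> + ennreal v) \<omega>) \<partial>lborel) \<partial>P x) =
         (\<integral>\<^sup>+ \<omega>. Z \<omega> * (\<integral>\<^sup>+ v\<in>B. (\<integral>\<^sup>+ \<omega>'. w (X (ennreal v) \<omega>') \<partial>P (X (T \<omega>) \<omega>)) \<partial>lborel) \<partial>P x)"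
    unfolding * by (rule swap[symmetric]) measurable
qed

text \<open>The point is the order of quantifiers: one function q serves every t, every starting
  point and every event L of the past. Taking t = 0 later identifies it with the probability of the
  same event started afresh. The induction peels off the earliest time, at which it
  conditions.\<close>

lemma markov_finite_dimensional:
  assumes A: "\<And>i. A i \<in> sets cemetery_borel" and I: "finite I" and b: "b < \<infinity>" "\<And>i. i \<in> I \<Longrightarrow> b \<le> i \<and> i < \<infinity>"
  shows "\<exists>q\<in>borel_measurable cemetery_borel. \<forall>t<\<infinity>. \<forall>x. \<forall>L\<in>sets (F (t + b)).
    emeasure (P x) {\<omega>\<in>L. \<forall>i\<in>I. X (t + i) \<omega> \<in> A i} = (\<integral>\<^sup>+ \<omega>. indicator L \<omega> * q (X (t + b) \<omega>) \<partial>P x)"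
  using I b
proof (induction arbitrary: b rule: finite_linorder_min_induct)
  case empty
  show ?case
    using sets_F_le by (intro bexI[of _ "\<lambda>_. 1"]) (auto simp: sets_P nn_integral_indicator)
next
  case (insert c I)
  have c: "b \<le> c" "c < \<infinity>" using insert.prems by auto
  obtain q where q [measurable]: "q \<in> borel_measurable cemetery_borel"
    and eq: "\<And>t x L. t < \<infinity> \<Longrightarrow> L \<in> sets (F (t + c)) \<Longrightarrow>
      emeasure (P x) {\<omega>\<in>L. \<forall>i\<in>I. X (t + i) \<omega> \<in> A i} = (\<integral>\<^sup>+ \<omega>. indicator L \<omega> * q (X (t + c) \<omega>) \<partial>P x)"
  proof -
    have "c \<le> i \<and> i < \<infinity>" if "i \<in> I" for i
      using insert.prems insert.hyps that by (auto intro: less_imp_le)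
    from insert.IH[OF c(2) this] that show ?thesis by blast
  qed
  note A [measurable]
  \<comment> \<open>Run from time b to the earliest time c, demand to be in \<open>A c\<close>
    there, and continue with the q already found for the later times.\<close>
  define q' where "q' z = (\<integral>\<^sup>+ \<omega>. indicator (A c) (X (c - b) \<omega>) * q (X (c - b) \<omega>) \<partial>P z)" for z
  have q' [measurable]: "q' \<in> borel_measurable cemetery_borel"
    unfolding q'_def by (rule measurable_expectation_X[of "\<lambda>z. indicator (A c) z * q z"]) measurable
  have "emeasure (P x) {\<omega>\<in>L. \<forall>i\<in>insert c I. X (t + i) \<omega> \<in> A i} = (\<integral>\<^sup>+ \<omega>. indicator L \<omega> * q' (X (t + b) \<omega>) \<partial>P x)"
    if t: "t < \<infinity>" and L: "L \<in> sets (F (t + b))" for t x L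
  proof -
    define L' where "L' = {\<omega>\<in>L. X (t + c) \<omega> \<in> A c}"
    have sub: "L \<subseteq> \<Omega>" using sets.sets_into_space[OF L] by (simp add: space_F)
    have "L' = L \<inter> (X (t + c) -` A c \<inter> space (F (t + c)))"
      using sub by (auto simp: L'_def space_F)
    moreover have "L \<in> sets (F (t + c))" using L sets_F_mono[of "t + b" "t + c"] c by (auto simp: add_left_mono)
    moreover have "X (t + c) -` A c \<inter> space (F (t + c)) \<in> sets (F (t + c))"
      by (rule measurable_sets[OF adapted A])
    ultimately have L': "L' \<in> sets (F (t + c))" by simp
    have tc: "t + c = (t + b) + (c - b)"
      using c by (simp add: add.assoc add_diff_inverse_ennreal)
    have "emeasure (P x) {\<omega>\<in>L. \<forall>i\<in>insert c I. X (t + i) \<omega> \<in> A i} = emeasure (P x) {\<omega>\<in>L'. \<forall>i\<in>I. X (t + i) \<omega> \<in> A i}"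
      by (intro arg_cong[where f="emeasure _"]) (auto simp: L'_def)
    also have "\<dots> = (\<integral>\<^sup>+ \<omega>. indicator L' \<omega> * q (X (t + c) \<omega>) \<partial>P x)"
      by (rule eq[OF t L'])
    also have "\<dots> = (\<integral>\<^sup>+ \<omega>. indicator L \<omega> * (indicator (A c) (X ((t + b) + (c - b)) \<omega>) * q (X ((t + b) + (c - b)) \<omega>)) \<partial>P x)"
      unfolding tc[symmetric] by (intro nn_integral_cong) (auto simp: L'_def split: split_indicator)
    also have "\<dots> = (\<integral>\<^sup>+ \<omega>. indicator L \<omega> * q' (X (t + b) \<omega>) \<partial>P x)"
      unfolding q'_def
    proof (rule strong_markov_fun[where f="\<lambda>z. indicator (A c) z * q z", OF stopping_time_const])
      show "c - b < \<infinity>" by (rule le_less_trans[OF diff_le_self_ennreal c(2)])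
      show "indicator L \<in> borel_measurable (pre_sigma (\<lambda>_. t + b))"
        using L by (intro borel_measurable_indicator) (simp add: sets_pre_sigma_const)
    qed measurable
    finally show ?thesis .
  qed
  then show ?case using q' by blast
qed

end

section \<open>Blumenthal's zero-one law for the limsup\<close>

text \<open>The hypothesis is a lower semicontinuity from the left along rationals. It makes suprema
  over intervals countable, which is what measurability of the limsup requires.\<close>

lemma Limsup_at_right_rat:
  fixes g :: "real \<Rightarrow> 'a::complete_linorder"
  assumes d: "0 < d" and g: "\<And>r. 0 < r \<Longrightarrow> r < d \<Longrightarrow> g r \<le> (SUP q\<in>\<rat> \<inter> {0<..<r}. g q)"
  shows "Limsup (at_right 0) g = (INF n. SUP q\<in>\<rat> \<inter> {0<..<d / real (Suc n)}. g q)"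
proof (rule antisym)
  show "Limsup (at_right 0) g \<le> (INF n. SUP q\<in>\<rat> \<inter> {0<..<d / real (Suc n)}. g q)"
  proof (rule INF_greatest)
    fix n
    let ?P = "\<lambda>r. 0 < r \<and> r < d / real (Suc n)"
    have ev: "eventually ?P (at_right 0)"
      unfolding eventually_at_right_field using d by (intro exI[of _ "d / real (Suc n)"]) auto
    have "Limsup (at_right 0) g \<le> Sup (g ` {r. ?P r})"
      unfolding Limsup_def using ev by (intro INF_lower) simp
    also have "\<dots> \<le> (SUP q\<in>\<rat> \<inter> {0<..<d / real (Suc n)}. g q)"
    proof (rule SUP_least)
      fix r assume r: "r \<in> {r. ?P r}"
      have "d / real (Suc n) \<le> d" using d by (simp add: field_simps)
      then have "g r \<le> (SUP q\<in>\<rat> \<inter> {0<..<r}. g q)" using r by (intro g) auto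
      also have "\<dots> \<le> (SUP q\<in>\<rat> \<inter> {0<..<d / real (Suc n)}. g q)"
        using r by (intro SUP_subset_mono) auto
      finally show "g r \<le> (SUP q\<in>\<rat> \<inter> {0<..<d / real (Suc n)}. g q)" .
    qed
    finally show "Limsup (at_right 0) g \<le> (SUP q\<in>\<rat> \<inter> {0<..<d / real (Suc n)}. g q)" .
  qed
next
  show "(INF n. SUP q\<in>\<rat> \<inter> {0<..<d / real (Suc n)}. g q) \<le> Limsup (at_right 0) g"
    unfolding Limsup_def
  proof (rule INF_greatest)
    fix Q assume "Q \<in> {Q. eventually Q (at_right (0::real))}"
    then obtain b where b: "0 < b" "\<And>y. 0 < y \<Longrightarrow> y < b \<Longrightarrow> Q y"
      by (auto simp: eventually_at_right_field)
    obtain n where n: "d / real (Suc n) < b"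
    proof -
      obtain n where "d / b < real n" using reals_Archimedean2 by blast
      then have "d / real (Suc n) < b" using b d by (simp add: field_simps)
      then show ?thesis using that by blast
    qed
    have "(INF n. SUP q\<in>\<rat> \<inter> {0<..<d / real (Suc n)}. g q) \<le> (SUP q\<in>\<rat> \<inter> {0<..<d / real (Suc n)}. g q)"
      by (rule INF_lower) simp
    also have "\<dots> \<le> Sup (g ` {r. Q r})"
      using b(2) n by (intro SUP_subset_mono) auto
    finally show "(INF n. SUP q\<in>\<rat> \<inter> {0<..<d / real (Suc n)}. g q) \<le> Sup (g ` {r. Q r})" .
  qed
qed

lemma occupation_time_eq:
  assumes "0 < r" "r \<le> \<rho>"
  shows "occupation_time X (ball x r) t \<omega> =
    (\<integral>\<^sup>+ s\<in>{s. 0 \<le> s \<and> ennreal s \<le> t}. indicator {z. trunc_dist x \<rho> z < r} (X (ennreal s) \<omega>) \<partial>lborel)"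
  unfolding occupation_time_def
proof (intro nn_integral_cong)
  fix s
  have "(extend0 (indicator (ball x r)) z :: ennreal) = indicator {z. trunc_dist x \<rho> z < r} z" for z
    using assms by (cases z) (auto simp: extend0_def split: split_indicator)
  then show "extend0 (indicator (ball x r)) (X (ennreal s) \<omega>) * indicator {s. 0 \<le> s \<and> ennreal s \<le> t} s =
     (indicator {z. trunc_dist x \<rho> z < r} (X (ennreal s) \<omega>) * indicator {s. 0 \<le> s \<and> ennreal s \<le> t} s :: ennreal)"
    by simp
qed

lemma occupation_time_le: "0 \<le> u \<Longrightarrow> occupation_time X D (ennreal u) \<omega> \<le> ennreal u"
proof -
  assume u: "0 \<le> u"
  have "occupation_time X D (ennreal u) \<omega> \<le> (\<integral>\<^sup>+ s. indicator {0..u} s \<partial>lborel)"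
    unfolding occupation_time_def
    using u by (intro nn_integral_mono) (auto simp: extend0_def ennreal_le_iff split: split_indicator option.split)
  then show ?thesis using u by simp
qed

lemma occupation_time_mono: "D \<subseteq> D' \<Longrightarrow> t \<le> t' \<Longrightarrow> occupation_time X D t \<omega> \<le> occupation_time X D' t' \<omega>"
  unfolding occupation_time_def
  by (intro nn_integral_mono) (auto simp: extend0_def split: split_indicator option.split)

section \<open>Occupation times as functions of the path\<close>

context borel_standard_process
begin

lemma measurable_near_path:
  assumes "compact (cball x \<rho>)" "0 < r" and G: "space G = \<Omega>"
    and X: "\<And>v. 0 \<le> v \<Longrightarrow> v \<le> u \<Longrightarrow> X (ennreal v) \<in> G \<rightarrow>\<^sub>M cemetery_borel" and u: "0 \<le> u"
  shows "(\<lambda>(v, \<omega>). indicator {z. trunc_dist x \<rho> z < r} (X (ennreal (min v u)) \<omega>) :: ennreal) \<in> borel_measurable (borel \<Otimes>\<^sub>M G)"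
proof -
  have "right_cont (\<lambda>z. ennreal (max 0 (trunc_dist x \<rho> z)))"
    by (rule right_cont_trunc_dist[OF assms(1)]) (intro continuous_intros)
  from measurable_right_cont_path_upto[OF this G X u]
  have [measurable]: "(\<lambda>(v, \<omega>). ennreal (max 0 (trunc_dist x \<rho> (X (ennreal (min v u)) \<omega>)))) \<in> borel_measurable (borel \<Otimes>\<^sub>M G)" .
  have eq: "(\<lambda>(v, \<omega>). indicator {z. trunc_dist x \<rho> z < r} (X (ennreal (min v u)) \<omega>) :: ennreal) =
    (\<lambda>p. indicator {..<ennreal r} ((\<lambda>(v, \<omega>). ennreal (max 0 (trunc_dist x \<rho> (X (ennreal (min v u)) \<omega>)))) p))"
    using assms(2) by (auto simp: fun_eq_iff ennreal_less_iff intro: ennreal_lessI split: split_indicator)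
  show ?thesis unfolding eq by measurable
qed

lemma measurable_occupation_time:
  assumes "compact (cball x \<rho>)" "0 < r" "r \<le> \<rho>" and G: "space G = \<Omega>"
    and X: "\<And>v. 0 \<le> v \<Longrightarrow> v \<le> u \<Longrightarrow> X (ennreal v) \<in> G \<rightarrow>\<^sub>M cemetery_borel" and u: "0 \<le> u"
  shows "occupation_time X (ball x r) (ennreal u) \<in> borel_measurable G"
proof -
  note [measurable] = measurable_near_path[OF assms(1,2) G X u]
  have eq: "occupation_time X (ball x r) (ennreal u) =
     (\<lambda>\<omega>. \<integral>\<^sup>+ s. (\<lambda>(v, \<omega>). indicator {z. trunc_dist x \<rho> z < r} (X (ennreal (min v u)) \<omega>)) (s, \<omega>) * indicator {0..u} s \<partial>lborel)"
    unfolding occupation_time_eq[OF assms(2,3)] fun_eq_iff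
    using u by (intro allI nn_integral_cong) (auto simp: min_def split: split_indicator)
  show ?thesis unfolding eq by measurable
qed

text \<open>An open ball is the union of the smaller concentric ones, and the time window at r is
  exhausted, up to its last instant, by those at smaller radii. Monotone convergence gives the bound
  along radii R n increasing to r, and a rational q between R n and r does no worse.\<close>

lemma occupation_ratio_left_lsc:
  assumes cpt: "compact (cball x \<rho>)" and d: "d \<le> \<rho>" and \<omega>: "\<omega> \<in> \<Omega>"
    and t: "mono_on {0<..<d} t" "continuous_on {0<..<d} t" "\<And>r. 0 < r \<Longrightarrow> r < d \<Longrightarrow> 0 < t r"
    and r: "0 < r" "r < d"
  shows "occupation_time X (ball x r) (ennreal (t r)) \<omega> / ennreal (t r) \<le>
    (SUP q\<in>\<rat> \<inter> {0<..<r}. occupation_time X (ball x q) (ennreal (t q)) \<omega> / ennreal (t q))"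
proof -
  let ?Y = "\<lambda>s. trunc_dist x \<rho> (X (ennreal s) \<omega>)"
  define R where "R n = r * (1 - 1 / real (n + 2))" for n
  have R: "0 < R n" "R n < r" for n
  proof -
    show "0 < R n" unfolding R_def using r by (intro mult_pos_pos) (auto simp: field_simps)
    show "R n < r" using r by (auto simp: R_def field_simps)
  qed
  have "R \<longlonglongrightarrow> r * (1 - 0)"
    unfolding R_def by (intro tendsto_intros LIMSEQ_ignore_initial_segment[OF lim_1_over_n])
  then have Rlim: "R \<longlonglongrightarrow> r" by simp
  have Rinc: "R m \<le> R n" if "m \<le> n" for m n
    unfolding R_def using r that by (intro mult_left_mono diff_left_mono frac_le) auto
  have tR: "t (R m) \<le> t (R n)" if "m \<le> n" for m n
    using R[of m] R[of n] r Rinc[OF that] by (intro mono_onD[OF t(1)]) auto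
  have "isCont t r" using t(2) r by (auto simp: continuous_on_eq_continuous_at)
  then have tlim: "(\<lambda>n. t (R n)) \<longlonglongrightarrow> t r" using Rlim isCont_tendsto_compose by blast
  define f where "f n s = (indicator {0..t (R n)} s * indicator {s. ?Y s < R n} s :: ennreal)" for n s
  have Ymeas [measurable]: "?Y \<in> borel_measurable borel"
  proof -
    have "right_cont (\<lambda>z. ennreal (max 0 (trunc_dist x \<rho> z)))"
      by (rule right_cont_trunc_dist[OF cpt]) (intro continuous_intros)
    from measurable_right_cont_path[OF this space_F measurable_X]
    have "(\<lambda>(v, \<omega>). ennreal (max 0 (trunc_dist x \<rho> (X (ennreal v) \<omega>)))) \<in> borel_measurable (borel \<Otimes>\<^sub>M F \<infinity>)" .
    from measurable_Pair1[OF this, of \<omega>] \<omega>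
    have "(\<lambda>v. ennreal (max 0 (?Y v))) \<in> borel_measurable borel" by (simp add: space_F)
    then have "(\<lambda>v. enn2real (ennreal (max 0 (?Y v)))) \<in> borel_measurable borel" by measurable
    moreover have "enn2real (ennreal (max 0 (?Y v))) = ?Y v" for v
    proof -
      have "0 \<le> trunc_dist x \<rho> z" for z using r d by (cases z) auto
      then show ?thesis by (simp add: max_absorb2)
    qed
    ultimately show ?thesis by simp
  qed
  have fmeas [measurable]: "f n \<in> borel_measurable borel" for n
    unfolding f_def by measurable
  have U: "occupation_time X (ball x (R n)) (ennreal (t (R n))) \<omega> = (\<integral>\<^sup>+ s. f n s \<partial>lborel)" for n
    unfolding occupation_time_eq[OF R(1) less_imp_le[OF less_le_trans[OF less_trans[OF R(2) r(2)] d]]] f_def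
    using t(3)[of "R n"] R[of n] r
    by (intro nn_integral_cong) (auto split: split_indicator simp: ennreal_le_iff)
  have "occupation_time X (ball x r) (ennreal (t r)) \<omega> =
     (\<integral>\<^sup>+ s. indicator {0..<t r} s * indicator {s. ?Y s < r} s \<partial>lborel)"
    unfolding occupation_time_eq[OF r(1) less_imp_le[OF less_le_trans[OF r(2) d]]]
  \<comment> \<open>The last instant of the window is dropped as a null set: \<open>t (R n)\<close>
    may stay below \<open>t r\<close> for every n.\<close>
  proof (rule nn_integral_cong_AE)
    show "AE s in lborel. indicator {z. trunc_dist x \<rho> z < r} (X (ennreal s) \<omega>) *
      indicator {s. 0 \<le> s \<and> ennreal s \<le> ennreal (t r)} s =
      (indicator {0..<t r} s * indicator {s. trunc_dist x \<rho> (X (ennreal s) \<omega>) < r} s :: ennreal)"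
      using AE_lborel_singleton[of "t r"]
      by eventually_elim (use t(3)[OF r] in \<open>auto split: split_indicator simp: ennreal_le_iff\<close>)
  qed
  also have "\<dots> \<le> (\<integral>\<^sup>+ s. (SUP n. f n s) \<partial>lborel)"
  proof (intro nn_integral_mono)
    fix s :: real
    show "indicator {0..<t r} s * indicator {s. ?Y s < r} s \<le> (SUP n. f n s)"
    proof (cases "0 \<le> s \<and> s < t r \<and> ?Y s < r")
      case True
      have "\<forall>\<^sub>F n in sequentially. s < t (R n) \<and> ?Y s < R n"
        using order_tendstoD(1)[OF tlim, of s] order_tendstoD(1)[OF Rlim, of "?Y s"] True
        by (auto intro: eventually_conj)
      then obtain n where "s < t (R n)" "?Y s < R n" by (auto simp: eventually_sequentially)
      then have "f n s = 1" using True by (simp add: f_def)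
      then have "1 \<le> (SUP n. f n s)" by (metis SUP_upper UNIV_I)
      then show ?thesis using True by simp
    qed (auto split: split_indicator)
  qed
  also have "\<dots> = (SUP n. \<integral>\<^sup>+ s. f n s \<partial>lborel)"
  proof (rule nn_integral_monotone_convergence_SUP)
    show "incseq f"
      unfolding f_def incseq_def le_fun_def
    proof (intro allI impI mult_mono)
      fix m n :: nat and s :: real assume "m \<le> n"
      show "(indicator {0..t (R m)} s :: ennreal) \<le> indicator {0..t (R n)} s"
        using tR[OF \<open>m \<le> n\<close>] by (auto split: split_indicator)
      show "(indicator {s. ?Y s < R m} s :: ennreal) \<le> indicator {s. ?Y s < R n} s"
        using Rinc[OF \<open>m \<le> n\<close>] by (auto split: split_indicator)
    qed auto
  qed simp
  finally have "occupation_time X (ball x r) (ennreal (t r)) \<omega> / ennreal (t r) \<le> (SUP n. \<integral>\<^sup>+ s. f n s \<partial>lborel) / ennreal (t r)"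
    by (rule divide_right_mono_ennreal)
  also have "\<dots> = (SUP n. (\<integral>\<^sup>+ s. f n s \<partial>lborel) / ennreal (t r))"
    by (simp add: SUP_divide_ennreal)
  also have "\<dots> \<le> (SUP q\<in>\<rat> \<inter> {0<..<r}. occupation_time X (ball x q) (ennreal (t q)) \<omega> / ennreal (t q))"
  proof (rule SUP_least)
    fix n
    obtain q where q: "q \<in> \<rat>" "R n < q" "q < r" using Rats_dense_in_real[OF R(2)] by blast
    have "0 < q" using q R(1)[of n] by linarith
    \<comment> \<open>Passing from R n to q enlarges ball and window, and dividing by
      \<open>t q\<close> instead of \<open>t r\<close> only increases the quotient.\<close>
    have tq: "t (R n) \<le> t q" "t q \<le> t r"
      using mono_onD[OF t(1), of "R n" q] mono_onD[OF t(1), of q r] q R[of n] r \<open>0 < q\<close> by auto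
    have "(\<integral>\<^sup>+ s. f n s \<partial>lborel) / ennreal (t r) \<le> occupation_time X (ball x q) (ennreal (t q)) \<omega> / ennreal (t r)"
      unfolding U[symmetric] using q tq by (intro divide_right_mono_ennreal occupation_time_mono) (auto intro: ennreal_leI)
    also have "\<dots> \<le> occupation_time X (ball x q) (ennreal (t q)) \<omega> / ennreal (t q)"
      using tq t(3)[of q] q \<open>0 < q\<close> r
      unfolding divide_ennreal_def
      by (intro mult_left_mono) (auto simp: inverse_ennreal intro!: ennreal_leI le_imp_inverse_le)
    also have "\<dots> \<le> (SUP q\<in>\<rat> \<inter> {0<..<r}. occupation_time X (ball x q) (ennreal (t q)) \<omega> / ennreal (t q))"
      using q \<open>0 < q\<close> by (intro SUP_upper) auto
    finally show "(\<integral>\<^sup>+ s. f n s \<partial>lborel) / ennreal (t r) \<le>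
      (SUP q\<in>\<rat> \<inter> {0<..<r}. occupation_time X (ball x q) (ennreal (t q)) \<omega> / ennreal (t q))" .
  qed
  finally show ?thesis .
qed

text \<open>Near r = 0 the windows end before any prescribed time, so the path up to \<epsilon>
  decides. The \<sigma>-algebra is left open because the result is applied both to
  \<open>F (ennreal \<epsilon>)\<close> and to \<open>path_sigma\<close>.\<close>

lemma measurable_Limsup_occupation:
  assumes cpt: "compact (cball x \<rho>)" and d: "0 < d" "d \<le> \<rho>"
    and t: "mono_on {0<..<d} t" "continuous_on {0<..<d} t" "\<And>r. 0 < r \<Longrightarrow> r < d \<Longrightarrow> 0 < t r"
      "(t \<longlongrightarrow> 0) (at_right 0)"
    and G: "space G = \<Omega>" and \<epsilon>: "0 < \<epsilon>" and X: "\<And>v. 0 \<le> v \<Longrightarrow> v \<le> \<epsilon> \<Longrightarrow> X (ennreal v) \<in> G \<rightarrow>\<^sub>M cemetery_borel"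
  shows "(\<lambda>\<omega>. Limsup (at_right 0) (\<lambda>r. occupation_time X (ball x r) (ennreal (t r)) \<omega> / ennreal (t r)))
    \<in> borel_measurable G"
proof -
  have "\<forall>\<^sub>F r in at_right 0. t r < \<epsilon>" by (rule order_tendstoD(2)[OF t(4) \<epsilon>])
  then obtain d' where d': "0 < d'" "\<And>r. 0 < r \<Longrightarrow> r < d' \<Longrightarrow> t r < \<epsilon>"
    by (auto simp: eventually_at_right_field)
  define e where "e = min d d'"
  have e: "0 < e" "e \<le> d" "e \<le> d'" using d d' by (auto simp: e_def)
  have [measurable]: "occupation_time X (ball x q) (ennreal (t q)) \<in> borel_measurable G" if "0 < q" "q < e" for q
    using that e d d'(2)[of q] t(3)[of q]
    by (intro measurable_occupation_time[OF cpt _ _ G] X) auto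
  have "(\<lambda>\<omega>. INF n. SUP q\<in>\<rat> \<inter> {0<..<e / real (Suc n)}. occupation_time X (ball x q) (ennreal (t q)) \<omega> / ennreal (t q))
    \<in> borel_measurable G"
  proof (intro borel_measurable_INF borel_measurable_SUP)
    fix n q assume "q \<in> \<rat> \<inter> {0<..<e / real (Suc n)}"
    moreover have "e / real (Suc n) \<le> e" using e by (simp add: field_simps)
    ultimately have "0 < q" "q < e" by auto
    then show "(\<lambda>\<omega>. occupation_time X (ball x q) (ennreal (t q)) \<omega> / ennreal (t q)) \<in> borel_measurable G"
      by measurable
  qed (auto intro: countable_Int1 countable_rat)
  moreover have "Limsup (at_right 0) (\<lambda>r. occupation_time X (ball x r) (ennreal (t r)) \<omega> / ennreal (t r)) =
     (INF n. SUP q\<in>\<rat> \<inter> {0<..<e / real (Suc n)}. occupation_time X (ball x q) (ennreal (t q)) \<omega> / ennreal (t q))"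
    if "\<omega> \<in> \<Omega>" for \<omega>
    using e by (intro Limsup_at_right_rat occupation_ratio_left_lsc[OF cpt d(2) that t(1-3)]) auto
  ultimately show ?thesis
    using G by (subst measurable_cong) auto
qed

text \<open>The \<sigma>-algebra generated by the path, without completion. The Markov property
  controls these events only; the ambient \<sigma>-algebra may contain more.\<close>

definition path_sigma :: "'w measure" where
  "path_sigma = sigma \<Omega> {{\<omega>\<in>\<Omega>. \<forall>i\<in>I. X i \<omega> \<in> A i} | I A.
     finite I \<and> (\<forall>i\<in>I. i < \<infinity>) \<and> (\<forall>i. A i \<in> sets cemetery_borel)}"

lemma space_path_sigma [simp]: "space path_sigma = \<Omega>"
  by (simp add: path_sigma_def space_measure_of_conv)

lemma measurable_X_path_sigma: "i < \<infinity> \<Longrightarrow> X i \<in> path_sigma \<rightarrow>\<^sub>M cemetery_borel"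
proof (rule measurableI)
  fix A :: "'m option set" assume "A \<in> sets cemetery_borel" "i < \<infinity>"
  then have "{\<omega>\<in>\<Omega>. \<forall>j\<in>{i}. X j \<omega> \<in> (\<lambda>_. A) j} \<in> sets path_sigma"
    unfolding path_sigma_def
    by (intro in_measure_of CollectI exI[of _ "{i}"] exI[of _ "\<lambda>_. A"]) auto
  moreover have "X i -` A \<inter> space path_sigma = {\<omega>\<in>\<Omega>. \<forall>j\<in>{i}. X j \<omega> \<in> (\<lambda>_. A) j}" by auto
  ultimately show "X i -` A \<inter> space path_sigma \<in> sets path_sigma" by simp
qed simp

text \<open>Given \<open>F 0\<close>, a finite-dimensional event has conditional probability q(X 0),
  and X 0 equals x almost surely, so this is a constant. Finite-dimensional events are closed under
  intersection, and Dynkin's argument extends the product formula to all path events.\<close>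

lemma blumenthal_independence:
  assumes L: "L \<in> sets (F 0)" and B: "B \<in> sets path_sigma"
  shows "measure (P x) (L \<inter> B) = measure (P x) L * measure (P x) B"
proof -
  let ?G = "{{\<omega>\<in>\<Omega>. \<forall>i\<in>I. X i \<omega> \<in> A i} | I A.
     finite I \<and> (\<forall>i\<in>I. i < \<infinity>) \<and> (\<forall>i. A i \<in> sets cemetery_borel)}"
  interpret prob_space "P x" by (rule prob_P)
  have LF: "L \<in> events" unfolding sets_P using L by (rule sets_F_le)
  have Lsub: "L \<subseteq> \<Omega>" using sets.sets_into_space[OF L] by (simp add: space_F)
  have G: "?G \<subseteq> Pow \<Omega>" by auto
  have B': "B \<in> sigma_sets \<Omega> ?G" using B G by (simp add: path_sigma_def sets_measure_of)
  have stable: "Int_stable ?G"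
  proof (rule Int_stableI)
    fix a b assume "a \<in> ?G" "b \<in> ?G"
    then obtain I A I' A' where a: "a = {\<omega>\<in>\<Omega>. \<forall>i\<in>I. X i \<omega> \<in> A i}" "finite I" "\<forall>i\<in>I. i < \<infinity>" "\<forall>i. A i \<in> sets cemetery_borel"
      and b: "b = {\<omega>\<in>\<Omega>. \<forall>i\<in>I'. X i \<omega> \<in> A' i}" "finite I'" "\<forall>i\<in>I'. i < \<infinity>" "\<forall>i. A' i \<in> sets cemetery_borel"
      by blast
    define C where "C i = (if i \<in> I then A i else UNIV) \<inter> (if i \<in> I' then A' i else UNIV)" for i
    have "a \<inter> b = {\<omega>\<in>\<Omega>. \<forall>i\<in>I \<union> I'. X i \<omega> \<in> C i}"
      unfolding a b C_def by (auto split: if_splits)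
    moreover have "C i \<in> sets cemetery_borel" for i
    proof -
      have "(UNIV :: 'm option set) \<in> sets cemetery_borel" using sets.top[of cemetery_borel] by simp
      then show ?thesis unfolding C_def using a(4) b(4) by (intro sets.Int) auto
    qed
    ultimately show "a \<inter> b \<in> ?G"
      using a b by (intro CollectI exI[of _ "I \<union> I'"] exI[of _ C]) auto
  qed
  have "B \<in> sets (F \<infinity>) \<and> prob (L \<inter> B) = prob L * prob B"
    using stable G B'
  proof (induction rule: sigma_sets_induct_disjoint)
    case (basic A)
    then obtain I C where A: "A = {\<omega>\<in>\<Omega>. \<forall>i\<in>I. X i \<omega> \<in> C i}" "finite I" "\<forall>i\<in>I. i < \<infinity>" "\<And>i. C i \<in> sets cemetery_borel"
      by blast
    have "\<exists>q\<in>borel_measurable cemetery_borel. \<forall>t<\<infinity>. \<forall>x. \<forall>L\<in>sets (F (t + 0)).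
      emeasure (P x) {\<omega>\<in>L. \<forall>i\<in>I. X (t + i) \<omega> \<in> C i} = (\<integral>\<^sup>+ \<omega>. indicator L \<omega> * q (X (t + 0) \<omega>) \<partial>P x)"
      by (rule markov_finite_dimensional[OF A(4) A(2)]) (use A(3) in auto)
    then obtain q where [measurable]: "q \<in> borel_measurable cemetery_borel"
      and "\<forall>t<\<infinity>. \<forall>x. \<forall>L\<in>sets (F (t + 0)).
        emeasure (P x) {\<omega>\<in>L. \<forall>i\<in>I. X (t + i) \<omega> \<in> C i} = (\<integral>\<^sup>+ \<omega>. indicator L \<omega> * q (X (t + 0) \<omega>) \<partial>P x)"
      by blast
    then have q: "emeasure (P x) {\<omega>\<in>L. \<forall>i\<in>I. X i \<omega> \<in> C i} = (\<integral>\<^sup>+ \<omega>. indicator L \<omega> * q (X 0 \<omega>) \<partial>P x)"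
      if "L \<in> sets (F 0)" for L
      using that by (force dest: spec[of _ 0])
    have q': "emeasure (P x) {\<omega>\<in>L. \<forall>i\<in>I. X i \<omega> \<in> C i} = q x * emeasure (P x) L"
      if "L \<in> sets (F 0)" for L
    proof -
      have [measurable]: "L \<in> events" unfolding sets_P using that by (rule sets_F_le)
      have "emeasure (P x) {\<omega>\<in>L. \<forall>i\<in>I. X i \<omega> \<in> C i} = (\<integral>\<^sup>+ \<omega>. q x * indicator L \<omega> \<partial>P x)"
        unfolding q[OF that] by (rule nn_integral_cong_AE) (use normal[of x] in \<open>eventually_elim, simp add: mult.commute\<close>)
      then show ?thesis by (simp add: nn_integral_cmult_indicator)
    qed
    have "\<Omega> \<in> sets (F 0)" using sets.top[of "F 0"] by (simp add: space_F)
    from q'[OF this] have 1: "emeasure (P x) A = q x"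
      using emeasure_space_1 by (simp add: A)
    have 2: "emeasure (P x) (L \<inter> A) = q x * emeasure (P x) L"
    proof -
      have "L \<inter> A = {\<omega>\<in>L. \<forall>i\<in>I. X i \<omega> \<in> C i}" using Lsub by (auto simp: A)
      then show ?thesis using q'[OF L] by simp
    qed
    have "A \<in> sets (F \<infinity>)"
    proof -
      note A(4) [measurable]
      have "{\<omega>\<in>space (F \<infinity>). \<forall>i\<in>I. X i \<omega> \<in> C i} \<in> sets (F \<infinity>)"
      proof (rule sets.sets_Collect_finite_All)
        show "{\<omega>\<in>space (F \<infinity>). X i \<omega> \<in> C i} \<in> sets (F \<infinity>)" for i by measurable
      qed (rule A(2))
      then show ?thesis by (simp only: A(1) space_F)
    qed
    moreover have "prob (L \<inter> A) = prob L * prob A"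
      using 1 2 by (simp add: measure_def enn2real_mult mult.commute)
    ultimately show ?case ..
  next
    case empty
    then show ?case by simp
  next
    case (compl A)
    have A: "A \<in> events" using compl by (simp add: sets_P)
    have "L \<inter> (\<Omega> - A) = L - L \<inter> A" using Lsub by auto
    then have "prob (L \<inter> (\<Omega> - A)) = prob L - prob (L \<inter> A)"
      using LF A by (simp add: finite_measure_Diff)
    also have "\<dots> = prob L * (1 - prob A)" using compl by (simp add: algebra_simps)
    also have "1 - prob A = prob (\<Omega> - A)" using prob_compl[OF A] by simp
    finally have "prob (L \<inter> (\<Omega> - A)) = prob L * prob (\<Omega> - A)" .
    moreover have "\<Omega> - A \<in> sets (F \<infinity>)" using compl sets.compl_sets[of A "F \<infinity>"] by (simp add: space_F)
    ultimately show ?case by simp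
  next
    case (union A)
    have A: "range A \<subseteq> events" using union by (auto simp: sets_P)
    have "(\<lambda>i. prob (L \<inter> A i)) sums prob (\<Union>i. L \<inter> A i)"
      using union(1) A LF by (intro finite_measure_UNION) (auto simp: disjoint_family_on_def)
    moreover have "(\<lambda>i. prob L * prob (A i)) sums (prob L * prob (\<Union>i. A i))"
      using union(1) A by (intro sums_mult finite_measure_UNION)
    moreover have "prob (L \<inter> A i) = prob L * prob (A i)" for i using union by simp
    ultimately have "prob (\<Union>i. L \<inter> A i) = prob L * prob (\<Union>i. A i)"
      using sums_unique2 by force
    then show ?case using union by auto
  qed
  then show ?thesis by blast
qed

lemma zero_one_law:
  assumes "B \<in> sets (F 0)" "B \<in> sets path_sigma"
  shows "measure (P x) B \<in> {0, 1}"
  using blumenthal_independence[OF assms, of x] by auto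

lemma zero_one_constant:
  fixes g :: "'w \<Rightarrow> ennreal"
  assumes g [measurable]: "g \<in> borel_measurable (F 0)" and g' [measurable]: "g \<in> borel_measurable path_sigma"
    and bd: "\<And>\<omega>. \<omega> \<in> \<Omega> \<Longrightarrow> g \<omega> \<le> 1"
  shows "\<exists>c\<in>{0..1}. AE \<omega> in P x. g \<omega> = ennreal c"
proof -
  interpret prob_space "P x" by (rule prob_P)
  define E where "E a = {\<omega>\<in>\<Omega>. ennreal a \<le> g \<omega>}" for a
  have E: "E a \<in> sets (F 0)" "E a \<in> sets path_sigma" for a
  proof -
    have "{\<omega>\<in>space (F 0). ennreal a \<le> g \<omega>} \<in> sets (F 0)" by measurable
    then show "E a \<in> sets (F 0)" by (simp add: E_def space_F)
    have "{\<omega>\<in>space path_sigma. ennreal a \<le> g \<omega>} \<in> sets path_sigma" by measurable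
    then show "E a \<in> sets path_sigma" by (simp add: E_def)
  qed
  have Eev [measurable]: "E a \<in> events" for a unfolding sets_P by (rule sets_F_le[OF E(1)])
  \<comment> \<open>The constant is the supremum of the levels that g reaches almost surely; by the
    zero-one law every other nonnegative level is almost surely not reached.\<close>
  define S where "S = {a. 0 \<le> a \<and> prob (E a) = 1}"
  have E0: "E 0 = \<Omega>" by (auto simp: E_def)
  have S0: "0 \<in> S" using prob_space by (simp add: S_def E0)
  have S1: "a \<le> 1" if "a \<in> S" for a
  proof (rule ccontr)
    assume "\<not> a \<le> 1"
    then have "1 < ennreal a" by (simp add: one_less_ennreal)
    then have "\<not> ennreal a \<le> g \<omega>" if "\<omega> \<in> \<Omega>" for \<omega>
      using le_less_trans[OF bd[OF that]] by (simp add: not_le)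
    then have "E a = {}" by (auto simp: E_def)
    then show False using that by (simp add: S_def)
  qed
  have bdd: "bdd_above S" using S1 by (auto simp: bdd_above_def)
  define c where "c = Sup S"
  have c: "0 \<le> c" "c \<le> 1" unfolding c_def
    using S0 S1 by (auto intro: cSup_upper[OF S0 bdd] cSup_least)
  have "AE \<omega> in P x. ennreal (c - 1 / Suc n) \<le> g \<omega> \<and> g \<omega> < ennreal (c + 1 / Suc n)" for n
  proof (rule AE_conjI)
    obtain a where a: "a \<in> S" "c - 1 / Suc n < a"
      using less_cSupD[of S "c - 1 / Suc n"] S0 c_def by auto
    have "AE \<omega> in P x. \<omega> \<in> E a"
      using a by (intro AE_prob_1) (simp add: S_def)
    then show "AE \<omega> in P x. ennreal (c - 1 / Suc n) \<le> g \<omega>"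
      by eventually_elim (rule order_trans[OF ennreal_leI[OF less_imp_le[OF a(2)]]], simp add: E_def)
    have "c + 1 / Suc n \<notin> S"
    proof
      assume "c + 1 / Suc n \<in> S"
      from cSup_upper[OF this bdd] show False by (simp add: c_def[symmetric])
    qed
    then have "prob (E (c + 1 / Suc n)) \<noteq> 1" using c by (simp add: S_def)
    then have "prob (E (c + 1 / Suc n)) = 0" using zero_one_law[OF E, of x] by blast
    then have "AE \<omega> in P x. \<omega> \<notin> E (c + 1 / Suc n)"
      by (subst (asm) prob_eq_0) auto
    then show "AE \<omega> in P x. g \<omega> < ennreal (c + 1 / Suc n)"
      using AE_space by eventually_elim (auto simp: E_def not_le)
  qed
  then have "AE \<omega> in P x. \<forall>n. ennreal (c - 1 / Suc n) \<le> g \<omega> \<and> g \<omega> < ennreal (c + 1 / Suc n)"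
    by (simp add: AE_all_countable)
  then have "AE \<omega> in P x. g \<omega> = ennreal c"
  proof eventually_elim
    case (elim \<omega>)
    have l1: "(\<lambda>n. ennreal (c - 1 / Suc n)) \<longlonglongrightarrow> ennreal (c - 0)" and l2: "(\<lambda>n. ennreal (c + 1 / Suc n)) \<longlonglongrightarrow> ennreal (c + 0)"
      by (intro tendsto_intros filterlim_compose[OF lim_1_over_n filterlim_Suc])+
    show ?case
    proof (rule antisym)
      show "g \<omega> \<le> ennreal c" using LIMSEQ_le_const[OF l2, of "g \<omega>"] elim by (auto intro: less_imp_le)
      show "ennreal c \<le> g \<omega>" using LIMSEQ_le_const2[OF l1, of "g \<omega>"] elim by auto
    qed
  qed
  then show ?thesis using c by auto
qed

text \<open>Right-continuity of the filtration at 0: \<open>F 0\<close> is the germ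
  \<sigma>-algebra.\<close>

lemma measurable_F0I:
  assumes "\<And>\<epsilon>. 0 < \<epsilon> \<Longrightarrow> g \<in> F (ennreal \<epsilon>) \<rightarrow>\<^sub>M N"
  shows "g \<in> F 0 \<rightarrow>\<^sub>M N"
proof (rule measurableI)
  show "g \<omega> \<in> space N" if "\<omega> \<in> space (F 0)" for \<omega>
    using measurable_space[OF assms[of 1]] that by (simp add: space_F)
  fix A assume A: "A \<in> sets N"
  have "g -` A \<inter> space (F 0) \<in> sets (F s)" if "0 < s" for s
  proof -
    obtain \<epsilon> where \<epsilon>: "0 < \<epsilon>" "ennreal \<epsilon> \<le> s"
    proof (cases s)
      case (real r)
      then show ?thesis using that[of r] \<open>0 < s\<close> by auto
    qed (use that[of 1] in auto)
    have "g -` A \<inter> space (F (ennreal \<epsilon>)) \<in> sets (F (ennreal \<epsilon>))" by (rule measurable_sets[OF assms[OF \<epsilon>(1)] A])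
    then show ?thesis using sets_F_mono[OF \<epsilon>(2)] by (auto simp: space_F)
  qed
  then show "g -` A \<inter> space (F 0) \<in> sets (F 0)"
    unfolding F_right_continuous[of 0, simplified] by auto
qed

lemma Limsup_occupation_constant:
  assumes cpt: "compact (cball x \<rho>)" and d: "0 < d" "d \<le> \<rho>"
    and t: "mono_on {0<..<d} t" "continuous_on {0<..<d} t" "\<And>r. 0 < r \<Longrightarrow> r < d \<Longrightarrow> 0 < t r"
      "(t \<longlongrightarrow> 0) (at_right 0)"
  defines "g \<equiv> \<lambda>\<omega>. Limsup (at_right 0) (\<lambda>r. occupation_time X (ball x r) (ennreal (t r)) \<omega> / ennreal (t r))"
  shows "\<exists>c\<in>{0..1}. AE \<omega> in P y. g \<omega> = ennreal c"
proof -
  have *: "g \<in> borel_measurable (F 0)"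
  proof (rule measurable_F0I)
    fix \<epsilon> :: real assume "0 < \<epsilon>"
    then show "g \<in> borel_measurable (F (ennreal \<epsilon>))"
      unfolding g_def
      by (intro measurable_Limsup_occupation[OF cpt d t space_F] measurable_F_mono[OF _ adapted]) (auto intro: ennreal_leI)
  qed
  have **: "g \<in> borel_measurable path_sigma"
    unfolding g_def by (intro measurable_Limsup_occupation[OF cpt d t, where \<epsilon>=1] measurable_X_path_sigma) auto
  have "g \<omega> \<le> 1" for \<omega>
    unfolding g_def
  proof (rule Limsup_bounded)
    have "\<forall>\<^sub>F r in at_right 0. 0 < r \<and> r < d" using d by (auto simp: eventually_at_right_field)
    then show "\<forall>\<^sub>F r in at_right 0. occupation_time X (ball x r) (ennreal (t r)) \<omega> / ennreal (t r) \<le> 1"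
    proof eventually_elim
      case (elim r)
      then show ?case using t(3)[of r] occupation_time_le[of "t r" X "ball x r" \<omega>]
        by (intro divide_le_posI_ennreal) auto
    qed
  qed
  then show "\<exists>c\<in>{0..1}. AE \<omega> in P y. g \<omega> = ennreal c"
    by (intro zero_one_constant * **)
qed

section \<open>Leaving a ball\<close>

text \<open>The strict inequality makes this the hitting time of an open set, so rational times
  detect it; \<open>exit_time\<close> of an open ball is the hitting time of a closed set. Time 0 is
  included.\<close>

definition leave_time :: "'m \<Rightarrow> real \<Rightarrow> real \<Rightarrow> 'w \<Rightarrow> ennreal" where
  "leave_time x \<rho> a \<omega> = Inf {t. a < trunc_dist x \<rho> (X t \<omega>)}"

lemma before_leave_time: "t < leave_time x \<rho> a \<omega> \<Longrightarrow> trunc_dist x \<rho> (X t \<omega>) \<le> a"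
  unfolding leave_time_def by (metis (mono_tags) Inf_lower leD mem_Collect_eq not_le)

lemma tendsto_trunc_dist_X:
  assumes "compact (cball x \<rho>)" "\<omega> \<in> \<Omega>" "0 \<le> v"
  shows "((\<lambda>s. trunc_dist x \<rho> (X (ennreal s) \<omega>)) \<longlongrightarrow> trunc_dist x \<rho> (X (ennreal v) \<omega>)) (at_right v)"
  by (rule tendsto_trunc_dist[OF assms(1) limitin_X_real[OF assms(2,3)]])

text \<open>Were the path still below level a, right-continuity would keep it there for a while and
  the infimum would be later. Equality with a can occur, as the infimum need not be
  attained.\<close>

lemma at_leave_time:
  assumes cpt: "compact (cball x \<rho>)" and \<omega>: "\<omega> \<in> \<Omega>" and \<tau>: "leave_time x \<rho> a \<omega> = ennreal \<tau>" "0 \<le> \<tau>"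
  shows "a \<le> trunc_dist x \<rho> (X (ennreal \<tau>) \<omega>)"
proof (rule ccontr)
  assume "\<not> a \<le> trunc_dist x \<rho> (X (ennreal \<tau>) \<omega>)"
  then have "\<forall>\<^sub>F s in at_right \<tau>. trunc_dist x \<rho> (X (ennreal s) \<omega>) < a"
    by (intro order_tendstoD(2)[OF tendsto_trunc_dist_X[OF cpt \<omega> \<tau>(2)]]) simp
  then obtain b where b: "\<tau> < b" "\<And>s. \<tau> < s \<Longrightarrow> s < b \<Longrightarrow> trunc_dist x \<rho> (X (ennreal s) \<omega>) < a"
    by (auto simp: eventually_at_right_field)
  have "ennreal b \<le> leave_time x \<rho> a \<omega>"
    unfolding leave_time_def
  proof (rule Inf_greatest)
    fix t assume t: "t \<in> {t. a < trunc_dist x \<rho> (X t \<omega>)}"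
    show "ennreal b \<le> t"
    proof (rule ccontr)
      assume "\<not> ennreal b \<le> t"
      then obtain s where s: "t = ennreal s" "0 \<le> s" "s < b"
        by (cases t) (auto simp: ennreal_le_iff not_le ennreal_less_iff)
      consider "s < \<tau>" | "s = \<tau>" | "\<tau> < s" by linarith
      then show False
      proof cases
        case 1
        then have "t < leave_time x \<rho> a \<omega>" using s \<tau> by (simp add: ennreal_less_iff)
        then show ?thesis using before_leave_time t by fastforce
      next
        case 2
        then show ?thesis using \<open>\<not> a \<le> trunc_dist x \<rho> (X (ennreal \<tau>) \<omega>)\<close> t s by simp
      next
        case 3
        then show ?thesis using b(2)[OF 3 s(3)] t s by simp
      qed
    qed
  qed
  then show False using \<tau> b by (simp add: ennreal_le_iff)
qed

text \<open>Once above the level, a right-continuous path stays above it on an interval to the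
  right, and this contains a rational time.\<close>

lemma leave_time_less_iff:
  assumes cpt: "compact (cball x \<rho>)" and \<omega>: "\<omega> \<in> \<Omega>"
  shows "leave_time x \<rho> a \<omega> < t \<longleftrightarrow>
    (\<exists>q::rat. 0 \<le> q \<and> ennreal (real_of_rat q) < t \<and> a < trunc_dist x \<rho> (X (ennreal (real_of_rat q)) \<omega>))"
proof
  assume "leave_time x \<rho> a \<omega> < t"
  then obtain u where u: "a < trunc_dist x \<rho> (X u \<omega>)" "u < t"
    unfolding leave_time_def Inf_less_iff by auto
  obtain s where s: "u = ennreal s" "0 \<le> s" using u(2) by (cases u) auto
  have "\<forall>\<^sub>F v in at_right s. a < trunc_dist x \<rho> (X (ennreal v) \<omega>)"
    using order_tendstoD(1)[OF tendsto_trunc_dist_X[OF cpt \<omega> s(2)]] u s by simp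
  then obtain b where b: "s < b" "\<And>v. s < v \<Longrightarrow> v < b \<Longrightarrow> a < trunc_dist x \<rho> (X (ennreal v) \<omega>)"
    by (auto simp: eventually_at_right_field)
  have "ennreal s < min (ennreal b) t" using b s u by (simp add: ennreal_less_iff)
  then obtain q :: rat where q: "ennreal s < ennreal (real_of_rat q)" "ennreal (real_of_rat q) < min (ennreal b) t"
    using ennreal_rat_dense by blast
  have "s < real_of_rat q" using q(1) s by (simp add: ennreal_less_iff)
  moreover have "real_of_rat q < b"
  proof (rule ccontr)
    assume "\<not> real_of_rat q < b"
    then have "ennreal b \<le> ennreal (real_of_rat q)" by (intro ennreal_leI) simp
    then show False using q(2) by auto
  qed
  ultimately show "\<exists>q::rat. 0 \<le> q \<and> ennreal (real_of_rat q) < t \<and> a < trunc_dist x \<rho> (X (ennreal (real_of_rat q)) \<omega>)"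
    using b(2) q(2) s by (intro exI[of _ q]) (auto simp: zero_le_of_rat_iff[symmetric, where 'a=real] simp del: zero_le_of_rat_iff)
next
  assume "\<exists>q::rat. 0 \<le> q \<and> ennreal (real_of_rat q) < t \<and> a < trunc_dist x \<rho> (X (ennreal (real_of_rat q)) \<omega>)"
  then show "leave_time x \<rho> a \<omega> < t"
    unfolding leave_time_def by (auto intro: le_less_trans[OF Inf_lower])
qed

text \<open>The rational description settles strict inequalities. For \<open>\<le> t\<close>, the
  event is expressed through times in (t, s) for each s > t, and right-continuity of the filtration
  lets s decrease to t.\<close>

lemma stopping_time_leave_time:
  assumes cpt: "compact (cball x \<rho>)"
  shows "stopping_time F (leave_time x \<rho> a)"
proof
  have less: "Measurable.pred (F s) (\<lambda>\<omega>. leave_time x \<rho> a \<omega> < s)" for s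
  proof -
    have "Measurable.pred (F s) (\<lambda>\<omega>. \<exists>q::rat. 0 \<le> q \<and> ennreal (real_of_rat q) < s \<and> a < trunc_dist x \<rho> (X (ennreal (real_of_rat q)) \<omega>))"
    proof (rule pred_intros_countable(2))
      fix q :: rat
      show "Measurable.pred (F s) (\<lambda>\<omega>. 0 \<le> q \<and> ennreal (real_of_rat q) < s \<and> a < trunc_dist x \<rho> (X (ennreal (real_of_rat q)) \<omega>))"
      proof (cases "ennreal (real_of_rat q) < s")
        case True
        have [measurable]: "X (ennreal (real_of_rat q)) \<in> F s \<rightarrow>\<^sub>M cemetery_borel"
          by (rule measurable_F_mono[OF less_imp_le[OF True] adapted])
        show ?thesis by measurable
      qed simp
    qed
    then show ?thesis
      by (rule measurable_cong[THEN iffD2, rotated]) (auto simp: space_F leave_time_less_iff[OF cpt])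
  qed
  fix t
  show "Measurable.pred (F t) (\<lambda>\<omega>. leave_time x \<rho> a \<omega> \<le> t)"
  proof (cases "t = \<infinity>")
    case False
    have "{\<omega>\<in>\<Omega>. leave_time x \<rho> a \<omega> \<le> t} \<in> sets (F s)" if "t < s" for s
    proof -
      have "Measurable.pred (F s) (\<lambda>\<omega>. \<forall>q::rat. t < ennreal (real_of_rat q) \<and> ennreal (real_of_rat q) < s \<longrightarrow>
        leave_time x \<rho> a \<omega> < ennreal (real_of_rat q))"
      proof (rule pred_intros_countable(1))
        fix q :: rat
        show "Measurable.pred (F s) (\<lambda>\<omega>. t < ennreal (real_of_rat q) \<and> ennreal (real_of_rat q) < s \<longrightarrow>
          leave_time x \<rho> a \<omega> < ennreal (real_of_rat q))"
        proof (cases "ennreal (real_of_rat q) < s")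
          case True
          have [measurable]: "Measurable.pred (F s) (\<lambda>\<omega>. leave_time x \<rho> a \<omega> < ennreal (real_of_rat q))"
            by (rule measurable_F_mono[OF less_imp_le[OF True] less])
          show ?thesis by measurable
        qed simp
      qed
      moreover have "leave_time x \<rho> a \<omega> \<le> t \<longleftrightarrow> (\<forall>q::rat. t < ennreal (real_of_rat q) \<and> ennreal (real_of_rat q) < s \<longrightarrow>
        leave_time x \<rho> a \<omega> < ennreal (real_of_rat q))" for \<omega>
      proof
        assume *: "\<forall>q::rat. t < ennreal (real_of_rat q) \<and> ennreal (real_of_rat q) < s \<longrightarrow>
          leave_time x \<rho> a \<omega> < ennreal (real_of_rat q)"
        show "leave_time x \<rho> a \<omega> \<le> t"
        proof (rule ccontr)
          assume "\<not> leave_time x \<rho> a \<omega> \<le> t"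
          then have "t < min s (leave_time x \<rho> a \<omega>)" using that by simp
          then obtain q :: rat where "t < ennreal (real_of_rat q)" "ennreal (real_of_rat q) < min s (leave_time x \<rho> a \<omega>)"
            using ennreal_rat_dense by blast
          then show False using *[rule_format, of q] by auto
        qed
      qed auto
      ultimately have "Measurable.pred (F s) (\<lambda>\<omega>. leave_time x \<rho> a \<omega> \<le> t)" by (simp only:)
      then show ?thesis unfolding pred_def space_F .
    qed
    then have "{\<omega>\<in>\<Omega>. leave_time x \<rho> a \<omega> \<le> t} \<in> sets (F t)"
      using False by (subst F_right_continuous) (auto simp: less_top)
    then show ?thesis unfolding pred_def space_F .
  qed simp
qed

text \<open>Strictness matters: left limits in M are guaranteed only strictly before the
  lifetime.\<close>

lemma less_lifetime:
  assumes "\<omega> \<in> \<Omega>" "0 \<le> v" "X (ennreal v) \<omega> \<noteq> None"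
  shows "ennreal v < lifetime X \<omega>"
proof -
  obtain b where b: "v < b" "\<And>s. v < s \<Longrightarrow> s < b \<Longrightarrow> X (ennreal s) \<omega> \<noteq> None"
    using eventually_alive[OF assms] by (auto simp: eventually_at_right_field)
  define c where "c = (v + b) / 2"
  have c: "v < c" "c < b" using b by (auto simp: c_def)
  have "ennreal c \<le> lifetime X \<omega>"
    unfolding lifetime_def
  proof (rule Inf_greatest)
    fix t assume "t \<in> {t. X t \<omega> = None}"
    then show "ennreal c \<le> t"
      using cemetery_absorbing[OF assms(1), of t "ennreal c"] b(2)[OF c] by (auto intro: leI less_imp_le)
  qed
  moreover have "ennreal v < ennreal c" using c assms(2) by (simp add: ennreal_less_iff)
  ultimately show ?thesis by (rule less_le_trans[rotated])
qed

lemma at_left_ennreal_neq_bot: "0 < t \<Longrightarrow> at_left (t::ennreal) \<noteq> bot"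
proof
  assume "0 < t" "at_left t = bot"
  then have "\<forall>\<^sub>F _ in at_left t. False" by simp
  then obtain b where "b < t" "\<And>y. b < y \<Longrightarrow> y < t \<Longrightarrow> False"
    using eventually_at_left[OF \<open>0 < t\<close>] by auto
  then show False using dense by blast
qed

text \<open>The sum over the jumps is not known to be measurable, but it dominates the indicator of a measurable event,
  and the Lebesgue integral (a supremum over simple functions from below) is monotone regardless.\<close>

lemma jump_at_leave_time:
  assumes levy: "levy_system X P J" and cpt: "compact (cball x \<rho>)" and a: "a < b" "b \<le> \<rho>" and z: "dist x z < a"
    and t: "0 < t" and rate: "\<And>u. u \<in> cball x a \<Longrightarrow> emeasure (J u) (UNIV - Some ` ball x b) \<le> ennreal C" and C: "0 \<le> C"
  shows "emeasure (P (Some z)) {\<omega>\<in>\<Omega>. leave_time x \<rho> a \<omega> < ennreal t \<and>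
     X (leave_time x \<rho> a \<omega>) \<omega> \<in> Some ` (- ball x b)} \<le> ennreal (C * t)"
proof -
  \<comment> \<open>G counts the jumps from the closed ball of radius a to outside the open ball of
    radius b, or to the cemetery. It vanishes on the diagonal because a < b.\<close>
  define G :: "'m \<times> 'm option \<Rightarrow> ennreal" where "G = (\<lambda>(u, y). indicator (cball x a) u * indicator (UNIV - Some ` ball x b) y)"
  \<comment> \<open>Landing points are restricted to M. At the lifetime a left limit in M may be
    missing, and the sum over jumps would then not register the jump to the cemetery.\<close>
  define E where "E = {\<omega>\<in>\<Omega>. leave_time x \<rho> a \<omega> < ennreal t \<and> X (leave_time x \<rho> a \<omega>) \<omega> \<in> Some ` (- ball x b)}"
  have outside: "UNIV - Some ` ball x b \<in> sets cemetery_borel"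
    using sets.compl_sets[OF sets_Some_image[of "ball x b"]] by simp
  have [measurable]: "Some ` (- ball x b) \<in> sets cemetery_borel"
    by (rule sets_Some_image) simp
  have G: "G \<in> borel_measurable (borel \<Otimes>\<^sub>M cemetery_borel)"
    unfolding G_def case_prod_beta'
    by (intro borel_measurable_times_ennreal measurable_compose[OF measurable_fst borel_measurable_indicator]
        measurable_compose[OF measurable_snd borel_measurable_indicator] outside) simp
  have G0: "G (u, Some u) = 0" for u
    using a by (auto simp: G_def split: split_indicator)
  note T = stopping_time_leave_time[OF cpt, of a]
  note [measurable] = measurable_X_stopping[OF T]
  have Tm [measurable]: "leave_time x \<rho> a \<in> borel_measurable (F \<infinity>)"
    using measurable_stopping_time[OF T, of "F \<infinity>"] sets_F_mono space_F by (simp add: sets_F_le subset_iff)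
  have E: "E \<in> sets (P (Some z))"
  proof -
    have "{\<omega>\<in>space (F \<infinity>). leave_time x \<rho> a \<omega> < ennreal t \<and> X (leave_time x \<rho> a \<omega>) \<omega> \<in> Some ` (- ball x b)} \<in> sets (F \<infinity>)"
      by measurable
    then show ?thesis unfolding E_def sets_P space_F .
  qed
  have "emeasure (P (Some z)) E = (\<integral>\<^sup>+ \<omega>. indicator E \<omega> \<partial>P (Some z))" using E by simp
  also have "\<dots> \<le> (\<integral>\<^sup>+ \<omega>. (\<integral>\<^sup>+ s. extend0 (\<lambda>x. G (x, X (ennreal s) \<omega>)) (left_lim X (ennreal s) \<omega>)
                 \<partial>count_space {0<..t}) \<partial>P (Some z))"
  proof (rule nn_integral_mono_AE)
    show "AE \<omega> in P (Some z). indicator E \<omega> \<le> (\<integral>\<^sup>+ s. extend0 (\<lambda>x. G (x, X (ennreal s) \<omega>)) (left_lim X (ennreal s) \<omega>)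
                 \<partial>count_space {0<..t})"
      using left_limits[of "Some z"] normal[of "Some z"]
    proof eventually_elim
      case (elim \<omega>)
      show ?case
      proof (cases "\<omega> \<in> E")
        case True
        then have \<omega>: "\<omega> \<in> \<Omega>" by (simp add: E_def)
        obtain \<tau> where \<tau>: "leave_time x \<rho> a \<omega> = ennreal \<tau>" "0 \<le> \<tau>" "\<tau> < t"
          using True t by (cases "leave_time x \<rho> a \<omega>") (auto simp: E_def ennreal_less_iff)
        have out: "X (ennreal \<tau>) \<omega> \<in> Some ` (- ball x b)" using True \<tau> by (simp add: E_def)
        \<comment> \<open>The start lies within distance a, hence not outside the ball of radius b,
          so the large displacement happens at a positive time and has a left limit.\<close>
        have "\<tau> \<noteq> 0"
          using elim(2) out z a by auto
        then have "0 < \<tau>" using \<tau> by simp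
        have nb: "at_left (ennreal \<tau>) \<noteq> bot" using \<open>0 < \<tau>\<close> by (intro at_left_ennreal_neq_bot) simp
        have "ennreal \<tau> < lifetime X \<omega>" using out by (intro less_lifetime[OF \<omega> \<tau>(2)]) auto
        then obtain y where y: "limitin cemetery_top (\<lambda>u. X u \<omega>) (Some y) (at_left (ennreal \<tau>))"
          using elim(1)[rule_format, of "ennreal \<tau>"] \<open>0 < \<tau>\<close> by auto
        have "Hausdorff_space (cemetery_top :: 'm option topology)"
          using locally_compact by (simp add: Hausdorff_space_Alexandroff_compactification Hausdorff_space_euclidean)
        then have "y' = y" if "limitin cemetery_top (\<lambda>u. X u \<omega>) (Some y') (at_left (ennreal \<tau>))" for y'
          using limitin_Hausdorff_unique[OF that y nb] by simp
        then have "(THE y. limitin cemetery_top (\<lambda>u. X u \<omega>) (Some y) (at_left (ennreal \<tau>))) = y"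
          using y by (intro the_equality)
        then have ll: "left_lim X (ennreal \<tau>) \<omega> = Some y" using y by (auto simp: left_lim_def)
        \<comment> \<open>Before \<open>leave_time\<close> all positions are within distance a, and
          this passes to the left limit. The displacement at \<open>leave_time\<close> is therefore
          a jump that G counts, so the sum is at least 1.\<close>
        have "trunc_dist x \<rho> (Some y) \<le> a"
        proof (rule tendsto_upperbound[OF tendsto_trunc_dist[OF cpt y] _ nb])
          have "\<forall>\<^sub>F s in at_left (ennreal \<tau>). s < ennreal \<tau>"
            by (simp add: eventually_at_filter)
          then show "\<forall>\<^sub>F s in at_left (ennreal \<tau>). trunc_dist x \<rho> (X s \<omega>) \<le> a"
            by eventually_elim (use before_leave_time \<tau> in auto)
        qed
        then have "y \<in> cball x a" using a by (auto simp: min_le_iff_disj)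
        then have "extend0 (\<lambda>x. G (x, X (ennreal \<tau>) \<omega>)) (left_lim X (ennreal \<tau>) \<omega>) = 1"
          using out by (auto simp: ll extend0_def G_def split: split_indicator)
        then have "1 \<le> (\<integral>\<^sup>+ s. extend0 (\<lambda>x. G (x, X (ennreal s) \<omega>)) (left_lim X (ennreal s) \<omega>) \<partial>count_space {0<..t})"
          using nn_integral_ge_point[of \<tau> "{0<..t}" "\<lambda>s. extend0 (\<lambda>x. G (x, X (ennreal s) \<omega>)) (left_lim X (ennreal s) \<omega>)"]
            \<open>0 < \<tau>\<close> \<tau> by simp
        then show ?thesis using True by simp
      qed simp
    qed
  qed
  also have "\<dots> = (\<integral>\<^sup>+ \<omega>. (\<integral>\<^sup>+ s\<in>{0..t}. extend0 (\<lambda>x. \<integral>\<^sup>+ y. G (x, y) \<partial>J x) (X (ennreal s) \<omega>)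
                 \<partial>lborel) \<partial>P (Some z))"
    using levy[unfolded levy_system_def, THEN conjunct2, rule_format, OF t, of G] G G0 by simp
  also have "\<dots> \<le> (\<integral>\<^sup>+ \<omega>. ennreal (C * t) \<partial>P (Some z))"
  proof (rule nn_integral_mono)
    fix \<omega>
    have "extend0 (\<lambda>x. \<integral>\<^sup>+ y. G (x, y) \<partial>J x) w \<le> ennreal C" for w
    proof (cases w)
      case (Some u)
      have "UNIV - Some ` ball x b \<in> sets (J u)" using levy outside by (simp add: levy_system_def)
      then have "(\<integral>\<^sup>+ y. G (u, y) \<partial>J u) = indicator (cball x a) u * emeasure (J u) (UNIV - Some ` ball x b)"
        unfolding G_def by (simp add: nn_integral_cmult_indicator)
      also have "\<dots> \<le> ennreal C" using rate[of u] by (auto split: split_indicator)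
      finally show ?thesis by (simp add: Some extend0_def)
    qed (simp add: extend0_def)
    then have "(\<integral>\<^sup>+ s\<in>{0..t}. extend0 (\<lambda>x. \<integral>\<^sup>+ y. G (x, y) \<partial>J x) (X (ennreal s) \<omega>) \<partial>lborel) \<le>
       (\<integral>\<^sup>+ s. ennreal C * indicator {0..t} s \<partial>lborel)"
      by (intro nn_integral_mono mult_right_mono) auto
    also have "\<dots> = ennreal (C * t)" using t C by (simp add: nn_integral_cmult_indicator ennreal_mult)
    finally show "(\<integral>\<^sup>+ s\<in>{0..t}. extend0 (\<lambda>x. \<integral>\<^sup>+ y. G (x, y) \<partial>J x) (X (ennreal s) \<omega>) \<partial>lborel) \<le> ennreal (C * t)" .
  qed
  also have "\<dots> = ennreal (C * t)"
    using prob_space.emeasure_space_1[OF prob_P] by simp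
  finally show ?thesis by (simp add: E_def)
qed

lemma Fubini_path:
  assumes w: "right_cont w" and bd: "\<And>z. w z \<le> 1" and B: "B \<in> sets borel"
  shows "(\<integral>\<^sup>+ \<omega>. (\<integral>\<^sup>+ v\<in>B. w (X (ennreal v) \<omega>) \<partial>lborel) \<partial>P x) =
         (\<integral>\<^sup>+ v\<in>B. (\<integral>\<^sup>+ \<omega>. w (X (ennreal v) \<omega>) \<partial>P x) \<partial>lborel)"
proof -
  interpret prob_space "P x" by (rule prob_P)
  have "(\<integral>\<^sup>+ \<omega>. (\<integral>\<^sup>+ v\<in>B. w (X (ennreal v) \<omega>) \<partial>lborel) \<partial>P x) =
    (\<integral>\<^sup>+ v\<in>B. (\<integral>\<^sup>+ \<omega>. 1 * (\<integral>\<^sup>+ \<omega>'. w (X (ennreal v) \<omega>') \<partial>P (X 0 \<omega>)) \<partial>P x) \<partial>lborel)"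
    using strong_markov_integral(1)[OF stopping_time_const[of F 0] w bd _ B, of "\<lambda>_. 1" x] by simp
  also have "\<dots> = (\<integral>\<^sup>+ v\<in>B. (\<integral>\<^sup>+ \<omega>. w (X (ennreal v) \<omega>) \<partial>P x) \<partial>lborel)"
  proof (intro nn_integral_cong)
    fix v
    have "(\<integral>\<^sup>+ \<omega>. 1 * (\<integral>\<^sup>+ \<omega>'. w (X (ennreal v) \<omega>') \<partial>P (X 0 \<omega>)) \<partial>P x) =
      (\<integral>\<^sup>+ \<omega>. (\<integral>\<^sup>+ \<omega>'. w (X (ennreal v) \<omega>') \<partial>P x) \<partial>P x)"
      by (rule nn_integral_cong_AE) (use normal[of x] in \<open>eventually_elim, simp\<close>)
    then show "(\<integral>\<^sup>+ \<omega>. 1 * (\<integral>\<^sup>+ \<omega>'. w (X (ennreal v) \<omega>') \<partial>P (X 0 \<omega>)) \<partial>P x) * indicator B v =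
        (\<integral>\<^sup>+ \<omega>. w (X (ennreal v) \<omega>) \<partial>P x) * indicator B v"
      by (simp add: emeasure_space_1[simplified])
  qed
  finally show ?thesis .
qed

end

section \<open>The local scaling hypotheses\<close>

text \<open>The hypotheses near one point x, at all radii up to \<rho> and all centres within
  \<rho>. The constants are the global ones; only \<rho> may depend on x. Continuity and the limit
  at 0 are demanded at x itself, because radii are prescribed through values of
  \<open>\<phi> x\<close>.\<close>

locale scaled_process = borel_standard_process \<Omega> F X P
  for \<Omega> :: "'w set" and F :: "ennreal \<Rightarrow> 'w measure"
    and X :: "ennreal \<Rightarrow> 'w \<Rightarrow> 'm::{metric_space, second_countable_topology} option"
    and P :: "'m option \<Rightarrow> 'w measure" +
  fixes J :: "'m \<Rightarrow> 'm option measure" and \<phi> :: "'m \<Rightarrow> real \<Rightarrow> real" and x :: 'm and \<rho> :: real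
    and C1 C2 C3 C4 C5 C6 C7 :: real
  assumes levy: "levy_system X P J"
    and const_pos: "1 < C1" "0 < C2" "0 < C3" "0 < C4" "0 < C5" "0 < C6" "0 < C7"
    and rho: "0 < \<rho>" and cpt: "compact (cball x \<rho>)"
    and phi_pos: "\<And>y r. y \<in> cball x \<rho> \<Longrightarrow> 0 < r \<Longrightarrow> r \<le> \<rho> \<Longrightarrow> 0 < \<phi> y r"
    and phi_mono: "\<And>y r s. y \<in> cball x \<rho> \<Longrightarrow> 0 < r \<Longrightarrow> r \<le> s \<Longrightarrow> s \<le> \<rho> \<Longrightarrow> \<phi> y r \<le> \<phi> y s"
    and phi_cont: "continuous_on {0<..\<rho>} (\<phi> x)"
    and phi_lim: "(\<phi> x \<longlongrightarrow> 0) (at_right 0)"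
    and CE: "\<And>y r z. y \<in> cball x \<rho> \<Longrightarrow> 0 < r \<Longrightarrow> r \<le> \<rho> \<Longrightarrow> z \<in> ball y r \<Longrightarrow>
      \<phi> z r \<le> C1 * \<phi> y r \<and> \<phi> y r \<le> C1 * \<phi> z r"
    and doubling: "\<And>y r. y \<in> cball x \<rho> \<Longrightarrow> 0 < r \<Longrightarrow> r \<le> \<rho> \<Longrightarrow> \<phi> y r \<le> C2 * \<phi> y (r / 2)"
    and tail: "\<And>y r. y \<in> cball x \<rho> \<Longrightarrow> 0 < r \<Longrightarrow> r \<le> \<rho> \<Longrightarrow>
      emeasure (J y) (UNIV - Some ` ball y r) \<le> ennreal (C3 / \<phi> y r)"
    and SP_lower: "\<And>y r n. y \<in> cball x \<rho> \<Longrightarrow> 0 < r \<Longrightarrow> r \<le> \<rho> \<Longrightarrow> 1 \<le> (n::nat) \<Longrightarrow>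
      C4 * exp (- C5 * real n) \<le> measure (P (Some y)) {\<omega>\<in>\<Omega>. ennreal (real n * \<phi> y r) \<le> exit_time X (ball y r) \<omega>}"
    and SP_upper: "\<And>y r n. y \<in> cball x \<rho> \<Longrightarrow> 0 < r \<Longrightarrow> r \<le> \<rho> \<Longrightarrow> 1 \<le> (n::nat) \<Longrightarrow>
      measure (P (Some y)) {\<omega>\<in>\<Omega>. ennreal (real n * \<phi> y r) \<le> exit_time X (ball y r) \<omega>} \<le> C6 * exp (- C7 * real n)"
begin

lemma x_in: "x \<in> cball x \<rho>"
  using rho by simp

lemma C2_ge_1: "1 \<le> C2"
proof -
  have "\<phi> x \<rho> \<le> C2 * \<phi> x (\<rho> / 2)" using doubling[OF x_in rho] by simp
  also have "\<dots> \<le> C2 * \<phi> x \<rho>" using phi_mono[OF x_in, of "\<rho> / 2" \<rho>] rho const_pos by (intro mult_left_mono) auto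
  finally show ?thesis using phi_pos[OF x_in rho] by simp
qed

lemma doubling_pow:
  assumes "y \<in> cball x \<rho>" "0 < r" "2 ^ k * r \<le> \<rho>"
  shows "\<phi> y (2 ^ k * r) \<le> C2 ^ k * \<phi> y r"
  using assms(3)
proof (induction k)
  case (Suc k)
  have "2 ^ k * r \<le> 2 ^ Suc k * r" using assms(2) by simp
  then have le: "2 ^ k * r \<le> \<rho>" using Suc.prems by linarith
  have "\<phi> y (2 ^ Suc k * r) \<le> C2 * \<phi> y (2 ^ k * r)"
    using doubling[OF assms(1) _ Suc.prems] assms(2) by simp
  also have "\<dots> \<le> C2 * (C2 ^ k * \<phi> y r)"
    using Suc.IH[OF le] const_pos by (intro mult_left_mono) auto
  finally show ?case by (simp add: mult.assoc)
qed simp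

text \<open>\<^const>\<open>measure\<close> vanishes on non-measurable sets, so the lower bound in (SP) forces measurability.\<close>

lemma exit_event_measurable:
  assumes "y \<in> cball x \<rho>" "0 < r" "r \<le> \<rho>" "1 \<le> n"
  shows "{\<omega>\<in>\<Omega>. ennreal (real n * \<phi> y r) \<le> exit_time X (ball y r) \<omega>} \<in> sets (F \<infinity>)"
proof (rule ccontr)
  assume "\<not> ?thesis"
  then have "measure (P (Some y)) {\<omega>\<in>\<Omega>. ennreal (real n * \<phi> y r) \<le> exit_time X (ball y r) \<omega>} = 0"
    by (intro measure_notin_sets) (simp add: sets_P)
  then show False using SP_lower[OF assms] const_pos by (simp add: mult_le_0_iff)
qed

lemma before_exit_time:
  assumes "t < exit_time X D \<omega>" "0 < t"
  shows "X t \<omega> \<in> Some ` D"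
proof (rule ccontr)
  assume "X t \<omega> \<notin> Some ` D"
  then have "exit_time X D \<omega> \<le> t" unfolding exit_time_def using assms(2) by (intro Inf_lower) auto
  then show False using assms(1) by simp
qed

lemma stay_probability:
  assumes y: "y \<in> cball x \<rho>" "0 < r" "r \<le> \<rho>" "1 \<le> n" and v: "0 < v" "v < real n * \<phi> y r"
  shows "C4 * exp (- C5 * real n) \<le> measure (P (Some y)) {\<omega>\<in>\<Omega>. X (ennreal v) \<omega> \<in> Some ` ball y r}"
proof -
  interpret prob_space "P (Some y)" by (rule prob_P)
  have "measure (P (Some y)) {\<omega>\<in>\<Omega>. ennreal (real n * \<phi> y r) \<le> exit_time X (ball y r) \<omega>} \<le>
    measure (P (Some y)) {\<omega>\<in>\<Omega>. X (ennreal v) \<omega> \<in> Some ` ball y r}"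
  proof (rule finite_measure_mono)
    have "ennreal v < ennreal (real n * \<phi> y r)" using v by (simp add: ennreal_less_iff)
    then show "{\<omega>\<in>\<Omega>. ennreal (real n * \<phi> y r) \<le> exit_time X (ball y r) \<omega>} \<subseteq> {\<omega>\<in>\<Omega>. X (ennreal v) \<omega> \<in> Some ` ball y r}"
      using v by (auto intro!: before_exit_time)
    have [measurable]: "Some ` ball y r \<in> sets cemetery_borel" by (rule sets_Some_image) simp
    have "{\<omega>\<in>space (F \<infinity>). X (ennreal v) \<omega> \<in> Some ` ball y r} \<in> sets (F \<infinity>)" by measurable
    then show "{\<omega>\<in>\<Omega>. X (ennreal v) \<omega> \<in> Some ` ball y r} \<in> events" unfolding sets_P space_F .
  qed
  then show ?thesis using SP_lower[OF y] by linarith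
qed

text \<open>A continuous stand-in for the indicator of the ball of radius R: equal to 1 up to R, to
  0 from 2R on, and linear in between.\<close>

definition cut :: "real \<Rightarrow> 'm option \<Rightarrow> ennreal" where
  "cut R z = ennreal (max 0 (min 1 (2 - trunc_dist x \<rho> z / R)))"

text \<open>The gap between the cutoffs at S and R, plus death. A killed process has left the R-ball
  for good, and counting it here means that leaving by death needs no estimate of its own.\<close>

definition shell :: "real \<Rightarrow> real \<Rightarrow> 'm option \<Rightarrow> ennreal" where
  "shell R S z = ennreal (max 0 (min 1 (2 - trunc_dist x \<rho> z / S)) - max 0 (min 1 (2 - trunc_dist x \<rho> z / R)))
     + indicator {None} z"

lemma trunc_dist_nonneg: "0 \<le> trunc_dist x \<rho> z"
  using rho by (cases z) auto

lemma right_cont_cut: "0 < R \<Longrightarrow> right_cont (cut R)"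
  unfolding cut_def[abs_def]
  by (rule right_cont_trunc_dist[OF cpt, of "\<lambda>h. max 0 (min 1 (2 - h / R))"]) (intro continuous_intros, simp)

lemma right_cont_shell: "0 < R \<Longrightarrow> 0 < S \<Longrightarrow> right_cont (shell R S)"
  unfolding shell_def[abs_def]
  by (intro right_cont_add right_cont_dead
      right_cont_trunc_dist[OF cpt, of "\<lambda>h. max 0 (min 1 (2 - h / S)) - max 0 (min 1 (2 - h / R))"])
    (intro continuous_intros, simp_all)

lemma cut_le_1: "cut R z \<le> 1"
  by (simp add: cut_def)

text \<open>The two summands do not overlap: with \<open>2 * S \<le> \<rho>\<close> the cemetery has
  truncated distance at least 2S, where the cutoff at S is 0.\<close>

lemma shell_le_1:
  assumes "0 < R" "0 < S" "2 * S \<le> \<rho>"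
  shows "shell R S z \<le> 1"
proof (cases z)
  case None
  have "2 - \<rho> / S \<le> 0" using assms by (simp add: field_simps)
  then show ?thesis by (simp add: shell_def None ennreal_neg)
next
  case (Some y)
  have "max 0 (min 1 a) - max 0 (min 1 b) \<le> (1::real)" for a b by (auto simp: max_def min_def)
  then show ?thesis by (simp add: shell_def Some)
qed

lemma cut_eq_1: "0 < R \<Longrightarrow> trunc_dist x \<rho> z \<le> R \<Longrightarrow> cut R z = 1"
  by (simp add: cut_def min_def max_def field_simps)

lemma cut_eq_0: "0 < R \<Longrightarrow> 2 * R \<le> trunc_dist x \<rho> z \<Longrightarrow> cut R z = 0"
  by (simp add: cut_def min_def max_def field_simps)

lemma cut_None: "0 < R \<Longrightarrow> 2 * R \<le> \<rho> \<Longrightarrow> cut R None = 0"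
  by (rule cut_eq_0) simp_all

lemma shell_eq_1:
  assumes "0 < R" "2 * S \<le> \<rho>" "2 * R \<le> dist x y" "dist x y \<le> S" "0 < S"
  shows "shell R S (Some y) = 1"
  using assms by (simp add: shell_def min_def max_def field_simps)

lemma cut_plus_shell:
  assumes "0 < R" "R \<le> S"
  shows "cut R z + shell R S z = cut S z + indicator {None} z"
proof -
  have "trunc_dist x \<rho> z / S \<le> trunc_dist x \<rho> z / R"
    using assms trunc_dist_nonneg[of z] by (intro divide_left_mono) auto
  then have "max 0 (min 1 (2 - trunc_dist x \<rho> z / R)) \<le> max 0 (min 1 (2 - trunc_dist x \<rho> z / S))"
    by (auto simp: max_def min_def)
  then have "ennreal (max 0 (min 1 (2 - trunc_dist x \<rho> z / R))) +
    ennreal (max 0 (min 1 (2 - trunc_dist x \<rho> z / S)) - max 0 (min 1 (2 - trunc_dist x \<rho> z / R))) =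
    ennreal (max 0 (min 1 (2 - trunc_dist x \<rho> z / S)))"
    by (subst ennreal_plus[symmetric]) auto
  then show ?thesis by (simp add: cut_def shell_def add.assoc[symmetric])
qed

end

text \<open>N makes it unlikely (at most 1/4) to stay N time units in a ball. The ratio \<beta> of
  consecutive scales is so large that their radii differ by more than a factor 16 (first bound) and
  that a jump over a whole scale has probability at most 1/4 (second bound).\<close>

locale multiscale_process = scaled_process \<Omega> F X P J \<phi> x \<rho> C1 C2 C3 C4 C5 C6 C7
  for \<Omega> :: "'w set" and F :: "ennreal \<Rightarrow> 'w measure"
    and X :: "ennreal \<Rightarrow> 'w \<Rightarrow> 'm::{metric_space, second_countable_topology} option"
    and P :: "'m option \<Rightarrow> 'w measure"
    and J \<phi> x \<rho> C1 C2 C3 C4 C5 C6 C7 +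
  fixes N :: nat and \<beta> :: real
  assumes N: "1 \<le> N" "C6 * exp (- C7 * real N) \<le> 1 / 4"
    and lam: "C2 ^ 4 < \<beta>" "4 * (real N * C1 ^ 2 * C2 ^ 5 * C3) \<le> \<beta>"
begin

text \<open>Within a factor 16, four doublings would give a ratio of at most \<open>C2 ^ 4\<close>,
  which is less than \<beta>.\<close>

lemma scale_gap:
  assumes R: "0 < R" "R \<le> S" "16 * R \<le> \<rho>" "S \<le> \<rho>" and eq: "\<phi> x S = \<beta> * \<phi> x R"
  shows "16 * R < S"
proof (rule ccontr)
  assume "\<not> 16 * R < S"
  then have "\<phi> x S \<le> \<phi> x (16 * R)" using R by (intro phi_mono[OF x_in]) auto
  also have "\<dots> \<le> C2 ^ 4 * \<phi> x R" using doubling_pow[OF x_in R(1), of 4] R by simp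
  also have "\<dots> < \<beta> * \<phi> x R" using lam phi_pos[OF x_in R(1)] R by simp
  finally show False using eq by simp
qed

lemma leave_soon:
  assumes R: "0 < R" "8 * R \<le> \<rho>" and z: "dist x z < 2 * R"
  shows "measure (P (Some z)) {\<omega>\<in>\<Omega>. ennreal (real N * C1 * C2 ^ 3 * \<phi> x R) \<le> leave_time x \<rho> (4 * R) \<omega>} \<le> 1 / 4"
proof -
  interpret prob_space "P (Some z)" by (rule prob_P)
  have zin: "z \<in> cball x \<rho>" using R z by simp
  \<comment> \<open>From z the ball of radius 4R around x lies within 6R; the next power of two
    times R is 8R, so that three doublings lead back to R, after one change of centre by
    (CE).\<close>
  have "\<phi> z (8 * R) \<le> C1 * \<phi> x (8 * R)" using CE[OF x_in, of "8 * R" z] R z by simp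
  also have "\<dots> \<le> C1 * (C2 ^ 3 * \<phi> x R)" using doubling_pow[OF x_in R(1), of 3] R const_pos by (intro mult_left_mono) auto
  finally have le: "real N * \<phi> z (8 * R) \<le> real N * C1 * C2 ^ 3 * \<phi> x R"
    by (auto simp: mult.assoc intro: mult_left_mono)
  have "measure (P (Some z)) {\<omega>\<in>\<Omega>. ennreal (real N * C1 * C2 ^ 3 * \<phi> x R) \<le> leave_time x \<rho> (4 * R) \<omega>} \<le>
    measure (P (Some z)) {\<omega>\<in>\<Omega>. ennreal (real N * \<phi> z (8 * R)) \<le> exit_time X (ball z (8 * R)) \<omega>}"
  proof (rule finite_measure_mono)
    show "{\<omega>\<in>\<Omega>. ennreal (real N * \<phi> z (8 * R)) \<le> exit_time X (ball z (8 * R)) \<omega>} \<in> events"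
      unfolding sets_P using R N by (intro exit_event_measurable zin) auto
    show "{\<omega>\<in>\<Omega>. ennreal (real N * C1 * C2 ^ 3 * \<phi> x R) \<le> leave_time x \<rho> (4 * R) \<omega>} \<subseteq>
      {\<omega>\<in>\<Omega>. ennreal (real N * \<phi> z (8 * R)) \<le> exit_time X (ball z (8 * R)) \<omega>}"
    proof safe
      fix \<omega> assume \<omega>: "\<omega> \<in> \<Omega>" and *: "ennreal (real N * C1 * C2 ^ 3 * \<phi> x R) \<le> leave_time x \<rho> (4 * R) \<omega>"
      show "ennreal (real N * \<phi> z (8 * R)) \<le> exit_time X (ball z (8 * R)) \<omega>"
        unfolding exit_time_def
      proof (rule Inf_greatest)
        fix t assume t: "t \<in> {t. 0 < t \<and> X t \<omega> \<in> UNIV - Some ` ball z (8 * R)}"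
        show "ennreal (real N * \<phi> z (8 * R)) \<le> t"
        proof (rule ccontr)
          assume "\<not> ?thesis"
          then have "t < leave_time x \<rho> (4 * R) \<omega>"
            using * ennreal_leI[OF le] by (meson less_le_trans not_le)
          then have "trunc_dist x \<rho> (X t \<omega>) \<le> 4 * R" by (rule before_leave_time)
          then obtain u where u: "X t \<omega> = Some u" "dist x u \<le> 4 * R"
            using R by (cases "X t \<omega>") (auto simp: min_le_iff_disj)
          have "dist z u < 8 * R" using dist_triangle[of z u x] u z R by (simp add: dist_commute)
          then show False using t u by auto
        qed
      qed
    qed
  qed
  also have "\<dots> \<le> 1 / 4" using SP_upper[OF zin _ _ N(1), of "8 * R"] R N by simp
  finally show ?thesis .
qed

text \<open>From within 4R, reaching distance S/2 takes a jump of length at least S/4, as 16R < S.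
  By (Tail), (CE) and two doublings its rate is of order 1 / (\<beta> \<phi>(x, R)), and over a time
  of order \<phi>(x, R) the factor \<beta> wins.\<close>

lemma no_long_jump:
  assumes R: "0 < R" "16 * R < S" "2 * S \<le> \<rho>" and eq: "\<phi> x S = \<beta> * \<phi> x R" and z: "dist x z < 2 * R"
  defines "a \<equiv> real N * C1 * C2 ^ 3 * \<phi> x R"
  shows "emeasure (P (Some z)) {\<omega>\<in>\<Omega>. leave_time x \<rho> (4 * R) \<omega> < ennreal a \<and>
     X (leave_time x \<rho> (4 * R) \<omega>) \<omega> \<in> Some ` (- ball x (S / 2))} \<le> ennreal (1 / 4)"
proof -
  have pR: "0 < \<phi> x R" using R by (intro phi_pos[OF x_in]) auto
  define C where "C = C3 * C1 * C2 ^ 2 / (\<beta> * \<phi> x R)"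
  have "0 < \<beta>" using lam(1) const_pos by (meson less_trans zero_less_power)
  then have C: "0 \<le> C" using const_pos pR by (simp add: C_def)
  have a: "0 < a" unfolding a_def using N const_pos pR by simp
  have rate: "emeasure (J u) (UNIV - Some ` ball x (S / 2)) \<le> ennreal C" if u: "u \<in> cball x (4 * R)" for u
  proof -
    have uin: "u \<in> cball x \<rho>" and ub: "u \<in> ball x (S / 4)" using u R by auto
    have pu: "0 < \<phi> u (S / 4)" using R by (intro phi_pos[OF uin]) auto
    have Some_borel: "Some ` ball u (S / 4) \<in> sets cemetery_borel" by (rule sets_Some_image) simp
    have sJ: "sets (J u) = sets cemetery_borel" using levy by (simp add: levy_system_def)
    have "ball u (S / 4) \<subseteq> ball x (S / 2)"
    proof
      fix v assume "v \<in> ball u (S / 4)"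
      then show "v \<in> ball x (S / 2)" using dist_triangle[of x v u] ub by simp
    qed
    then have "emeasure (J u) (UNIV - Some ` ball x (S / 2)) \<le> emeasure (J u) (UNIV - Some ` ball u (S / 4))"
      using sets.compl_sets[OF Some_borel] by (intro emeasure_mono) (auto simp: sJ)
    also have "\<dots> \<le> ennreal (C3 / \<phi> u (S / 4))" using R by (intro tail[OF uin]) auto
    also have "\<dots> \<le> ennreal C"
    proof (rule ennreal_leI)
      have "\<beta> * \<phi> x R \<le> C2 ^ 2 * \<phi> x (S / 4)"
        using doubling_pow[OF x_in, of "S / 4" 2] R eq by simp
      also have "\<dots> \<le> C2 ^ 2 * (C1 * \<phi> u (S / 4))"
        using CE[OF x_in, of "S / 4" u] ub R by (intro mult_left_mono) auto
      finally have "\<beta> * \<phi> x R \<le> C1 * C2 ^ 2 * \<phi> u (S / 4)" by (simp add: ac_simps)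
      then have "C3 * (\<beta> * \<phi> x R) \<le> C3 * (C1 * C2 ^ 2 * \<phi> u (S / 4))" using const_pos by (intro mult_left_mono) auto
      then show "C3 / \<phi> u (S / 4) \<le> C"
        unfolding C_def using pu pR \<open>0 < \<beta>\<close> by (simp add: field_simps)
    qed
    finally show ?thesis .
  qed
  have "C * a = real N * C1 ^ 2 * C2 ^ 5 * C3 / \<beta>"
    unfolding C_def a_def using pR by (simp add: field_simps power2_eq_square eval_nat_numeral)
  also have "\<dots> \<le> 1 / 4" using lam \<open>0 < \<beta>\<close> by (simp add: field_simps)
  finally have "C * a \<le> 1 / 4" .
  then have "ennreal (C * a) \<le> ennreal (1 / 4)" by (rule ennreal_leI)
  moreover have "emeasure (P (Some z)) {\<omega>\<in>\<Omega>. leave_time x \<rho> (4 * R) \<omega> < ennreal a \<and>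
     X (leave_time x \<rho> (4 * R) \<omega>) \<omega> \<in> Some ` (- ball x (S / 2))} \<le> ennreal (C * a)"
    using R z a C rate by (intro jump_at_leave_time[OF levy cpt]) auto
  ultimately show ?thesis by (rule order_trans[rotated])
qed

text \<open>If the landing point u is at distance d in [4R, S/2), the ball of radius d/2 around u
  stays between the distances 2R and S, where \<open>shell\<close> is 1. Its radius is at least 2R,
  so by (SP) it is kept for a time comparable to \<phi>(x, R).\<close>

lemma stay_in_shell:
  assumes R: "0 < R" "16 * R < S" "2 * S \<le> \<rho>" and w: "w = None \<or> (\<exists>u. w = Some u \<and> 4 * R \<le> dist x u \<and> dist x u < S / 2)"
    and v: "0 < v" "v < \<phi> x R / (C1 * C2 ^ 2)"
  shows "ennreal (C4 * exp (- C5)) \<le> (\<integral>\<^sup>+ \<omega>. shell R S (X (ennreal v) \<omega>) \<partial>P w)"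
proof -
  interpret prob_space "P w" by (rule prob_P)
  from w consider "w = None" | u where "w = Some u" "4 * R \<le> dist x u" "dist x u < S / 2" by auto
  then show ?thesis
  proof cases
    case 1
    \<comment> \<open>It bounds a probability from below.\<close>
    have "C4 * exp (- C5) \<le> 1"
    proof -
      have "C4 * exp (- C5) \<le> measure (P (Some x)) {\<omega>\<in>\<Omega>. ennreal (real 1 * \<phi> x \<rho>) \<le> exit_time X (ball x \<rho>) \<omega>}"
        using SP_lower[OF x_in rho, of 1] by simp
      also have "\<dots> \<le> 1" by (rule prob_space.prob_le_1[OF prob_P])
      finally show ?thesis .
    qed
    then have "ennreal (C4 * exp (- C5)) \<le> 1" by (simp add: ennreal_le_1)
    also have "1 = (\<integral>\<^sup>+ \<omega>. 1 \<partial>P w)" using emeasure_space_1 by simp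
    also have "\<dots> \<le> (\<integral>\<^sup>+ \<omega>. shell R S (X (ennreal v) \<omega>) \<partial>P w)"
    proof (rule nn_integral_mono_AE)
      show "AE \<omega> in P w. 1 \<le> shell R S (X (ennreal v) \<omega>)"
        using normal[of w] AE_space
      proof eventually_elim
        case (elim \<omega>)
        then have "X (ennreal v) \<omega> = None"
          using cemetery_absorbing[of \<omega> 0 "ennreal v"] 1 by simp
        then show ?case by (simp add: shell_def)
      qed
    qed
    finally show ?thesis .
  next
    case (2 u)
    define d where "d = dist x u"
    have d: "4 * R \<le> d" "d < S / 2" using 2 by (simp_all add: d_def)
    have uin: "u \<in> cball x \<rho>" using d R by (simp add: d_def)
    have "\<phi> x R \<le> \<phi> x (2 * d)" using d R by (intro phi_mono[OF x_in]) auto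
    \<comment> \<open>Radius 2d: the open ball of radius d around x does not contain u, and 2d is
      two doublings of d/2.\<close>
    also have "\<dots> \<le> C1 * \<phi> u (2 * d)"
    proof -
      have "u \<in> ball x (2 * d)" using d R by (simp add: d_def[symmetric])
      then show ?thesis using CE[OF x_in, of "2 * d" u] d R by simp
    qed
    also have "\<dots> \<le> C1 * (C2 ^ 2 * \<phi> u (d / 2))"
      using doubling_pow[OF uin, of "d / 2" 2] d R const_pos by (intro mult_left_mono) auto
    finally have "\<phi> x R / (C1 * C2 ^ 2) \<le> \<phi> u (d / 2)"
      using const_pos by (simp add: field_simps)
    then have "v < real 1 * \<phi> u (d / 2)" using v by simp
    from stay_probability[OF uin _ _ _ v(1) this]
    have "C4 * exp (- C5) \<le> prob {\<omega>\<in>\<Omega>. X (ennreal v) \<omega> \<in> Some ` ball u (d / 2)}"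
      using d R 2 by simp
    then have "ennreal (C4 * exp (- C5)) \<le> emeasure (P w) {\<omega>\<in>\<Omega>. X (ennreal v) \<omega> \<in> Some ` ball u (d / 2)}"
      by (simp add: emeasure_eq_measure ennreal_leI)
    also have "\<dots> = (\<integral>\<^sup>+ \<omega>. indicator {\<omega>\<in>\<Omega>. X (ennreal v) \<omega> \<in> Some ` ball u (d / 2)} \<omega> \<partial>P w)"
    proof (rule nn_integral_indicator[symmetric])
      have [measurable]: "Some ` ball u (d / 2) \<in> sets cemetery_borel" by (rule sets_Some_image) simp
      have "{\<omega>\<in>space (F \<infinity>). X (ennreal v) \<omega> \<in> Some ` ball u (d / 2)} \<in> sets (F \<infinity>)" by measurable
      then show "{\<omega>\<in>\<Omega>. X (ennreal v) \<omega> \<in> Some ` ball u (d / 2)} \<in> events" unfolding sets_P space_F .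
    qed
    also have "\<dots> \<le> (\<integral>\<^sup>+ \<omega>. shell R S (X (ennreal v) \<omega>) \<partial>P w)"
    proof (rule nn_integral_mono)
      fix \<omega>
      show "indicator {\<omega>\<in>\<Omega>. X (ennreal v) \<omega> \<in> Some ` ball u (d / 2)} \<omega> \<le> shell R S (X (ennreal v) \<omega>)"
      proof (cases "X (ennreal v) \<omega> \<in> Some ` ball u (d / 2)")
        case True
        then obtain y where y: "X (ennreal v) \<omega> = Some y" "dist u y < d / 2" by auto
        have "d \<le> dist x y + dist u y" "dist x y \<le> d + dist u y"
          using dist_triangle[of x u y] dist_triangle[of x y u] by (simp_all add: d_def dist_commute)
        then have "2 * R \<le> dist x y" "dist x y \<le> S" using y d R by linarith+
        then have "shell R S (Some y) = 1" using R by (intro shell_eq_1) auto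
        then show ?thesis using y by (auto split: split_indicator)
      qed (auto split: split_indicator)
    qed
    finally show ?thesis .
  qed
qed

text \<open>Here a is the time allowed for leaving and b the time of the subsequent stay. With
  probability at least 1/2 the process leaves in time without a long jump, and then each instant of
  the following b units is spent in the shell with probability at least
  \<open>C4 * exp (- C5)\<close>.\<close>

lemma shell_time_lower:
  assumes R: "0 < R" "16 * R < S" "2 * S \<le> \<rho>" and eq: "\<phi> x S = \<beta> * \<phi> x R" and z: "dist x z < 2 * R"
  defines "b \<equiv> \<phi> x R / (C1 * C2 ^ 2)" and "a \<equiv> real N * C1 * C2 ^ 3 * \<phi> x R"
  shows "ennreal (C4 * exp (- C5) * b / 2) \<le>
    (\<integral>\<^sup>+ v\<in>{0..a + b}. (\<integral>\<^sup>+ \<omega>. shell R S (X (ennreal v) \<omega>) \<partial>P (Some z)) \<partial>lborel)"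
proof -
  interpret prob_space "P (Some z)" by (rule prob_P)
  have pR: "0 < \<phi> x R" using R by (intro phi_pos[OF x_in]) auto
  have ab: "0 < a" "0 < b" unfolding a_def b_def using N const_pos pR by simp_all
  let ?T = "leave_time x \<rho> (4 * R)"
  note T = stopping_time_leave_time[OF cpt, of "4 * R"]
  have S: "0 < S" using R by simp
  note rc = right_cont_shell[OF R(1) S] and bd = shell_le_1[OF R(1) S R(3)]
  note [measurable] = measurable_X_stopping[OF T]
  have Tm [measurable]: "?T \<in> borel_measurable (F \<infinity>)"
    using measurable_stopping_time[OF T, of "F \<infinity>"] sets_F_mono space_F by (simp add: sets_F_le subset_iff)
  define D where "D = Some ` (- ball x (S / 2))"
  have [measurable]: "D \<in> sets cemetery_borel" unfolding D_def by (rule sets_Some_image) simp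
  \<comment> \<open>The two failures: staying too long, and jumping too far. L is their complement;
    it belongs to the past of the leaving time, and death at that time counts as success.\<close>
  define E1 where "E1 = {\<omega>\<in>\<Omega>. ennreal a \<le> ?T \<omega>}"
  define E2 where "E2 = {\<omega>\<in>\<Omega>. ?T \<omega> < ennreal a \<and> X (?T \<omega>) \<omega> \<in> D}"
  define L where "L = {\<omega>\<in>\<Omega>. ?T \<omega> < ennreal a \<and> X (?T \<omega>) \<omega> \<notin> D}"
  have [measurable]: "E1 \<in> events" "E2 \<in> events"
  proof -
    have "{\<omega>\<in>space (F \<infinity>). ennreal a \<le> ?T \<omega>} \<in> sets (F \<infinity>)"
      "{\<omega>\<in>space (F \<infinity>). ?T \<omega> < ennreal a \<and> X (?T \<omega>) \<omega> \<in> D} \<in> sets (F \<infinity>)" by measurable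
    then show "E1 \<in> events" "E2 \<in> events" unfolding E1_def E2_def sets_P space_F by auto
  qed
  have Lpre: "L \<in> sets (pre_sigma ?T)"
  proof -
    note [measurable] = stopped_measurable[OF T] measurable_stopping_time_pre_sigma[OF T]
    have "{\<omega>\<in>space (pre_sigma ?T). ?T \<omega> < ennreal a \<and> X (?T \<omega>) \<omega> \<notin> D} \<in> sets (pre_sigma ?T)"
      by measurable
    then show ?thesis unfolding L_def space_pre_sigma .
  qed
  have Lev [measurable]: "L \<in> events" unfolding sets_P by (rule sets_pre_sigma_le[OF T Lpre])
  have "prob E1 \<le> 1 / 4"
    unfolding E1_def a_def using R z by (intro leave_soon) auto
  moreover have "prob E2 \<le> 1 / 4"
    using no_long_jump[OF R eq z] unfolding E2_def D_def a_def by (simp add: emeasure_eq_measure)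
  moreover have "1 \<le> prob E1 + prob E2 + prob L"
  proof -
    have "1 = prob (E1 \<union> E2 \<union> L)"
      using prob_space by (simp add: E1_def E2_def L_def Un_def) (metis (no_types, lifting) Collect_cong Collect_mem_eq not_le)
    also have "\<dots> \<le> prob (E1 \<union> E2) + prob L" by (rule measure_Un_le) auto
    also have "prob (E1 \<union> E2) \<le> prob E1 + prob E2" by (rule measure_Un_le) auto
    finally show ?thesis by simp
  qed
  ultimately have pL: "1 / 2 \<le> prob L" by linarith
  have "ennreal (C4 * exp (- C5) * b / 2) \<le> ennreal (C4 * exp (- C5) * prob L * b)"
  proof (rule ennreal_leI)
    have "C4 * exp (- C5) * b * (1 / 2) \<le> C4 * exp (- C5) * b * prob L"
      using pL ab const_pos by (intro mult_left_mono) auto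
    then show "C4 * exp (- C5) * b / 2 \<le> C4 * exp (- C5) * prob L * b" by (simp add: ac_simps)
  qed
  also have "\<dots> = (\<integral>\<^sup>+ v\<in>{0<..<b}. ennreal (C4 * exp (- C5) * prob L) \<partial>lborel)"
    using ab const_pos by (simp add: nn_integral_cmult_indicator ennreal_mult)
  also have "\<dots> \<le> (\<integral>\<^sup>+ v\<in>{0<..<b}. (\<integral>\<^sup>+ \<omega>. indicator L \<omega> * (\<integral>\<^sup>+ \<omega>'. shell R S (X (ennreal v) \<omega>') \<partial>P (X (?T \<omega>) \<omega>)) \<partial>P (Some z)) \<partial>lborel)"
  proof (intro nn_integral_mono)
    fix v :: real
    show "ennreal (C4 * exp (- C5) * prob L) * indicator {0<..<b} v \<le>
      (\<integral>\<^sup>+ \<omega>. indicator L \<omega> * (\<integral>\<^sup>+ \<omega>'. shell R S (X (ennreal v) \<omega>') \<partial>P (X (?T \<omega>) \<omega>)) \<partial>P (Some z)) * indicator {0<..<b} v"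
    proof (cases "v \<in> {0<..<b}")
      case True
      have "ennreal (C4 * exp (- C5) * prob L) = (\<integral>\<^sup>+ \<omega>. ennreal (C4 * exp (- C5)) * indicator L \<omega> \<partial>P (Some z))"
        using const_pos by (simp add: nn_integral_cmult_indicator emeasure_eq_measure ennreal_mult)
      also have "\<dots> \<le> (\<integral>\<^sup>+ \<omega>. indicator L \<omega> * (\<integral>\<^sup>+ \<omega>'. shell R S (X (ennreal v) \<omega>') \<partial>P (X (?T \<omega>) \<omega>)) \<partial>P (Some z))"
      proof (intro nn_integral_mono)
        fix \<omega>
        show "ennreal (C4 * exp (- C5)) * indicator L \<omega> \<le>
          indicator L \<omega> * (\<integral>\<^sup>+ \<omega>'. shell R S (X (ennreal v) \<omega>') \<partial>P (X (?T \<omega>) \<omega>))"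
        proof (cases "\<omega> \<in> L")
          case L: True
          then have \<omega>: "\<omega> \<in> \<Omega>" by (simp add: L_def)
          obtain \<tau> where \<tau>: "?T \<omega> = ennreal \<tau>" "0 \<le> \<tau>" using L by (cases "?T \<omega>") (auto simp: L_def)
          have "4 * R \<le> trunc_dist x \<rho> (X (?T \<omega>) \<omega>)" using at_leave_time[OF cpt \<omega> \<tau>] \<tau> by simp
          moreover have "X (?T \<omega>) \<omega> \<notin> Some ` (- ball x (S / 2))" using L by (simp add: L_def D_def)
          ultimately have "X (?T \<omega>) \<omega> = None \<or> (\<exists>u. X (?T \<omega>) \<omega> = Some u \<and> 4 * R \<le> dist x u \<and> dist x u < S / 2)"
            by (cases "X (?T \<omega>) \<omega>") auto
          from stay_in_shell[OF R this] True L show ?thesis by (simp add: b_def)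
        qed simp
      qed
      finally show ?thesis using True by simp
    qed simp
  qed
  also have "\<dots> = (\<integral>\<^sup>+ \<omega>. indicator L \<omega> * (\<integral>\<^sup>+ v\<in>{0<..<b}. shell R S (X (?T \<omega> + ennreal v) \<omega>) \<partial>lborel) \<partial>P (Some z))"
    using Lpre by (intro strong_markov_integral(1)[symmetric] T rc bd borel_measurable_indicator) auto
  \<comment> \<open>On L the leaving time is below a, so the window of length b after it ends before
    a + b.\<close>
  also have "\<dots> \<le> (\<integral>\<^sup>+ \<omega>. (\<integral>\<^sup>+ v\<in>{0..a + b}. shell R S (X (ennreal v) \<omega>) \<partial>lborel) \<partial>P (Some z))"
  proof (rule nn_integral_mono)
    fix \<omega> assume "\<omega> \<in> space (P (Some z))"
    then have \<omega>: "\<omega> \<in> \<Omega>" by simp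
    show "indicator L \<omega> * (\<integral>\<^sup>+ v\<in>{0<..<b}. shell R S (X (?T \<omega> + ennreal v) \<omega>) \<partial>lborel) \<le>
      (\<integral>\<^sup>+ v\<in>{0..a + b}. shell R S (X (ennreal v) \<omega>) \<partial>lborel)"
    proof (cases "\<omega> \<in> L")
      case L: True
      then obtain \<tau> where \<tau>: "?T \<omega> = ennreal \<tau>" "0 \<le> \<tau>" "\<tau> < a"
        by (cases "?T \<omega>") (auto simp: L_def ennreal_less_iff)
      have [measurable]: "(\<lambda>v. shell R S (X (ennreal v) \<omega>)) \<in> borel_measurable borel"
        using measurable_Pair1[OF measurable_right_cont_path[OF rc space_F measurable_X], of \<omega>] \<omega> by (simp add: space_F)
      have "(\<integral>\<^sup>+ v\<in>{0<..<b}. shell R S (X (?T \<omega> + ennreal v) \<omega>) \<partial>lborel) =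
        (\<integral>\<^sup>+ v. shell R S (X (ennreal (\<tau> + 1 * v)) \<omega>) * indicator {\<tau><..<\<tau> + b} (\<tau> + 1 * v) \<partial>lborel)"
        using \<tau> by (intro nn_integral_cong) (auto simp: ennreal_plus[symmetric] simp del: ennreal_plus split: split_indicator)
      also have "\<dots> = (\<integral>\<^sup>+ v\<in>{\<tau><..<\<tau> + b}. shell R S (X (ennreal v) \<omega>) \<partial>lborel)"
        by (subst nn_integral_real_affine[where c=1 and t=\<tau>]) auto
      also have "\<dots> \<le> (\<integral>\<^sup>+ v\<in>{0..a + b}. shell R S (X (ennreal v) \<omega>) \<partial>lborel)"
        using \<tau> by (intro nn_integral_mono mult_left_mono) (auto split: split_indicator)
      finally show ?thesis using L by simp
    qed simp
  qed
  also have "\<dots> = (\<integral>\<^sup>+ v\<in>{0..a + b}. (\<integral>\<^sup>+ \<omega>. shell R S (X (ennreal v) \<omega>) \<partial>P (Some z)) \<partial>lborel)"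
    by (rule Fubini_path[OF rc bd]) simp
  finally show ?thesis .
qed

end

section \<open>Expected occupation over many scales\<close>

context borel_standard_process
begin

lemma measurable_path_integral:
  assumes w: "right_cont w" and u: "0 \<le> a" "a \<le> u"
  shows "(\<lambda>\<omega>. \<integral>\<^sup>+ v\<in>{a..u}. w (X (ennreal v) \<omega>) \<partial>lborel) \<in> borel_measurable (F (ennreal u))"
proof -
  have u0: "0 \<le> u" using u by simp
  have [measurable]: "(\<lambda>(v, \<omega>). w (X (ennreal (min v u)) \<omega>)) \<in> borel_measurable (borel \<Otimes>\<^sub>M F (ennreal u))"
    by (rule measurable_right_cont_path_upto[OF w space_F _ u0]) (auto intro!: measurable_F_mono[OF _ adapted] ennreal_leI)
  have eq: "(\<lambda>\<omega>. \<integral>\<^sup>+ v\<in>{a..u}. w (X (ennreal v) \<omega>) \<partial>lborel) =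
     (\<lambda>\<omega>. \<integral>\<^sup>+ v. (\<lambda>(v, \<omega>). w (X (ennreal (min v u)) \<omega>)) (v, \<omega>) * indicator {a..u} v \<partial>lborel)"
    by (intro ext nn_integral_cong) (auto simp: min_def split: split_indicator)
  show ?thesis unfolding eq by measurable
qed

lemma measurable_path_section:
  assumes w: "right_cont w" and \<omega>: "\<omega> \<in> \<Omega>"
  shows "(\<lambda>v. w (X (ennreal v) \<omega>)) \<in> borel_measurable borel"
  using measurable_Pair1[OF measurable_right_cont_path[OF w space_F measurable_X], of \<omega>] \<omega> by (simp add: space_F)

lemma path_integral_shift:
  assumes w: "right_cont w" and \<omega>: "\<omega> \<in> \<Omega>" and a: "0 \<le> a"
  shows "(\<integral>\<^sup>+ v\<in>{0..s}. w (X (ennreal a + ennreal v) \<omega>) \<partial>lborel) = (\<integral>\<^sup>+ v\<in>{a..a + s}. w (X (ennreal v) \<omega>) \<partial>lborel)"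
proof -
  note [measurable] = measurable_path_section[OF w \<omega>]
  have "(\<integral>\<^sup>+ v\<in>{0..s}. w (X (ennreal a + ennreal v) \<omega>) \<partial>lborel) =
    (\<integral>\<^sup>+ v. w (X (ennreal (a + 1 * v)) \<omega>) * indicator {a..a + s} (a + 1 * v) \<partial>lborel)"
    using a by (intro nn_integral_cong) (auto simp: ennreal_plus[symmetric] simp del: ennreal_plus split: split_indicator)
  also have "\<dots> = (\<integral>\<^sup>+ v\<in>{a..a + s}. w (X (ennreal v) \<omega>) \<partial>lborel)"
    by (subst nn_integral_real_affine[where c=1 and t=a]) auto
  finally show ?thesis .
qed

lemma measurable_expectation_section [measurable]:
  assumes w: "right_cont w" and bd: "\<And>z. w z \<le> 1"
  shows "(\<lambda>v. \<integral>\<^sup>+ \<omega>. w (X (ennreal v) \<omega>) \<partial>P y) \<in> borel_measurable borel"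
  using measurable_Pair1[OF measurable_expectation_path[OF w bd], of y] by simp

lemma expectation_le_1:
  assumes bd: "\<And>z. w z \<le> 1"
  shows "(\<integral>\<^sup>+ \<omega>. w (X t \<omega>) \<partial>P y) \<le> 1"
proof -
  have "(\<integral>\<^sup>+ \<omega>. w (X t \<omega>) \<partial>P y) \<le> (\<integral>\<^sup>+ \<omega>. 1 \<partial>P y)" by (intro nn_integral_mono bd)
  then show ?thesis using prob_space.emeasure_space_1[OF prob_P] by simp
qed

text \<open>The factors \<open>1 + 2 u\<close> dominate \<open>exp u\<close> on \<open>[0,1]\<close> and are affine in \<open>u\<close>, so that a bound on the
  conditional expectation of each block is enough.\<close>

lemma block_large_deviation:
  assumes w: "right_cont w" and bd: "\<And>z. w z \<le> 1" and S: "0 < S" and \<delta>: "0 < \<delta>"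
    and le: "\<And>z. (\<integral>\<^sup>+ v\<in>{0..S}. (\<integral>\<^sup>+ \<omega>. w (X (ennreal v) \<omega>) \<partial>P z) \<partial>lborel) \<le> ennreal (\<delta> / 4 * S)"
  shows "measure (P y) {\<omega>\<in>\<Omega>. ennreal (\<delta> * (real n * S)) \<le> (\<integral>\<^sup>+ v\<in>{0..real n * S}. w (X (ennreal v) \<omega>) \<partial>lborel)}
    \<le> exp (- (real n * \<delta> / 2))"
proof -
  interpret prob_space "P y" by (rule prob_P)
  define B where "B j \<omega> = (\<integral>\<^sup>+ v\<in>{real j * S..real j * S + S}. w (X (ennreal v) \<omega>) \<partial>lborel)" for j :: nat and \<omega>
  define Z where "Z n \<omega> = (\<Prod>j<n. 1 + ennreal (2 / S) * B j \<omega>)" for n \<omega>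
  have B_meas: "B j \<in> borel_measurable (F (ennreal (real j * S + S)))" for j
    unfolding B_def[abs_def] using S by (intro measurable_path_integral[OF w]) auto
  have B_meas' [measurable]: "B j \<in> borel_measurable (F \<infinity>)" for j
    by (rule measurable_F_mono[OF _ B_meas]) simp
  have Z_meas: "Z n \<in> borel_measurable (F (ennreal (real n * S)))" for n
  proof -
    have "B j \<in> borel_measurable (F (ennreal (real n * S)))" if "j < n" for j
    proof (rule measurable_F_mono[OF _ B_meas], rule ennreal_leI)
      have "real (Suc j) * S \<le> real n * S" using that S by (intro mult_right_mono) auto
      then show "real j * S + S \<le> real n * S" by (simp add: algebra_simps)
    qed
    then show ?thesis unfolding Z_def[abs_def] by measurable
  qed
  have Z_meas' [measurable]: "Z n \<in> borel_measurable (F \<infinity>)" for n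
    by (rule measurable_F_mono[OF _ Z_meas]) simp
  have B_le: "B j \<omega> \<le> ennreal S" for j \<omega>
  proof -
    have "B j \<omega> \<le> (\<integral>\<^sup>+ v. indicator {real j * S..real j * S + S} v \<partial>lborel)"
      unfolding B_def using bd by (intro nn_integral_mono) (auto split: split_indicator)
    then show ?thesis using S by simp
  qed
  have EZ: "(\<integral>\<^sup>+ \<omega>. Z n \<omega> \<partial>P y) \<le> ennreal ((1 + \<delta> / 2) ^ n)" for n
  proof (induction n)
    case 0
    then show ?case using emeasure_space_1 by (simp add: Z_def)
  next
    case (Suc n)
    have "(\<integral>\<^sup>+ \<omega>. Z n \<omega> * B n \<omega> \<partial>P y) = (\<integral>\<^sup>+ \<omega>. Z n \<omega> * (\<integral>\<^sup>+ v\<in>{0..S}. w (X (ennreal (real n * S) + ennreal v) \<omega>) \<partial>lborel) \<partial>P y)"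
      unfolding B_def using S by (intro nn_integral_cong) (simp add: path_integral_shift[OF w])
    also have "\<dots> = (\<integral>\<^sup>+ \<omega>. Z n \<omega> * (\<integral>\<^sup>+ v\<in>{0..S}. (\<integral>\<^sup>+ \<omega>'. w (X (ennreal v) \<omega>') \<partial>P (X (ennreal (real n * S)) \<omega>)) \<partial>lborel) \<partial>P y)"
      by (rule strong_markov_integral(2)[OF stopping_time_const w bd measurable_pre_sigma_const[OF Z_meas]]) simp
    also have "\<dots> \<le> (\<integral>\<^sup>+ \<omega>. Z n \<omega> * ennreal (\<delta> / 4 * S) \<partial>P y)"
      by (intro nn_integral_mono mult_left_mono le) simp
    also have "\<dots> = (\<integral>\<^sup>+ \<omega>. Z n \<omega> \<partial>P y) * ennreal (\<delta> / 4 * S)"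
      by (rule nn_integral_multc) simp
    finally have *: "(\<integral>\<^sup>+ \<omega>. Z n \<omega> * B n \<omega> \<partial>P y) \<le> (\<integral>\<^sup>+ \<omega>. Z n \<omega> \<partial>P y) * ennreal (\<delta> / 4 * S)" .
    have "(\<integral>\<^sup>+ \<omega>. Z (Suc n) \<omega> \<partial>P y) = (\<integral>\<^sup>+ \<omega>. Z n \<omega> + ennreal (2 / S) * (Z n \<omega> * B n \<omega>) \<partial>P y)"
      by (intro nn_integral_cong) (simp add: Z_def distrib_left distrib_right mult_ac)
    also have "\<dots> = (\<integral>\<^sup>+ \<omega>. Z n \<omega> \<partial>P y) + ennreal (2 / S) * (\<integral>\<^sup>+ \<omega>. Z n \<omega> * B n \<omega> \<partial>P y)"
      by (simp add: nn_integral_add nn_integral_cmult)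
    also have "\<dots> \<le> (\<integral>\<^sup>+ \<omega>. Z n \<omega> \<partial>P y) + ennreal (2 / S) * ((\<integral>\<^sup>+ \<omega>. Z n \<omega> \<partial>P y) * ennreal (\<delta> / 4 * S))"
      by (intro add_left_mono mult_left_mono *) simp
    also have "\<dots> = (\<integral>\<^sup>+ \<omega>. Z n \<omega> \<partial>P y) * ennreal (1 + \<delta> / 2)"
    proof -
      have "ennreal (2 / S) * ennreal (\<delta> / 4 * S) = ennreal (\<delta> / 2)"
        using S \<delta> by (simp add: ennreal_mult[symmetric])
      moreover have "ennreal (1 + \<delta> / 2) = 1 + ennreal (\<delta> / 2)" using \<delta> by simp
      ultimately show ?thesis by (simp add: distrib_left mult.left_commute del: ennreal_plus)
    qed
    also have "\<dots> \<le> ennreal ((1 + \<delta> / 2) ^ n) * ennreal (1 + \<delta> / 2)"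
      by (intro mult_right_mono Suc.IH) simp
    also have "\<dots> = ennreal ((1 + \<delta> / 2) ^ Suc n)" using \<delta> by (simp add: ennreal_mult[symmetric] mult.commute del: ennreal_plus)
    finally show ?case .
  qed
  let ?E = "{\<omega>\<in>\<Omega>. ennreal (\<delta> * (real n * S)) \<le> (\<integral>\<^sup>+ v\<in>{0..real n * S}. w (X (ennreal v) \<omega>) \<partial>lborel)}"
  have sub: "?E \<subseteq> {\<omega>\<in>space (P y). ennreal (exp (real n * \<delta>)) \<le> Z n \<omega>}"
  proof safe
    fix \<omega> assume \<omega>: "\<omega> \<in> \<Omega>" and ge: "ennreal (\<delta> * (real n * S)) \<le> (\<integral>\<^sup>+ v\<in>{0..real n * S}. w (X (ennreal v) \<omega>) \<partial>lborel)"
    note [measurable] = measurable_path_section[OF w \<omega>]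
    \<comment> \<open>The closed blocks share endpoints, so the sum dominates the integral; the
      inequality suffices here.\<close>
    have sum: "(\<integral>\<^sup>+ v\<in>{0..real k * S}. w (X (ennreal v) \<omega>) \<partial>lborel) \<le> (\<Sum>j<k. B j \<omega>)" for k
    proof (induction k)
      case 0
      have "(\<integral>\<^sup>+ v\<in>{0..0::real}. w (X (ennreal v) \<omega>) \<partial>lborel) \<le> (\<integral>\<^sup>+ v. indicator {0..0::real} v \<partial>lborel)"
        using bd by (intro nn_integral_mono) (auto split: split_indicator)
      then show ?case by simp
    next
      case (Suc k)
      have "(\<integral>\<^sup>+ v\<in>{0..real (Suc k) * S}. w (X (ennreal v) \<omega>) \<partial>lborel) \<le>
        (\<integral>\<^sup>+ v. w (X (ennreal v) \<omega>) * indicator {0..real k * S} v + w (X (ennreal v) \<omega>) * indicator {real k * S..real k * S + S} v \<partial>lborel)"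
        by (intro nn_integral_mono) (auto split: split_indicator simp: algebra_simps)
      also have "\<dots> = (\<integral>\<^sup>+ v\<in>{0..real k * S}. w (X (ennreal v) \<omega>) \<partial>lborel) + B k \<omega>"
        unfolding B_def by (rule nn_integral_add) measurable
      also have "\<dots> \<le> (\<Sum>j<k. B j \<omega>) + B k \<omega>" by (intro add_right_mono Suc.IH)
      finally show ?case by simp
    qed
    define u where "u j = enn2real (B j \<omega>) / S" for j
    have Bu: "B j \<omega> = ennreal (u j * S)" and u: "0 \<le> u j" "u j \<le> 1" for j
    proof -
      have "B j \<omega> < \<top>" using B_le[of j \<omega>] by (rule le_less_trans) simp
      then show "B j \<omega> = ennreal (u j * S)" using S by (simp add: u_def)
      show "0 \<le> u j" using S by (simp add: u_def)
      show "u j \<le> 1" using B_le[of j \<omega>] S by (simp add: u_def enn2real_leI)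
    qed
    have "ennreal (\<delta> * (real n * S)) \<le> (\<Sum>j<n. B j \<omega>)" using ge sum by (rule order_trans)
    also have "\<dots> = ennreal (\<Sum>j<n. u j * S)" unfolding Bu using u S by (subst sum_ennreal) auto
    finally have "\<delta> * (real n * S) \<le> (\<Sum>j<n. u j * S)" using u S by (subst (asm) ennreal_le_iff) (auto intro!: sum_nonneg)
    then have "(real n * \<delta>) * S \<le> (\<Sum>j<n. u j) * S" unfolding sum_distrib_right by (simp only: ac_simps)
    then have su: "real n * \<delta> \<le> (\<Sum>j<n. u j)" using S by (rule mult_right_le_imp_le)
    have "exp (u j) \<le> 1 + 2 * u j" for j
    proof -
      have "exp (u j) \<le> 1 + u j + (u j)\<^sup>2" using u by (intro exp_bound) auto
      also have "(u j)\<^sup>2 \<le> u j" using u[of j] by (simp add: power2_eq_square mult_left_le)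
      finally show ?thesis by simp
    qed
    then have "(\<Prod>j<n. exp (u j)) \<le> (\<Prod>j<n. 1 + 2 * u j)" by (intro prod_mono) auto
    moreover have "exp (real n * \<delta>) \<le> (\<Prod>j<n. exp (u j))" using su by (simp add: exp_sum[symmetric])
    ultimately have "ennreal (exp (real n * \<delta>)) \<le> ennreal (\<Prod>j<n. 1 + 2 * u j)" by (intro ennreal_leI) linarith
    also have "\<dots> = (\<Prod>j<n. ennreal (1 + 2 * u j))" using u by (intro prod_ennreal[symmetric]) (simp add: add_nonneg_nonneg)
    also have "\<dots> = Z n \<omega>" unfolding Z_def Bu
    proof (intro prod.cong refl)
      fix j
      have "ennreal (2 / S) * ennreal (u j * S) = ennreal (2 * u j)"
        using u S by (simp add: ennreal_mult[symmetric])
      then show "ennreal (1 + 2 * u j) = 1 + ennreal (2 / S) * ennreal (u j * S)" using u by simp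
    qed
    finally show "ennreal (exp (real n * \<delta>)) \<le> Z n \<omega>" .
  qed simp
  have "emeasure (P y) ?E \<le> emeasure (P y) {\<omega>\<in>space (P y). ennreal (exp (real n * \<delta>)) \<le> Z n \<omega>}"
    by (intro emeasure_mono sub) measurable
  also have "\<dots> = emeasure (P y) {\<omega>\<in>space (P y). 1 \<le> ennreal (exp (- (real n * \<delta>))) * Z n \<omega>}"
  proof -
    have "ennreal (exp (real n * \<delta>)) \<le> z \<longleftrightarrow> 1 \<le> ennreal (exp (- (real n * \<delta>))) * z" for z
    proof (cases z)
      case (real r)
      then show ?thesis by (simp add: ennreal_mult[symmetric] exp_minus field_simps flip: ennreal_1)
    qed (simp add: ennreal_mult_top)
    then show ?thesis by simp
  qed
  also have "\<dots> \<le> ennreal (exp (- (real n * \<delta>))) * (\<integral>\<^sup>+ \<omega>. Z n \<omega> * indicator (space (P y)) \<omega> \<partial>P y)"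
    by (intro nn_integral_Markov_inequality borel_measurable_times_ennreal borel_measurable_indicator sets.top) measurable
  also have "\<dots> = ennreal (exp (- (real n * \<delta>))) * (\<integral>\<^sup>+ \<omega>. Z n \<omega> \<partial>P y)"
    by (intro arg_cong2[where f="(*)"] refl nn_integral_cong) simp
  also have "\<dots> \<le> ennreal (exp (- (real n * \<delta>))) * ennreal ((1 + \<delta> / 2) ^ n)"
    by (intro mult_left_mono EZ) simp
  also have "\<dots> = ennreal (exp (- (real n * \<delta>)) * (1 + \<delta> / 2) ^ n)" using \<delta> by (simp add: ennreal_mult[symmetric])
  also have "\<dots> \<le> ennreal (exp (- (real n * \<delta> / 2)))"
  proof (rule ennreal_leI)
    \<comment> \<open>A block mean of at most (\<delta>/4) S makes each factor cost at most 1 +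
      \<delta>/2 in expectation, hence at most half of the exponent n\<delta>; the other half is the
      rate.\<close>
    have "(1 + \<delta> / 2) ^ n \<le> exp (\<delta> / 2) ^ n" using \<delta> by (intro power_mono exp_ge_add_one_self) simp
    also have "\<dots> = exp (real n * (\<delta> / 2))" by (rule exp_of_nat_mult[symmetric])
    finally have "exp (- (real n * \<delta>)) * (1 + \<delta> / 2) ^ n \<le> exp (- (real n * \<delta>)) * exp (real n * (\<delta> / 2))"
      by (intro mult_left_mono) auto
    also have "\<dots> = exp (- (real n * \<delta> / 2))" by (simp add: exp_add[symmetric])
    finally show "exp (- (real n * \<delta>)) * (1 + \<delta> / 2) ^ n \<le> exp (- (real n * \<delta> / 2))" .
  qed
  finally show ?thesis by (simp add: emeasure_eq_measure)
qed

end

section \<open>The gain per scale and its iteration\<close>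

context multiscale_process
begin

text \<open>The horizon a + b of \<open>shell_time_lower\<close> in units of \<phi>(x, R).\<close>

definition scale_time :: real where "scale_time = real N * C1 * C2 ^ 3 + 1 / (C1 * C2 ^ 2)"

text \<open>The shell time guaranteed by \<open>shell_time_lower\<close>, divided by its horizon.
  Like \<open>scale_time\<close>, it depends on the constants only and not on x or the
  scale.\<close>

definition gain :: real where "gain = C4 * exp (- C5) / (2 * C1 * C2 ^ 2 * scale_time)"

definition cut_time :: "real \<Rightarrow> 'm option \<Rightarrow> real \<Rightarrow> ennreal" where
  "cut_time R y t = (\<integral>\<^sup>+ u\<in>{0..t}. (\<integral>\<^sup>+ \<omega>. cut R (X (ennreal u) \<omega>) \<partial>P y) \<partial>lborel)"

lemma scale_time_pos: "0 < scale_time"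
  unfolding scale_time_def using const_pos by (intro add_nonneg_pos) auto

lemma gain_pos: "0 < gain"
  unfolding gain_def using const_pos scale_time_pos by simp

lemma cut_time_le: "0 \<le> t \<Longrightarrow> cut_time R y t \<le> ennreal t"
proof -
  assume t: "0 \<le> t"
  have "cut_time R y t \<le> (\<integral>\<^sup>+ u. indicator {0..t} u \<partial>lborel)"
    unfolding cut_time_def using expectation_le_1[OF cut_le_1]
    by (intro nn_integral_mono) (auto split: split_indicator)
  then show ?thesis using t by simp
qed

lemma cut_time_mono: "t \<le> t' \<Longrightarrow> cut_time R y t \<le> cut_time R y t'"
  unfolding cut_time_def by (intro nn_integral_mono mult_left_mono) (auto split: split_indicator)

text \<open>Condition on the position at time u. If the cutoff does not vanish, the position is
  within 2R and \<open>shell_time_lower\<close> applies; if the process is dead, the whole window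
  counts. The two lower bounds add up because the cutoff is 0 at the cemetery.\<close>

lemma shell_from_cut:
  assumes R: "0 < R" "16 * R < S" "2 * S \<le> \<rho>" and eq: "\<phi> x S = \<beta> * \<phi> x R" and u: "0 \<le> u"
  defines "s \<equiv> scale_time * \<phi> x R"
  shows "ennreal (gain * s) * (\<integral>\<^sup>+ \<omega>. cut R (X (ennreal u) \<omega>) \<partial>P y) + ennreal s * (\<integral>\<^sup>+ \<omega>. indicator {None} (X (ennreal u) \<omega>) \<partial>P y)
     \<le> (\<integral>\<^sup>+ v\<in>{0..s}. (\<integral>\<^sup>+ \<omega>. shell R S (X (ennreal (u + v)) \<omega>) \<partial>P y) \<partial>lborel)"
proof -
  have pR: "0 < \<phi> x R" using R by (intro phi_pos[OF x_in]) auto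
  have s: "0 < s" using scale_time_pos pR by (simp add: s_def)
  have S: "0 < S" using R by simp
  note rc = right_cont_shell[OF R(1) S] and bd = shell_le_1[OF R(1) S R(3)]
  note rcc = right_cont_cut[OF R(1)]
  note [measurable] = right_cont_measurable[OF rc] right_cont_measurable[OF rcc] right_cont_measurable[OF right_cont_dead]
  have gs: "gain * s = C4 * exp (- C5) * (\<phi> x R / (C1 * C2 ^ 2)) / 2"
    using scale_time_pos by (simp add: gain_def s_def)
  have s_eq: "s = real N * C1 * C2 ^ 3 * \<phi> x R + \<phi> x R / (C1 * C2 ^ 2)"
    by (simp add: s_def scale_time_def algebra_simps)
  define I where "I \<omega> = (\<integral>\<^sup>+ v\<in>{0..s}. shell R S (X (ennreal u + ennreal v) \<omega>) \<partial>lborel)" for \<omega>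
  have I_meas [measurable]: "I \<in> borel_measurable (P y)"
  proof -
    have "(\<lambda>\<omega>. \<integral>\<^sup>+ v\<in>{u..u + s}. shell R S (X (ennreal v) \<omega>) \<partial>lborel) \<in> borel_measurable (F \<infinity>)"
      using s u by (intro measurable_F_mono[OF _ measurable_path_integral[OF rc]]) auto
    then have "(\<lambda>\<omega>. \<integral>\<^sup>+ v\<in>{u..u + s}. shell R S (X (ennreal v) \<omega>) \<partial>lborel) \<in> borel_measurable (P y)"
      unfolding measurable_cong_sets[OF sets_P refl] .
    then show ?thesis
      by (subst measurable_cong[where g="\<lambda>\<omega>. \<integral>\<^sup>+ v\<in>{u..u + s}. shell R S (X (ennreal v) \<omega>) \<partial>lborel"])
        (simp_all add: I_def path_integral_shift[OF rc _ u])
  qed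
  have "ennreal (gain * s) * (\<integral>\<^sup>+ \<omega>. cut R (X (ennreal u) \<omega>) \<partial>P y) = (\<integral>\<^sup>+ \<omega>. cut R (X (ennreal u) \<omega>) * ennreal (gain * s) \<partial>P y)"
    by (simp add: nn_integral_multc mult.commute)
  also have "\<dots> \<le> (\<integral>\<^sup>+ \<omega>. cut R (X (ennreal u) \<omega>) *
    (\<integral>\<^sup>+ v\<in>{0..s}. (\<integral>\<^sup>+ \<omega>'. shell R S (X (ennreal v) \<omega>') \<partial>P (X (ennreal u) \<omega>)) \<partial>lborel) \<partial>P y)"
  proof (intro nn_integral_mono)
    fix \<omega>
    show "cut R (X (ennreal u) \<omega>) * ennreal (gain * s) \<le> cut R (X (ennreal u) \<omega>) *
      (\<integral>\<^sup>+ v\<in>{0..s}. (\<integral>\<^sup>+ \<omega>'. shell R S (X (ennreal v) \<omega>') \<partial>P (X (ennreal u) \<omega>)) \<partial>lborel)"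
    proof (cases "trunc_dist x \<rho> (X (ennreal u) \<omega>) < 2 * R")
      case True
      then obtain z where z: "X (ennreal u) \<omega> = Some z" "dist x z < 2 * R"
        using R by (cases "X (ennreal u) \<omega>") (auto simp: min_less_iff_disj)
      show ?thesis
        unfolding z(1) using shell_time_lower[OF R eq z(2)]
        unfolding gs[symmetric] s_eq[symmetric] by (rule mult_left_mono) simp
    next
      case False
      then show ?thesis using cut_eq_0[OF R(1)] by simp
    qed
  qed
  also have "\<dots> = (\<integral>\<^sup>+ \<omega>. cut R (X (ennreal u) \<omega>) * I \<omega> \<partial>P y)"
    unfolding I_def
    by (rule strong_markov_integral(2)[symmetric, OF stopping_time_const rc bd
      measurable_pre_sigma_const[OF measurable_compose[OF adapted right_cont_measurable[OF rcc]]]]) simp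
  finally have 1: "ennreal (gain * s) * (\<integral>\<^sup>+ \<omega>. cut R (X (ennreal u) \<omega>) \<partial>P y) \<le> (\<integral>\<^sup>+ \<omega>. cut R (X (ennreal u) \<omega>) * I \<omega> \<partial>P y)" .
  have 2: "ennreal s * (\<integral>\<^sup>+ \<omega>. indicator {None} (X (ennreal u) \<omega>) \<partial>P y) = (\<integral>\<^sup>+ \<omega>. ennreal s * indicator {None} (X (ennreal u) \<omega>) \<partial>P y)"
    by (rule nn_integral_cmult[symmetric]) measurable
  have "ennreal (gain * s) * (\<integral>\<^sup>+ \<omega>. cut R (X (ennreal u) \<omega>) \<partial>P y) + ennreal s * (\<integral>\<^sup>+ \<omega>. indicator {None} (X (ennreal u) \<omega>) \<partial>P y)
    \<le> (\<integral>\<^sup>+ \<omega>. cut R (X (ennreal u) \<omega>) * I \<omega> \<partial>P y) + (\<integral>\<^sup>+ \<omega>. ennreal s * indicator {None} (X (ennreal u) \<omega>) \<partial>P y)"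
    unfolding 2 by (rule add_right_mono[OF 1])
  also have "\<dots> = (\<integral>\<^sup>+ \<omega>. cut R (X (ennreal u) \<omega>) * I \<omega> + ennreal s * indicator {None} (X (ennreal u) \<omega>) \<partial>P y)"
    by (rule nn_integral_add[symmetric]) measurable
  also have "\<dots> \<le> (\<integral>\<^sup>+ \<omega>. 1 * I \<omega> \<partial>P y)"
  proof (intro nn_integral_mono)
    fix \<omega> assume "\<omega> \<in> space (P y)"
    then have \<omega>: "\<omega> \<in> \<Omega>" by simp
    show "cut R (X (ennreal u) \<omega>) * I \<omega> + ennreal s * indicator {None} (X (ennreal u) \<omega>) \<le> 1 * I \<omega>"
    proof (cases "X (ennreal u) \<omega> = None")
      case True
      have dead: "X (ennreal u + ennreal v) \<omega> = None" for v
        by (rule cemetery_absorbing[OF \<omega> _ True]) simp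
      have "ennreal s = (\<integral>\<^sup>+ v. indicator {0..s} v \<partial>lborel)" using s by simp
      also have "\<dots> \<le> I \<omega>"
        unfolding I_def dead by (intro nn_integral_mono) (simp add: shell_def split: split_indicator)
      finally show ?thesis using cut_None[OF R(1)] R by (simp add: True)
    next
      case False
      then show ?thesis using mult_right_mono[OF cut_le_1, of "I \<omega>" R] by simp
    qed
  qed
  also have "\<dots> = (\<integral>\<^sup>+ v\<in>{0..s}. (\<integral>\<^sup>+ \<omega>. 1 * (\<integral>\<^sup>+ \<omega>'. shell R S (X (ennreal v) \<omega>') \<partial>P (X (ennreal u) \<omega>)) \<partial>P y) \<partial>lborel)"
    unfolding I_def by (rule strong_markov_integral(1)[OF stopping_time_const rc bd]) simp_all
  also have "\<dots> = (\<integral>\<^sup>+ v\<in>{0..s}. (\<integral>\<^sup>+ \<omega>. shell R S (X (ennreal (u + v)) \<omega>) \<partial>P y) \<partial>lborel)"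
  proof (intro nn_integral_cong)
    fix v
    have "(\<integral>\<^sup>+ \<omega>. 1 * shell R S (X (ennreal u + ennreal v) \<omega>) \<partial>P y) =
      (\<integral>\<^sup>+ \<omega>. 1 * (\<integral>\<^sup>+ \<omega>'. shell R S (X (ennreal v) \<omega>') \<partial>P (X (ennreal u) \<omega>)) \<partial>P y)"
      by (rule strong_markov_fun[OF stopping_time_const]) (simp_all add: right_cont_measurable[OF rc])
    then show "(\<integral>\<^sup>+ \<omega>. 1 * (\<integral>\<^sup>+ \<omega>'. shell R S (X (ennreal v) \<omega>') \<partial>P (X (ennreal u) \<omega>)) \<partial>P y) * indicator {0..s} v =
      (\<integral>\<^sup>+ \<omega>. shell R S (X (ennreal (u + v)) \<omega>) \<partial>P y) * indicator {0..s} v"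
      using u by (auto simp: ennreal_plus[symmetric] simp del: ennreal_plus split: split_indicator)
  qed
  finally show ?thesis .
qed

text \<open>Integrate \<open>shell_from_cut\<close> over u and exchange the order: for each delay v,
  time in the shell and time near x add up to time near x at the larger scale plus dead time. The
  dead time thus appears on both sides; what remains is the gain, at the cost of one s for the
  shifted window.\<close>

lemma cut_recursion:
  assumes R: "0 < R" "16 * R < S" "2 * S \<le> \<rho>" and eq: "\<phi> x S = \<beta> * \<phi> x R" and t: "0 \<le> t"
  defines "s \<equiv> scale_time * \<phi> x R"
  shows "(1 + gain) * enn2real (cut_time R y t) \<le> enn2real (cut_time S y (t + s)) + s"
proof -
  have pR: "0 < \<phi> x R" using R by (intro phi_pos[OF x_in]) auto
  have s: "0 < s" using scale_time_pos pR by (simp add: s_def)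
  have S: "0 < S" using R by simp
  note bd = shell_le_1[OF R(1) S R(3)]
  define p where "p u = (\<integral>\<^sup>+ \<omega>. cut R (X (ennreal u) \<omega>) \<partial>P y)" for u
  define pS where "pS u = (\<integral>\<^sup>+ \<omega>. cut S (X (ennreal u) \<omega>) \<partial>P y)" for u
  define k where "k u = (\<integral>\<^sup>+ \<omega>. shell R S (X (ennreal u) \<omega>) \<partial>P y)" for u
  define D where "D u = (\<integral>\<^sup>+ \<omega>. indicator {None} (X (ennreal u) \<omega>) \<partial>P y)" for u
  have dead_le: "indicator {None} z \<le> (1::ennreal)" for z :: "'m option" by (simp split: split_indicator)
  have [measurable]: "p \<in> borel_measurable borel" "pS \<in> borel_measurable borel" "k \<in> borel_measurable borel" "D \<in> borel_measurable borel"
    unfolding p_def[abs_def] pS_def[abs_def] k_def[abs_def] D_def[abs_def]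
    by (intro measurable_expectation_section right_cont_cut right_cont_shell right_cont_dead cut_le_1 bd dead_le R S)+
  have D1: "D u \<le> 1" for u unfolding D_def by (rule expectation_le_1[OF dead_le])
  have pk: "p u + k u = pS u + D u" for u
  proof -
    note [measurable] = right_cont_measurable[OF right_cont_cut[OF R(1)]] right_cont_measurable[OF right_cont_cut[OF S]]
      right_cont_measurable[OF right_cont_shell[OF R(1) S]] right_cont_measurable[OF right_cont_dead]
    have "p u + k u = (\<integral>\<^sup>+ \<omega>. cut R (X (ennreal u) \<omega>) + shell R S (X (ennreal u) \<omega>) \<partial>P y)"
      unfolding p_def k_def by (rule nn_integral_add[symmetric]) measurable
    also have "\<dots> = (\<integral>\<^sup>+ \<omega>. cut S (X (ennreal u) \<omega>) + indicator {None} (X (ennreal u) \<omega>) \<partial>P y)"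
      using R by (intro nn_integral_cong cut_plus_shell) auto
    also have "\<dots> = pS u + D u"
      unfolding pS_def D_def by (rule nn_integral_add) measurable
    finally show ?thesis .
  qed
  have ppS: "p u \<le> pS u" for u
    unfolding p_def pS_def
  proof (intro nn_integral_mono)
    fix \<omega>
    have "trunc_dist x \<rho> (X (ennreal u) \<omega>) / S \<le> trunc_dist x \<rho> (X (ennreal u) \<omega>) / R"
      using R trunc_dist_nonneg by (intro divide_left_mono) auto
    then show "cut R (X (ennreal u) \<omega>) \<le> cut S (X (ennreal u) \<omega>)"
      unfolding cut_def by (intro ennreal_leI) (auto simp: max_def min_def)
  qed
  define A where "A = (\<integral>\<^sup>+ u\<in>{0..t}. p u \<partial>lborel)"
  define AS where "AS = (\<integral>\<^sup>+ u\<in>{0..t + s}. pS u \<partial>lborel)"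
  define E where "E = (\<integral>\<^sup>+ u\<in>{0..t}. D u \<partial>lborel)"
  have A_eq: "A = cut_time R y t" and AS_eq: "AS = cut_time S y (t + s)"
    by (simp_all add: A_def AS_def cut_time_def p_def pS_def)
  have E_le: "E \<le> ennreal t"
  proof -
    have "E \<le> (\<integral>\<^sup>+ u. indicator {0..t} u \<partial>lborel)"
      unfolding E_def using D1 by (intro nn_integral_mono) (auto split: split_indicator)
    then show ?thesis using t by simp
  qed
  \<comment> \<open>Over the shifted window {v..t + v} use p + k = pS + D; on the rest of {0..t + s}
    use p \<le> pS. Shifting the dead time costs at most v, because D \<le> 1.\<close>
  have K: "(\<integral>\<^sup>+ u\<in>{0..t}. k (u + v) \<partial>lborel) + A \<le> AS + E + ennreal s" if v: "0 \<le> v" "v \<le> s" for v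
  proof -
    have "(\<integral>\<^sup>+ u\<in>{0..t}. k (u + v) \<partial>lborel) = (\<integral>\<^sup>+ u. k (v + 1 * u) * indicator {v..t + v} (v + 1 * u) \<partial>lborel)"
      by (intro nn_integral_cong) (auto simp: add.commute split: split_indicator)
    also have "\<dots> = (\<integral>\<^sup>+ r\<in>{v..t + v}. k r \<partial>lborel)"
      by (subst nn_integral_real_affine[where c=1 and t=v]) auto
    finally have k_eq: "(\<integral>\<^sup>+ u\<in>{0..t}. k (u + v) \<partial>lborel) = (\<integral>\<^sup>+ r\<in>{v..t + v}. k r \<partial>lborel)" .
    have "(\<integral>\<^sup>+ u\<in>{0..t}. k (u + v) \<partial>lborel) + A \<le> (\<integral>\<^sup>+ r\<in>{v..t + v}. k r \<partial>lborel) + (\<integral>\<^sup>+ u\<in>{0..t + s}. p u \<partial>lborel)"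
      unfolding A_def k_eq using s by (intro add_left_mono nn_integral_mono mult_left_mono) (auto split: split_indicator)
    also have "\<dots> = (\<integral>\<^sup>+ r. k r * indicator {v..t + v} r + p r * indicator {0..t + s} r \<partial>lborel)"
      by (rule nn_integral_add[symmetric]) measurable
    also have "\<dots> \<le> (\<integral>\<^sup>+ r. pS r * indicator {0..t + s} r + D r * indicator {v..t + v} r \<partial>lborel)"
    proof (intro nn_integral_mono)
      fix r
      show "k r * indicator {v..t + v} r + p r * indicator {0..t + s} r \<le> pS r * indicator {0..t + s} r + D r * indicator {v..t + v} r"
        using pk[of r] ppS[of r] v by (auto simp: add.commute split: split_indicator)
    qed
    also have "\<dots> = AS + (\<integral>\<^sup>+ r\<in>{v..t + v}. D r \<partial>lborel)"
      unfolding AS_def by (rule nn_integral_add) measurable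
    also have "(\<integral>\<^sup>+ r\<in>{v..t + v}. D r \<partial>lborel) \<le> (\<integral>\<^sup>+ r. D r * indicator {0..t} r + indicator {t..t + v} r \<partial>lborel)"
    proof (intro nn_integral_mono)
      fix r
      show "D r * indicator {v..t + v} r \<le> D r * indicator {0..t} r + indicator {t..t + v} r"
        using v t D1[of r] by (auto split: split_indicator)
    qed
    also have "\<dots> = E + ennreal v"
      unfolding E_def using v by (subst nn_integral_add) auto
    also have "\<dots> \<le> E + ennreal s" using v by (intro add_left_mono ennreal_leI)
    finally show ?thesis by (simp add: add.assoc)
  qed
  have "(ennreal (gain * s) * A + ennreal s * E) + ennreal s * A =
    (\<integral>\<^sup>+ u\<in>{0..t}. ennreal (gain * s) * p u + ennreal s * D u \<partial>lborel) + ennreal s * A"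
    unfolding A_def E_def by (simp add: nn_integral_cmult[symmetric] nn_integral_add[symmetric] distrib_right mult.assoc)
  also have "\<dots> \<le> (\<integral>\<^sup>+ u\<in>{0..t}. (\<integral>\<^sup>+ v\<in>{0..s}. k (u + v) \<partial>lborel) \<partial>lborel) + ennreal s * A"
  proof (intro add_right_mono nn_integral_mono)
    fix u :: real
    show "(ennreal (gain * s) * p u + ennreal s * D u) * indicator {0..t} u \<le> (\<integral>\<^sup>+ v\<in>{0..s}. k (u + v) \<partial>lborel) * indicator {0..t} u"
      using shell_from_cut[OF R eq, of u y] unfolding p_def D_def k_def s_def by (auto split: split_indicator)
  qed
  also have "(\<integral>\<^sup>+ u\<in>{0..t}. (\<integral>\<^sup>+ v\<in>{0..s}. k (u + v) \<partial>lborel) \<partial>lborel) =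
    (\<integral>\<^sup>+ u. (\<integral>\<^sup>+ v. k (u + v) * indicator {0..s} v * indicator {0..t} u \<partial>lborel) \<partial>lborel)"
    by (intro nn_integral_cong) (simp add: nn_integral_multc)
  also have "\<dots> = (\<integral>\<^sup>+ v. (\<integral>\<^sup>+ u. k (u + v) * indicator {0..s} v * indicator {0..t} u \<partial>lborel) \<partial>lborel)"
    by (rule lborel_pair.Fubini') measurable
  also have "\<dots> + ennreal s * A = (\<integral>\<^sup>+ v. (\<integral>\<^sup>+ u. k (u + v) * indicator {0..s} v * indicator {0..t} u \<partial>lborel) + A * indicator {0..s} v \<partial>lborel)"
    using s by (subst nn_integral_add) (auto simp: nn_integral_cmult_indicator mult.commute)
  also have "\<dots> \<le> (\<integral>\<^sup>+ v. (AS + E + ennreal s) * indicator {0..s} v \<partial>lborel)"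
  proof (intro nn_integral_mono)
    fix v :: real
    show "(\<integral>\<^sup>+ u. k (u + v) * indicator {0..s} v * indicator {0..t} u \<partial>lborel) + A * indicator {0..s} v \<le> (AS + E + ennreal s) * indicator {0..s} v"
      using K[of v] by (auto split: split_indicator)
  qed
  also have "\<dots> = (AS + E + ennreal s) * ennreal s" using s by (simp add: nn_integral_cmult_indicator)
  finally have main: "(ennreal (gain * s) * A + ennreal s * E) + ennreal s * A \<le> (AS + E + ennreal s) * ennreal s" .
  \<comment> \<open>All occupation integrals are bounded by elapsed time. Being finite, they can be
    moved to the reals, where the dead time e cancels.\<close>
  obtain a where a: "A = ennreal a" "0 \<le> a"
    using cut_time_le[OF t, of R y] unfolding A_eq[symmetric] by (cases A) (auto simp: top_unique)
  obtain e where e: "E = ennreal e" "0 \<le> e" using E_le by (cases E) (auto simp: top_unique)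
  obtain b where b: "AS = ennreal b" "0 \<le> b"
    using cut_time_le[of "t + s" S y] s t unfolding AS_eq[symmetric] by (cases AS) (auto simp: top_unique)
  have "(gain * s * a + s * e) + s * a \<le> (b + e + s) * s"
    using main a e b s gain_pos by (simp add: ennreal_mult[symmetric] ennreal_plus[symmetric] ennreal_le_iff del: ennreal_plus)
  then have "s * ((1 + gain) * a) \<le> s * (b + s)" by (simp add: algebra_simps)
  then have "(1 + gain) * a \<le> b + s" using s by simp
  then show ?thesis using a b unfolding A_eq[symmetric] AS_eq[symmetric] by simp
qed

text \<open>Each scale lengthens the horizon by at most s and adds an error of at most s, which the
  later factors enlarge to at most (1 + gain)^j s.\<close>

lemma cut_iteration:
  assumes R: "\<And>i. i < m \<Longrightarrow> 0 < R i \<and> 16 * R i < R (Suc i) \<and> 2 * R (Suc i) \<le> \<rho> \<and> \<phi> x (R (Suc i)) = \<beta> * \<phi> x (R i)"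
    and sb: "\<And>i. i < m \<Longrightarrow> scale_time * \<phi> x (R i) \<le> s" "0 \<le> s" and t: "0 \<le> t" and "j \<le> m"
  shows "(1 + gain) ^ j * enn2real (cut_time (R 0) y t) \<le> enn2real (cut_time (R j) y (t + real j * s)) + real j * (1 + gain) ^ j * s"
  using \<open>j \<le> m\<close>
proof (induction j)
  case (Suc j)
  then have j: "j < m" by simp
  let ?A = "\<lambda>i t. enn2real (cut_time (R i) y t)"
  have t': "0 \<le> t + real j * s" using t sb by simp
  have "(1 + gain) ^ Suc j * ?A 0 t \<le> (1 + gain) * (?A j (t + real j * s) + real j * (1 + gain) ^ j * s)"
    using mult_left_mono[OF Suc.IH, of "1 + gain"] gain_pos j by (simp add: mult.assoc)
  also have "\<dots> = (1 + gain) * ?A j (t + real j * s) + real j * (1 + gain) ^ Suc j * s"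
    by (simp add: algebra_simps)
  also have "(1 + gain) * ?A j (t + real j * s) \<le> ?A (Suc j) (t + real j * s + scale_time * \<phi> x (R j)) + scale_time * \<phi> x (R j)"
    using R[OF j] by (intro cut_recursion t') auto
  also have "?A (Suc j) (t + real j * s + scale_time * \<phi> x (R j)) \<le> ?A (Suc j) (t + real (Suc j) * s)"
  proof (rule enn2real_mono)
    show "cut_time (R (Suc j)) y (t + real j * s + scale_time * \<phi> x (R j)) \<le> cut_time (R (Suc j)) y (t + real (Suc j) * s)"
      using sb(1)[OF j] by (intro cut_time_mono) (simp add: algebra_simps)
    show "cut_time (R (Suc j)) y (t + real (Suc j) * s) < \<top>"
      using t sb by (intro le_less_trans[OF cut_time_le]) auto
  qed
  also have "scale_time * \<phi> x (R j) \<le> (1 + gain) ^ Suc j * s"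
  proof -
    have "1 * s \<le> (1 + gain) ^ Suc j * s" using gain_pos sb(2) by (intro mult_right_mono one_le_power) auto
    then show ?thesis using sb(1)[OF j] by simp
  qed
  finally show ?case by (simp add: algebra_simps)
qed simp

text \<open>At the coarsest scale the occupation is bounded by the elapsed time. Dividing by the
  compounded gain leaves a small fraction, provided that K is so large that the m enlargements of
  the horizon are a small part of it.\<close>

lemma ball_occupation_expectation:
  assumes \<epsilon>: "0 < \<epsilon>" and m: "0 < m" "2 \<le> \<epsilon> * (1 + gain) ^ m"
    and r: "0 < r" "r \<le> \<rho> / 16" "\<beta> ^ m * \<phi> x r < \<phi> x (\<rho> / 16)"
  defines "K \<equiv> 4 * real m * scale_time * \<beta> ^ m / \<epsilon>"
  shows "cut_time r y (K * \<phi> x r) \<le> ennreal (\<epsilon> * (K * \<phi> x r))"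
proof -
  have pr: "0 < \<phi> x r" using r rho by (intro phi_pos[OF x_in]) auto
  have b1: "1 < \<beta>" using lam(1) one_le_power[OF C2_ge_1, of 4] by linarith
  have ex: "\<exists>R. r \<le> R \<and> R \<le> \<rho> / 16 \<and> \<phi> x R = \<beta> ^ i * \<phi> x r" if "i \<le> m" for i
  proof -
    have "\<beta> ^ i * \<phi> x r \<le> \<beta> ^ m * \<phi> x r" using that b1 pr by (intro mult_right_mono power_increasing) auto
    moreover have "1 * \<phi> x r \<le> \<beta> ^ i * \<phi> x r" using b1 pr by (intro mult_right_mono one_le_power) auto
    moreover have "continuous_on {r..\<rho> / 16} (\<phi> x)"
      using r rho by (intro continuous_on_subset[OF phi_cont]) auto
    ultimately show ?thesis
      using IVT'[of "\<phi> x" r "\<beta> ^ i * \<phi> x r" "\<rho> / 16"] r by auto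
  qed
  \<comment> \<open>R 0 has to be r itself: \<open>\<phi> x\<close> need not be strictly increasing,
    so the choice operator could return another radius with the same value.\<close>
  define R where "R i = (if i = 0 then r else SOME R. r \<le> R \<and> R \<le> \<rho> / 16 \<and> \<phi> x R = \<beta> ^ i * \<phi> x r)" for i
  have R: "r \<le> R i \<and> R i \<le> \<rho> / 16 \<and> \<phi> x (R i) = \<beta> ^ i * \<phi> x r" if "i \<le> m" for i
    using someI_ex[OF ex[OF that]] r by (auto simp: R_def)
  have step: "0 < R i \<and> 16 * R i < R (Suc i) \<and> 2 * R (Suc i) \<le> \<rho> \<and> \<phi> x (R (Suc i)) = \<beta> * \<phi> x (R i)" if "i < m" for i
  proof -
    have i: "r \<le> R i" "R i \<le> \<rho> / 16" "\<phi> x (R i) = \<beta> ^ i * \<phi> x r"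
      and Si: "r \<le> R (Suc i)" "R (Suc i) \<le> \<rho> / 16" "\<phi> x (R (Suc i)) = \<beta> ^ Suc i * \<phi> x r"
      using R[of i] R[of "Suc i"] that by auto
    have eq: "\<phi> x (R (Suc i)) = \<beta> * \<phi> x (R i)" using i Si by simp
    have pi: "0 < \<phi> x (R i)" using i r rho by (intro phi_pos[OF x_in]) auto
    have "R i \<le> R (Suc i)"
    proof (rule ccontr)
      assume "\<not> R i \<le> R (Suc i)"
      then have "\<phi> x (R (Suc i)) \<le> \<phi> x (R i)" using i Si r rho by (intro phi_mono[OF x_in]) auto
      then have "\<beta> * \<phi> x (R i) \<le> 1 * \<phi> x (R i)" using eq by simp
      then show False using b1 pi by simp
    qed
    then have "16 * R i < R (Suc i)" using i Si r rho eq by (intro scale_gap) auto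
    then show ?thesis using i Si r rho eq by auto
  qed
  define s where "s = scale_time * \<beta> ^ m * \<phi> x r"
  have s: "0 \<le> s" unfolding s_def using scale_time_pos b1 pr by simp
  have sb: "scale_time * \<phi> x (R i) \<le> s" if "i < m" for i
  proof -
    have "\<beta> ^ i * \<phi> x r \<le> \<beta> ^ m * \<phi> x r" using that b1 pr by (intro mult_right_mono power_increasing) auto
    then show ?thesis using R[of i] that scale_time_pos by (simp add: s_def mult.assoc)
  qed
  define T where "T = K * \<phi> x r"
  have T: "0 \<le> T" unfolding T_def K_def using scale_time_pos b1 pr \<epsilon> by simp
  \<comment> \<open>K is chosen for this identity. After division by (1 + gain)^m, half of the
    tolerance pays for T and a quarter for each of the two terms with m s.\<close>
  have ms: "real m * s = \<epsilon> * T / 4" unfolding s_def T_def K_def using \<epsilon> by (simp add: field_simps)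
  let ?a = "enn2real (cut_time r y T)"
  have "(1 + gain) ^ m * ?a \<le> enn2real (cut_time (R m) y (T + real m * s)) + real m * (1 + gain) ^ m * s"
    using cut_iteration[where R=R and m=m and j=m, OF step sb s T order_refl] by (simp add: R_def)
  also have "enn2real (cut_time (R m) y (T + real m * s)) \<le> T + real m * s"
    using T s by (intro enn2real_leI cut_time_le) auto
  finally have total: "(1 + gain) ^ m * ?a \<le> T + real m * s + (1 + gain) ^ m * (real m * s)" by (simp add: algebra_simps)
  have ms_le: "real m * s \<le> (1 + gain) ^ m * (real m * s)"
  proof -
    have "1 * (real m * s) \<le> (1 + gain) ^ m * (real m * s)" using gain_pos s by (intro mult_right_mono one_le_power) auto
    then show ?thesis by simp
  qed
  have T_le: "T \<le> (1 + gain) ^ m * (\<epsilon> * T / 2)"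
  proof -
    have "2 * (T / 2) \<le> (\<epsilon> * (1 + gain) ^ m) * (T / 2)" using m T by (intro mult_right_mono) auto
    then show ?thesis by (simp add: algebra_simps)
  qed
  have "(1 + gain) ^ m * ?a \<le> (1 + gain) ^ m * (\<epsilon> * T / 2) + (1 + gain) ^ m * (real m * s) + (1 + gain) ^ m * (real m * s)"
    using total ms_le T_le by linarith
  also have "\<dots> = (1 + gain) ^ m * (\<epsilon> * T)"
    unfolding ms by (simp add: field_simps)
  finally have "(1 + gain) ^ m * ?a \<le> (1 + gain) ^ m * (\<epsilon> * T)" .
  then have "?a \<le> \<epsilon> * T" using gain_pos by (subst (asm) mult_le_cancel_left_pos) auto
  moreover have "cut_time r y T = ennreal ?a"
    using le_less_trans[OF cut_time_le[OF T], of \<top> r y] by simp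
  ultimately show ?thesis unfolding T_def by (metis ennreal_leI)
qed

end

section \<open>Staying in small balls\<close>

text \<open>Decomposing the union according to the largest index that succeeds turns the conditional lower bounds into
  \<open>S \<ge> (q - S) (p n + \<dots> + p m)\<close> for \<open>S = prob (A n \<union> \<dots> \<union> A m)\<close>.\<close>

lemma (in prob_space) conditional_Borel_Cantelli:
  fixes A G :: "nat \<Rightarrow> 'a set" and p :: "nat \<Rightarrow> real"
  assumes [measurable]: "\<And>k. A k \<in> events" "\<And>k. G k \<in> events"
    and p: "\<And>k. 0 \<le> p k" "\<not> summable p" and q: "\<And>k. q \<le> prob (G k)"
    and cond: "\<And>k m. p k * prob ((space M - (\<Union>j\<in>{k<..m}. A j)) \<inter> G k) \<le> prob ((space M - (\<Union>j\<in>{k<..m}. A j)) \<inter> G k \<inter> A k)"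
  shows "q / 2 \<le> prob (\<Inter>n. \<Union>k\<in>{n..}. A k)"
proof -
  have large: "\<exists>m. 1 \<le> (\<Sum>k\<in>{n..m}. p k)" for n
  proof (rule ccontr)
    assume *: "\<not> ?thesis"
    have "(\<Sum>k<m. norm (p k)) \<le> (\<Sum>k<n. p k) + 1" for m
    proof -
      have "(\<Sum>k<m. norm (p k)) \<le> (\<Sum>k\<in>{..<n} \<union> {n..m}. p k)"
        using p(1) by (simp, intro sum_mono2) auto
      also have "\<dots> = (\<Sum>k<n. p k) + (\<Sum>k\<in>{n..m}. p k)" by (rule sum.union_disjoint) auto
      also have "\<dots> \<le> (\<Sum>k<n. p k) + 1" using * by (simp add: not_le less_imp_le)
      finally show ?thesis .
    qed
    from this[of "Suc _"] have "summable (\<lambda>k. norm (p k))"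
      by (intro bounded_imp_summable[where B="(\<Sum>k<n. p k) + 1"]) (simp_all only: lessThan_Suc_atMost norm_ge_zero)
    then show False using p(2) summable_norm_cancel by blast
  qed
  have union: "q / 2 \<le> prob (\<Union>k\<in>{n..}. A k)" for n
  proof -
    obtain m where m: "1 \<le> (\<Sum>k\<in>{n..m}. p k)" using large by blast
    define S where "S = prob (\<Union>k\<in>{n..m}. A k)"
    define E where "E k = space M - (\<Union>j\<in>{k<..m}. A j)" for k
    have E [measurable]: "E k \<in> events" for k unfolding E_def by measurable
    have "(\<Sum>k\<in>{n..m}. p k * (q - S)) \<le> (\<Sum>k\<in>{n..m}. prob (E k \<inter> A k))"
    proof (rule sum_mono)
      fix k assume k: "k \<in> {n..m}"
      have "prob (G k) \<le> prob ((E k \<inter> G k) \<union> (\<Union>j\<in>{n..m}. A j))"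
      proof (rule finite_measure_mono)
        show "G k \<subseteq> E k \<inter> G k \<union> (\<Union>j\<in>{n..m}. A j)"
          using k sets.sets_into_space[OF assms(2)[of k]] by (fastforce simp: E_def)
      qed measurable
      also have "\<dots> \<le> prob (E k \<inter> G k) + S" unfolding S_def by (rule measure_Un_le) measurable
      finally have "q - S \<le> prob (E k \<inter> G k)" using q[of k] by linarith
      then have "p k * (q - S) \<le> p k * prob (E k \<inter> G k)" using p(1) by (rule mult_left_mono)
      also have "\<dots> \<le> prob (E k \<inter> G k \<inter> A k)" unfolding E_def by (rule cond)
      also have "\<dots> \<le> prob (E k \<inter> A k)" by (rule finite_measure_mono) auto
      finally show "p k * (q - S) \<le> prob (E k \<inter> A k)" .
    qed
    also have "\<dots> = prob (\<Union>k\<in>{n..m}. E k \<inter> A k)"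
    proof (rule finite_measure_finite_Union[symmetric])
      show "disjoint_family_on (\<lambda>k. E k \<inter> A k) {n..m}"
        unfolding disjoint_family_on_def
      proof (intro ballI impI)
        fix i j assume ij: "i \<in> {n..m}" "j \<in> {n..m}" "i \<noteq> j"
        then consider "i < j" | "j < i" by linarith
        then show "E i \<inter> A i \<inter> (E j \<inter> A j) = {}"
          using ij by cases (auto simp: E_def)
      qed
    qed auto
    also have "\<dots> \<le> S" unfolding S_def by (intro finite_measure_mono) auto
    finally have "(\<Sum>k\<in>{n..m}. p k) * (q - S) \<le> S" by (simp add: sum_distrib_right)
    moreover have "q - S \<le> (\<Sum>k\<in>{n..m}. p k) * (q - S) \<or> q - S \<le> 0"
      using m mult_right_mono[of 1 "\<Sum>k\<in>{n..m}. p k" "q - S"] by (cases "0 \<le> q - S") auto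
    moreover have "0 \<le> S" by (simp add: S_def)
    ultimately have "q / 2 \<le> S" by auto
    also have "S \<le> prob (\<Union>k\<in>{n..}. A k)" unfolding S_def by (intro finite_measure_mono) auto
    finally show ?thesis .
  qed
  have "(\<lambda>n. prob (\<Union>k\<in>{n..}. A k)) \<longlonglongrightarrow> prob (\<Inter>n. \<Union>k\<in>{n..}. A k)"
  proof (rule finite_Lim_measure_decseq)
    show "decseq (\<lambda>n. \<Union>k\<in>{n..}. A k)" unfolding decseq_def by (intro allI impI UN_mono) auto
  qed auto
  then show ?thesis using union by (intro LIMSEQ_le_const) auto
qed

section \<open>Staying in a set at countably many times\<close>

context borel_standard_process
begin

lemma measurable_stay:
  assumes D: "D \<in> sets cemetery_borel" and I: "countable I" "\<And>i. i \<in> I \<Longrightarrow> t + i \<le> u" and t: "t \<le> u"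
  shows "{\<omega>\<in>\<Omega>. \<forall>i\<in>I. X (t + i) \<omega> \<in> D} \<in> sets (F u)"
proof -
  note [measurable] = D
  have "Measurable.pred (F u) (\<lambda>\<omega>. \<forall>i\<in>I. X (t + i) \<omega> \<in> D)"
  proof (rule measurable_pred_countable(1)[OF I(1)])
    fix i assume "i \<in> I"
    then have [measurable]: "X (t + i) \<in> F u \<rightarrow>\<^sub>M cemetery_borel" by (intro measurable_F_mono[OF I(2) adapted])
    show "Measurable.pred (F u) (\<lambda>\<omega>. X (t + i) \<omega> \<in> D)" by measurable
  qed
  then show ?thesis unfolding pred_def space_F .
qed

text \<open>The hypothesis, read at time 0 from z, says that the function q of
  \<open>markov_finite_dimensional\<close> is at least p on G; now integrate over the event of being
  in G at time t.\<close>

lemma markov_stay_finite: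
  assumes D: "D \<in> sets cemetery_borel" and G: "G \<in> sets cemetery_borel" and I: "finite I" "\<And>i. i \<in> I \<Longrightarrow> i < \<infinity>"
    and t: "t < \<infinity>" and L: "L \<in> sets (F t)" and p: "\<And>z. z \<in> G \<Longrightarrow> p \<le> measure (P z) {\<omega>\<in>\<Omega>. \<forall>i\<in>I. X i \<omega> \<in> D}"
  shows "p * measure (P y) {\<omega>\<in>L. X t \<omega> \<in> G} \<le> measure (P y) {\<omega>\<in>L. X t \<omega> \<in> G \<and> (\<forall>i\<in>I. X (t + i) \<omega> \<in> D)}"
proof (cases "0 \<le> p")
  case True
  interpret prob_space "P y" by (rule prob_P)
  have Lsub: "L \<subseteq> \<Omega>" using sets.sets_into_space[OF L] by (simp add: space_F)
  define L' where "L' = {\<omega>\<in>L. X t \<omega> \<in> G}"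
  have L': "L' \<in> sets (F t)"
  proof -
    have "L' = L \<inter> (X t -` G \<inter> space (F t))" using Lsub by (auto simp: L'_def space_F)
    then show ?thesis using L measurable_sets[OF adapted G] by simp
  qed
  have L'ev [measurable]: "L' \<in> events" unfolding sets_P by (rule sets_F_le[OF L'])
  have "\<exists>q\<in>borel_measurable cemetery_borel. \<forall>t<\<infinity>. \<forall>x. \<forall>L\<in>sets (F (t + 0)).
    emeasure (P x) {\<omega>\<in>L. \<forall>i\<in>I. X (t + i) \<omega> \<in> D} = (\<integral>\<^sup>+ \<omega>. indicator L \<omega> * q (X (t + 0) \<omega>) \<partial>P x)"
    by (rule markov_finite_dimensional[OF D I(1)]) (use I(2) in auto)
  then obtain q where q [measurable]: "q \<in> borel_measurable cemetery_borel"
    and q_eq: "\<And>t x L. t < \<infinity> \<Longrightarrow> L \<in> sets (F t) \<Longrightarrow>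
      emeasure (P x) {\<omega>\<in>L. \<forall>i\<in>I. X (t + i) \<omega> \<in> D} = (\<integral>\<^sup>+ \<omega>. indicator L \<omega> * q (X t \<omega>) \<partial>P x)"
    by (simp only: add_0_right) blast
  have qz: "ennreal p \<le> q z" if "z \<in> G" for z
  proof -
    interpret Pz: prob_space "P z" by (rule prob_P)
    have top: "\<Omega> \<in> sets (F 0)" using sets.top[of "F 0"] by (simp add: space_F)
    have "ennreal p \<le> emeasure (P z) {\<omega>\<in>\<Omega>. \<forall>i\<in>I. X i \<omega> \<in> D}"
      using p[OF that] by (simp add: Pz.emeasure_eq_measure ennreal_leI)
    also have "\<dots> = (\<integral>\<^sup>+ \<omega>. indicator \<Omega> \<omega> * q (X 0 \<omega>) \<partial>P z)"
      using q_eq[OF _ top, of z] by simp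
    also have "\<dots> = (\<integral>\<^sup>+ \<omega>. q z \<partial>P z)"
      by (rule nn_integral_cong_AE) (use normal[of z] AE_space in \<open>eventually_elim, simp\<close>)
    also have "\<dots> = q z" using Pz.emeasure_space_1 by simp
    finally show ?thesis .
  qed
  have "ennreal (p * prob L') = (\<integral>\<^sup>+ \<omega>. ennreal p * indicator L' \<omega> \<partial>P y)"
    using True by (simp add: nn_integral_cmult_indicator emeasure_eq_measure ennreal_mult)
  also have "\<dots> \<le> (\<integral>\<^sup>+ \<omega>. indicator L' \<omega> * q (X t \<omega>) \<partial>P y)"
    using qz by (intro nn_integral_mono) (auto simp: L'_def split: split_indicator)
  also have "\<dots> = emeasure (P y) {\<omega>\<in>L'. \<forall>i\<in>I. X (t + i) \<omega> \<in> D}"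
    by (rule q_eq[OF t L', symmetric])
  also have "{\<omega>\<in>L'. \<forall>i\<in>I. X (t + i) \<omega> \<in> D} = {\<omega>\<in>L. X t \<omega> \<in> G \<and> (\<forall>i\<in>I. X (t + i) \<omega> \<in> D)}"
    by (auto simp: L'_def)
  finally show ?thesis by (simp add: emeasure_eq_measure L'_def)
next
  case False
  then have "p * measure (P y) {\<omega>\<in>L. X t \<omega> \<in> G} \<le> 0" by (simp add: mult_nonpos_nonneg)
  also have "0 \<le> measure (P y) {\<omega>\<in>L. X t \<omega> \<in> G \<and> (\<forall>i\<in>I. X (t + i) \<omega> \<in> D)}" by simp
  finally show ?thesis .
qed

text \<open>The countable family of constraints is a decreasing limit of finite ones, each of which
  is implied by the full constraint under the starting law.\<close>

lemma markov_stay: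
  assumes D: "D \<in> sets cemetery_borel" and G: "G \<in> sets cemetery_borel" and I: "countable I" "\<And>i. i \<in> I \<Longrightarrow> i < \<infinity>"
    and t: "t < \<infinity>" and L: "L \<in> sets (F t)" and p: "\<And>z. z \<in> G \<Longrightarrow> p \<le> measure (P z) {\<omega>\<in>\<Omega>. \<forall>i\<in>I. X i \<omega> \<in> D}"
  shows "p * measure (P y) {\<omega>\<in>L. X t \<omega> \<in> G} \<le> measure (P y) {\<omega>\<in>L. X t \<omega> \<in> G \<and> (\<forall>i\<in>I. X (t + i) \<omega> \<in> D)}"
proof (cases "I = {}")
  case True
  then show ?thesis using markov_stay_finite[OF D G _ _ t L, of "{}" p y] p by simp
next
  case False
  interpret prob_space "P y" by (rule prob_P)
  obtain f :: "nat \<Rightarrow> ennreal" where f: "I = range f"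
    using uncountable_def[of I] I(1) False by auto
  define B where "B n = {\<omega>\<in>L. X t \<omega> \<in> G \<and> (\<forall>i\<in>f ` {..<n}. X (t + i) \<omega> \<in> D)}" for n
  have Lsub: "L \<subseteq> \<Omega>" using sets.sets_into_space[OF L] by (simp add: space_F)
  have stay_ev: "{\<omega>\<in>\<Omega>. \<forall>i\<in>J. X (s + i) \<omega> \<in> D} \<in> sets (F \<infinity>)" if "countable J" for J s
    by (rule measurable_stay[OF D that]) simp_all
  have B: "B n \<in> events" for n
  proof -
    have "B n = L \<inter> (X t -` G \<inter> space (F \<infinity>)) \<inter> {\<omega>\<in>\<Omega>. \<forall>i\<in>f ` {..<n}. X (t + i) \<omega> \<in> D}"
      using Lsub by (auto simp: B_def space_F)
    moreover have "\<dots> \<in> sets (F \<infinity>)"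
      by (intro sets.Int sets_F_le[OF L] measurable_sets[OF measurable_X G] stay_ev) simp
    ultimately show ?thesis unfolding sets_P by simp
  qed
  have "(\<lambda>n. prob (B n)) \<longlonglongrightarrow> prob (\<Inter>n. B n)"
    using B by (intro finite_Lim_measure_decseq) (auto simp: decseq_def B_def)
  moreover have "p * prob {\<omega>\<in>L. X t \<omega> \<in> G} \<le> prob (B n)" for n
    unfolding B_def
  proof (rule markov_stay_finite[OF D G _ _ t L])
    fix z assume "z \<in> G"
    interpret Pz: prob_space "P z" by (rule prob_P)
    have "p \<le> Pz.prob {\<omega>\<in>\<Omega>. \<forall>i\<in>I. X i \<omega> \<in> D}" by (rule p[OF \<open>z \<in> G\<close>])
    also have "\<dots> \<le> Pz.prob {\<omega>\<in>\<Omega>. \<forall>i\<in>f ` {..<n}. X i \<omega> \<in> D}"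
      using stay_ev[of "f ` {..<n}" 0] f unfolding sets_P[of z, symmetric] by (intro Pz.finite_measure_mono) auto
    finally show "p \<le> Pz.prob {\<omega>\<in>\<Omega>. \<forall>i\<in>f ` {..<n}. X i \<omega> \<in> D}" .
  qed (use I(2) f in auto)
  moreover have "(\<Inter>n. B n) = {\<omega>\<in>L. X t \<omega> \<in> G \<and> (\<forall>i\<in>I. X (t + i) \<omega> \<in> D)}"
  proof (rule set_eqI)
    fix \<omega>
    show "\<omega> \<in> (\<Inter>n. B n) \<longleftrightarrow> \<omega> \<in> {\<omega>\<in>L. X t \<omega> \<in> G \<and> (\<forall>i\<in>I. X (t + i) \<omega> \<in> D)}"
    proof
      assume *: "\<omega> \<in> (\<Inter>n. B n)"
      have "X (t + f j) \<omega> \<in> D" for j using INT_D[OF *, of "Suc j"] by (auto simp: B_def)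
      then show "\<omega> \<in> {\<omega>\<in>L. X t \<omega> \<in> G \<and> (\<forall>i\<in>I. X (t + i) \<omega> \<in> D)}"
        using INT_D[OF *, of 0] by (auto simp: B_def f)
    qed (auto simp: B_def f)
  qed
  ultimately show ?thesis by (simp add: LIMSEQ_le_const)
qed

text \<open>Right-continuity passes from rational times to all times, but a strict bound becomes a
  weak one. Later the radius r/2 is therefore used at rational times to stay inside the open ball of
  radius r.\<close>

lemma stay_imp_close:
  assumes cpt: "compact (cball x \<rho>)" and \<omega>: "\<omega> \<in> \<Omega>" and s: "0 \<le> s" and a: "a \<le> \<rho>"
    and stay: "\<And>q::rat. 0 < q \<Longrightarrow> real_of_rat q < t \<Longrightarrow> X (ennreal s + ennreal (real_of_rat q)) \<omega> \<in> Some ` ball x a"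
    and v: "s \<le> v" "v < s + t"
  shows "trunc_dist x \<rho> (X (ennreal v) \<omega>) \<le> a"
proof (rule ccontr)
  assume "\<not> ?thesis"
  then have "\<forall>\<^sub>F u in at_right v. a < trunc_dist x \<rho> (X (ennreal u) \<omega>)"
    using s v by (intro order_tendstoD(1)[OF tendsto_trunc_dist_X[OF cpt \<omega>]]) auto
  then obtain b where b: "v < b" "\<And>u. v < u \<Longrightarrow> u < b \<Longrightarrow> a < trunc_dist x \<rho> (X (ennreal u) \<omega>)"
    by (auto simp: eventually_at_right_field)
  have "v - s < min (b - s) t" using b v by simp
  then obtain q :: rat where q: "v - s < real_of_rat q" "real_of_rat q < min (b - s) t"
    using of_rat_dense by blast
  have q0: "0 < real_of_rat q" using q v by linarith
  then have "0 < q" by simp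
  then have "X (ennreal s + ennreal (real_of_rat q)) \<omega> \<in> Some ` ball x a" using q by (intro stay) auto
  moreover have "ennreal s + ennreal (real_of_rat q) = ennreal (s + real_of_rat q)"
    using s q0 by (intro ennreal_plus[symmetric]) auto
  moreover have "a < trunc_dist x \<rho> (X (ennreal (s + real_of_rat q)) \<omega>)" using q by (intro b(2)) auto
  ultimately show False by auto
qed

end

section \<open>Long stays in shrinking balls\<close>

context scaled_process
begin

lemma eventually_small_phi: "0 < \<delta> \<Longrightarrow> \<forall>\<^sub>F r in at_right 0. 0 < r \<and> r < a \<and> 0 < \<phi> x r \<and> \<phi> x r < \<delta>" if "0 < a"
proof -
  assume "0 < \<delta>"
  have "\<forall>\<^sub>F r in at_right 0. \<phi> x r < \<delta>" by (rule order_tendstoD(2)[OF phi_lim \<open>0 < \<delta>\<close>])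
  moreover have "\<forall>\<^sub>F r in at_right 0. 0 < r \<and> r < min a \<rho>" using that rho unfolding eventually_at_right_field by (intro exI[of _ "min a \<rho>"]) auto
  ultimately show ?thesis by eventually_elim (auto intro!: phi_pos[OF x_in])
qed

lemma phi_attains:
  assumes "0 < v" "v \<le> \<phi> x a" "0 < a" "a \<le> \<rho>"
  shows "\<exists>r. 0 < r \<and> r \<le> a \<and> \<phi> x r = v"
proof -
  have "\<forall>\<^sub>F r in at_right 0. 0 < r \<and> r < a \<and> 0 < \<phi> x r \<and> \<phi> x r < v"
    by (rule eventually_small_phi[OF assms(3,1)])
  then obtain b where b: "0 < b" "\<And>r. 0 < r \<Longrightarrow> r < b \<Longrightarrow> r < a \<and> \<phi> x r < v"
    by (auto simp: eventually_at_right_field)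
  define c where "c = b / 2"
  have c: "0 < c" "c < a" "\<phi> x c < v" using b(1) b(2)[of c] by (auto simp: c_def)
  have "continuous_on {c..a} (\<phi> x)" using c assms by (intro continuous_on_subset[OF phi_cont]) auto
  then obtain r where "c \<le> r" "r \<le> a" "\<phi> x r = v"
    using IVT'[of "\<phi> x" c v a] c assms by auto
  then show ?thesis using c by (intro exI[of _ r]) auto
qed

text \<open>The ball of radius r/4 around z lies in the ball of radius r/2 around x, so (SP) at z
  applies after one change of centre and two doublings. Only rational times are recorded, so that
  \<open>markov_stay\<close> can use the bound.\<close>

lemma stay_rational_probability:
  assumes z: "z \<in> ball x (r / 4)" and r: "0 < r" "r \<le> \<rho>" and n: "1 \<le> n" "t < real n * \<phi> x r / (C1 * C2 ^ 2)"
  shows "C4 * exp (- C5 * real n) \<le> measure (P (Some z))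
    {\<omega>\<in>\<Omega>. \<forall>i\<in>(\<lambda>q. ennreal (real_of_rat q)) ` {q. 0 < q \<and> real_of_rat q < t}. X i \<omega> \<in> Some ` ball x (r / 2)}"
proof -
  interpret prob_space "P (Some z)" by (rule prob_P)
  have zin: "z \<in> cball x \<rho>" using z r by simp
  have "\<phi> x r \<le> C2 ^ 2 * \<phi> x (r / 4)" using doubling_pow[OF x_in, of "r / 4" 2] r by simp
  also have "\<dots> \<le> C2 ^ 2 * (C1 * \<phi> z (r / 4))"
    using CE[OF x_in, of "r / 4" z] z r by (intro mult_left_mono) auto
  finally have "\<phi> x r / (C1 * C2 ^ 2) \<le> \<phi> z (r / 4)" using const_pos by (simp add: field_simps)
  then have "real n * (\<phi> x r / (C1 * C2 ^ 2)) \<le> real n * \<phi> z (r / 4)" by (intro mult_left_mono) auto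
  then have t: "t < real n * \<phi> z (r / 4)" using n by simp
  have sub: "ball z (r / 4) \<subseteq> ball x (r / 2)"
  proof
    fix v assume "v \<in> ball z (r / 4)"
    then show "v \<in> ball x (r / 2)" using dist_triangle[of x v z] z by simp
  qed
  have D: "Some ` ball x (r / 2) \<in> sets cemetery_borel" by (rule sets_Some_image) simp
  have "C4 * exp (- C5 * real n) \<le> prob {\<omega>\<in>\<Omega>. ennreal (real n * \<phi> z (r / 4)) \<le> exit_time X (ball z (r / 4)) \<omega>}"
    using r n by (intro SP_lower[OF zin]) auto
  also have "\<dots> \<le> prob {\<omega>\<in>\<Omega>. \<forall>i\<in>(\<lambda>q. ennreal (real_of_rat q)) ` {q. 0 < q \<and> real_of_rat q < t}. X i \<omega> \<in> Some ` ball x (r / 2)}"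
  proof (rule finite_measure_mono)
    show "{\<omega>\<in>\<Omega>. ennreal (real n * \<phi> z (r / 4)) \<le> exit_time X (ball z (r / 4)) \<omega>} \<subseteq>
      {\<omega>\<in>\<Omega>. \<forall>i\<in>(\<lambda>q. ennreal (real_of_rat q)) ` {q. 0 < q \<and> real_of_rat q < t}. X i \<omega> \<in> Some ` ball x (r / 2)}"
    proof safe
      fix \<omega> and q :: rat assume \<omega>: "\<omega> \<in> \<Omega>" and ex: "ennreal (real n * \<phi> z (r / 4)) \<le> exit_time X (ball z (r / 4)) \<omega>"
        and q: "0 < q" "real_of_rat q < t"
      have "0 < real_of_rat q" using q by simp
      then have "ennreal (real_of_rat q) < ennreal (real n * \<phi> z (r / 4))" using q t by (intro ennreal_lessI) linarith+
      then have "X (ennreal (real_of_rat q)) \<omega> \<in> Some ` ball z (r / 4)"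
        using ex q by (intro before_exit_time) auto
      then show "X (ennreal (real_of_rat q)) \<omega> \<in> Some ` ball x (r / 2)" using sub by auto
    qed
    have "{\<omega>\<in>\<Omega>. \<forall>i\<in>(\<lambda>q. ennreal (real_of_rat q)) ` {q. 0 < q \<and> real_of_rat q < t}. X (0 + i) \<omega> \<in> Some ` ball x (r / 2)} \<in> sets (F \<infinity>)"
      by (rule measurable_stay[OF D]) (rule countable_image countableI_type, simp_all)
    then show "{\<omega>\<in>\<Omega>. \<forall>i\<in>(\<lambda>q. ennreal (real_of_rat q)) ` {q. 0 < q \<and> real_of_rat q < t}. X i \<omega> \<in> Some ` ball x (r / 2)} \<in> events"
      unfolding sets_P add_0 .
  qed
  finally show ?thesis .
qed

text \<open>With \<phi>(x, r k) = exp(-k^2) the double logarithm is 2 ln k, and a stay through the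
  whole window has conditional probability of order at least k to the power -2 \<kappa> C1 C2^2 C5.
  The bound on \<kappa> makes this at least of order 1/k, so the series diverges.\<close>

lemma Limsup_occupation_ge_1:
  assumes \<kappa>: "0 < \<kappa>" "2 * \<kappa> * C1 * C2 ^ 2 * C5 \<le> 1"
  defines "t \<equiv> \<lambda>r. \<kappa> * \<phi> x r * ln \<bar>ln (\<phi> x r)\<bar>"
  shows "\<exists>E\<in>sets (F \<infinity>). 0 < measure (P (Some x)) E \<and>
    (\<forall>\<omega>\<in>E. 1 \<le> Limsup (at_right 0) (\<lambda>r. occupation_time X (ball x r) (ennreal (t r)) \<omega> / ennreal (t r)))"
proof -
  interpret prob_space "P (Some x)" by (rule prob_P)
  define v where "v k = exp (- (real k)\<^sup>2)" for k
  have pr: "0 < \<phi> x \<rho>" by (rule phi_pos[OF x_in rho order_refl])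
  obtain k0 :: nat where k0: "3 \<le> k0" "1 / \<phi> x \<rho> \<le> real k0" "(1 / 2 + 2 * \<kappa>) * (2 * C2 ^ 2) \<le> real k0"
  proof -
    obtain a b where "1 / \<phi> x \<rho> \<le> real a" "(1 / 2 + 2 * \<kappa>) * (2 * C2 ^ 2) \<le> real b"
      using real_arch_simple by metis
    then show ?thesis by (intro that[of "max 3 (max a b)"]) auto
  qed
  have v_pos: "0 < v k" for k by (simp add: v_def)
  have exp_k: "real k + 1 \<le> exp (real k)" for k by (rule order_trans[OF _ exp_ge_add_one_self]) simp
  have v_le: "v k \<le> \<phi> x \<rho>" if "k0 \<le> k" for k
  proof -
    have "1 / \<phi> x \<rho> \<le> real k" using k0(2) that by linarith
    also have "\<dots> \<le> exp (real k)" using exp_k[of k] by linarith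
    also have "\<dots> \<le> exp ((real k)\<^sup>2)"
      using k0(1) that by (simp add: power2_eq_square)
    finally have "1 \<le> \<phi> x \<rho> * exp ((real k)\<^sup>2)" using pr by (simp add: field_simps)
    then show ?thesis by (simp add: v_def exp_minus field_simps)
  qed
  have "\<exists>r. 0 < r \<and> r \<le> \<rho> \<and> \<phi> x r = v k" if "k0 \<le> k" for k
    using phi_attains[OF v_pos v_le[OF that] rho] by simp
  then obtain r where r: "\<And>k. k0 \<le> k \<Longrightarrow> 0 < r k \<and> r k \<le> \<rho> \<and> \<phi> x (r k) = v k" by metis
  \<comment> \<open>The starting time of the k-th attempt. The factor 1/2 keeps it strictly below
    \<open>\<phi> x (r k / 4)\<close>, so (SP) with n = 1 gives a fixed chance to be within r k / 4
    of x; it is of order v k and negligible against T k.\<close>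
  define s where "s k = \<phi> x (r k / 4) / 2" for k
  define T where "T k = 2 * \<kappa> * v k * ln (real k)" for k
  have t_r: "t (r k) = T k" if "k0 \<le> k" for k
  proof -
    have "1 < real k" using k0 that by linarith
    then have "ln \<bar>ln (v k)\<bar> = 2 * ln (real k)" by (simp add: v_def ln_realpow)
    then show ?thesis using r[OF that] by (simp add: t_def T_def)
  qed
  have s_bounds: "0 < s k" "v k / (2 * C2 ^ 2) \<le> s k" "s k \<le> v k / 2" if "k0 \<le> k" for k
  proof -
    note rk = r[OF that]
    show "0 < s k" unfolding s_def using rk phi_pos[OF x_in, of "r k / 4"] by simp
    have "\<phi> x (2 ^ 2 * (r k / 4)) \<le> C2 ^ 2 * \<phi> x (r k / 4)" using rk by (intro doubling_pow[OF x_in]) auto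
    then show "v k / (2 * C2 ^ 2) \<le> s k" using rk const_pos by (simp add: s_def field_simps)
    show "s k \<le> v k / 2" unfolding s_def using rk phi_mono[OF x_in, of "r k / 4" "r k"] by simp
  qed
  have T_pos: "0 < T k" if "k0 \<le> k" for k
    unfolding T_def using \<kappa> v_pos[of k] k0 that by simp
  \<comment> \<open>The attempt at Suc k is over before the one at k begins. Since v (Suc k) / v k =
    exp(-2k - 1), one factor exp(k) absorbs the logarithm and another the constants.\<close>
  have chain1: "s (Suc k) + T (Suc k) \<le> s k" if "k0 \<le> k" for k
  proof -
    have "v (Suc k) * exp (real k) * (real k + 1) \<le> v (Suc k) * exp (real k) * exp (real k)"
      using exp_k[of k] v_pos[of "Suc k"] by (intro mult_left_mono) auto
    also have "\<dots> \<le> v k"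
      by (simp add: v_def exp_add[symmetric] power2_eq_square algebra_simps)
    finally have 1: "v (Suc k) * exp (real k) * (real k + 1) \<le> v k" .
    have "real k \<le> exp (real k)" using exp_k[of k] by linarith
    then have 2: "(1 / 2 + 2 * \<kappa>) * (2 * C2 ^ 2) \<le> exp (real k)" using k0(3) that by linarith
    have "ln (real (Suc k)) \<le> real k + 1" using ln_le_minus_one[of "real (Suc k)"] by simp
    then have "2 * \<kappa> * ln (real (Suc k)) \<le> 2 * \<kappa> * (real k + 1)" using \<kappa> by simp
    moreover have "1 / 2 \<le> (1 / 2) * (real k + 1)" by simp
    ultimately have 3: "1 / 2 + 2 * \<kappa> * ln (real (Suc k)) \<le> (1 / 2 + 2 * \<kappa>) * (real k + 1)"
      by (simp only: distrib_right)
    have "s (Suc k) + T (Suc k) \<le> v (Suc k) * (1 / 2 + 2 * \<kappa> * ln (real (Suc k)))"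
      using s_bounds(3)[of "Suc k"] that by (simp add: T_def algebra_simps)
    also have "\<dots> \<le> v (Suc k) * ((1 / 2 + 2 * \<kappa>) * (real k + 1))"
      using v_pos[of "Suc k"] by (intro mult_left_mono 3) simp
    finally have "(s (Suc k) + T (Suc k)) * (2 * C2 ^ 2) \<le> v (Suc k) * ((1 / 2 + 2 * \<kappa>) * (real k + 1)) * (2 * C2 ^ 2)"
      by (intro mult_right_mono) auto
    also have "\<dots> = v (Suc k) * (real k + 1) * ((1 / 2 + 2 * \<kappa>) * (2 * C2 ^ 2))" by (simp only: ac_simps)
    also have "\<dots> \<le> v (Suc k) * (real k + 1) * exp (real k)"
      using v_pos[of "Suc k"] by (intro mult_left_mono 2) simp
    also have "\<dots> \<le> v k" using 1 by (simp only: ac_simps)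
    finally have "s (Suc k) + T (Suc k) \<le> v k / (2 * C2 ^ 2)" using const_pos by (simp add: field_simps)
    then show ?thesis using s_bounds(2)[OF that] by linarith
  qed
  have s_dec: "s (k + d) \<le> s k" if "k0 \<le> k" for k d
  proof (induction d)
    case (Suc d)
    have "s (Suc (k + d)) \<le> s (k + d)" using chain1[of "k + d"] T_pos[of "Suc (k + d)"] that by simp
    then show ?case using Suc.IH by simp
  qed simp
  have chain: "s j + T j \<le> s k" if "k0 \<le> k" "k < j" for k j
  proof -
    obtain d where d: "j = Suc (k + d)" using \<open>k < j\<close> less_iff_Suc_add by auto
    show ?thesis using chain1[of "k + d"] s_dec[OF that(1), of d] that by (simp add: d)
  qed
  \<comment> \<open>The least natural number strictly above the real bound:
    \<open>stay_rational_probability\<close> needs a strict inequality, and the excess of at most 1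
    costs the factor exp(-C5).\<close>
  define n where "n k = nat \<lfloor>2 * \<kappa> * C1 * C2 ^ 2 * ln (real k)\<rfloor> + 1" for k
  have n: "1 \<le> n k" "2 * \<kappa> * C1 * C2 ^ 2 * ln (real k) < real (n k)"
    "real (n k) \<le> 2 * \<kappa> * C1 * C2 ^ 2 * ln (real k) + 1" if "k0 \<le> k" for k
  proof -
    have "0 \<le> 2 * \<kappa> * C1 * C2 ^ 2 * ln (real k)" using \<kappa> const_pos k0 that by simp
    then show "1 \<le> n k" "2 * \<kappa> * C1 * C2 ^ 2 * ln (real k) < real (n k)"
      "real (n k) \<le> 2 * \<kappa> * C1 * C2 ^ 2 * ln (real k) + 1"
      unfolding n_def by linarith+
  qed
  have T_n: "T k < real (n k) * \<phi> x (r k) / (C1 * C2 ^ 2)" if "k0 \<le> k" for k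
  proof -
    have "(2 * \<kappa> * C1 * C2 ^ 2 * ln (real k)) * v k < real (n k) * v k"
      using n(2)[OF that] v_pos[of k] by (rule mult_strict_right_mono)
    then show ?thesis using r[OF that] const_pos by (simp add: T_def field_simps)
  qed
  define p where "p j = C4 * exp (- C5 * real (n (j + k0)))" for j
  have p_ge: "C4 * exp (- C5) * (1 / real (j + k0)) \<le> p j" for j
  proof -
    define k where "k = j + k0"
    have k: "k0 \<le> k" "1 < real k" using k0 by (auto simp: k_def)
    have "C5 * real (n k) \<le> C5 * (2 * \<kappa> * C1 * C2 ^ 2 * ln (real k) + 1)"
      using n(3)[OF k(1)] const_pos by (intro mult_left_mono) auto
    also have "\<dots> = (2 * \<kappa> * C1 * C2 ^ 2 * C5) * ln (real k) + C5" by (simp add: algebra_simps)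
    also have "\<dots> \<le> 1 * ln (real k) + C5" using \<kappa>(2) k by (intro add_right_mono mult_right_mono) auto
    finally have "exp (- C5 + - ln (real k)) \<le> exp (- C5 * real (n k))" by simp
    moreover have "exp (- C5 + - ln (real k)) = exp (- C5) * (1 / real k)"
      unfolding exp_add using k by (simp add: exp_minus inverse_eq_divide)
    ultimately have "exp (- C5) * (1 / real k) \<le> exp (- C5 * real (n k))" by (simp only:)
    then have "C4 * (exp (- C5) * (1 / real k)) \<le> C4 * exp (- C5 * real (n k))"
      using const_pos by (intro mult_left_mono) auto
    then show ?thesis unfolding p_def k_def[symmetric] by (simp only: mult.assoc)
  qed
  have p_nonneg: "0 \<le> p j" for j using const_pos by (simp add: p_def)
  have not_summable: "\<not> summable p"
  proof
    assume "summable p"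
    then have "summable (\<lambda>j. C4 * exp (- C5) * (1 / real (j + k0)))"
      by (rule summable_comparison_test'[where N=0]) (use p_ge const_pos in simp)
    then have "summable (\<lambda>j. 1 / real (j + k0))"
      unfolding summable_cmult_iff using const_pos by simp
    then have "summable (\<lambda>j. 1 / real j)" by (simp only: summable_iff_shift[of "\<lambda>j. 1 / real j" k0])
    then show False using not_summable_harmonic[where 'a=real] by (simp add: inverse_eq_divide)
  qed
  define I where "I j = (\<lambda>q. ennreal (real_of_rat q)) ` {q. 0 < q \<and> real_of_rat q < T (j + k0)}" for j
  have I: "countable (I j)" "\<And>i. i \<in> I j \<Longrightarrow> i < \<infinity>" "\<And>i. i \<in> I j \<Longrightarrow> i \<le> ennreal (T (j + k0))" for j
    unfolding I_def by (rule countable_image countableI_type, auto intro!: ennreal_leI)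
  define D where "D j = (Some ` ball x (r (j + k0) / 2) :: 'm option set)" for j
  define B where "B j = (Some ` ball x (r (j + k0) / 4) :: 'm option set)" for j
  have D: "D j \<in> sets cemetery_borel" and B: "B j \<in> sets cemetery_borel" for j
    unfolding D_def B_def by (simp_all add: sets_Some_image)
  define A where "A j = {\<omega>\<in>\<Omega>. \<forall>i\<in>I j. X (ennreal (s (j + k0)) + i) \<omega> \<in> D j}" for j
  define G where "G j = {\<omega>\<in>\<Omega>. X (ennreal (s (j + k0))) \<omega> \<in> B j}" for j
  have A_F: "A j \<in> sets (F u)" if "ennreal (s (j + k0) + T (j + k0)) \<le> u" for j u
  proof -
    have sT: "ennreal (s (j + k0)) + ennreal (T (j + k0)) \<le> u"
      using that s_bounds(1)[of "j + k0"] T_pos[of "j + k0"] by simp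
    show ?thesis
      unfolding A_def
    proof (rule measurable_stay[OF D I(1)])
      show "ennreal (s (j + k0)) + i \<le> u" if "i \<in> I j" for i
        using order_trans[OF add_left_mono[OF I(3)[OF that]] sT] .
      show "ennreal (s (j + k0)) \<le> u"
        by (rule order_trans[OF _ sT]) simp
    qed
  qed
  have A_ev: "A j \<in> events" for j unfolding sets_P by (rule A_F) simp
  have G_ev: "G j \<in> events" for j
  proof -
    have "X (ennreal (s (j + k0))) -` B j \<inter> space (F \<infinity>) \<in> sets (F \<infinity>)" by (rule measurable_sets[OF measurable_X B])
    moreover have "X (ennreal (s (j + k0))) -` B j \<inter> space (F \<infinity>) = G j" by (auto simp: G_def space_F)
    ultimately show ?thesis unfolding sets_P by simp
  qed
  have "C4 * exp (- C5) / 2 \<le> prob (\<Inter>n. \<Union>k\<in>{n..}. A k)"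
  proof (rule conditional_Borel_Cantelli[OF A_ev G_ev p_nonneg not_summable])
    fix j
    have "k0 \<le> j + k0" by simp
    note rk = r[OF this] and sk = s_bounds[OF this]
    have "C4 * exp (- C5 * real 1) \<le> prob {\<omega>\<in>\<Omega>. X (ennreal (s (j + k0))) \<omega> \<in> Some ` ball x (r (j + k0) / 4)}"
      using rk sk by (intro stay_probability x_in) (auto simp: s_def)
    then show "C4 * exp (- C5) \<le> prob (G j)" by (simp add: G_def B_def)
  next
    fix j m
    have kj: "k0 \<le> j + k0" by simp
    note rk = r[OF kj] and sk = s_bounds[OF kj]
    define L where "L = \<Omega> - (\<Union>i\<in>{j<..m}. A i)"
    have L: "L \<in> sets (F (ennreal (s (j + k0))))"
    proof -
      have "A i \<in> sets (F (ennreal (s (j + k0))))" if "i \<in> {j<..m}" for i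
        using that by (intro A_F ennreal_leI chain) auto
      then have "(\<Union>i\<in>{j<..m}. A i) \<in> sets (F (ennreal (s (j + k0))))" by (intro sets.finite_UN) auto
      then show ?thesis using sets.compl_sets[of _ "F (ennreal (s (j + k0)))"] by (simp add: L_def space_F)
    qed
    have "p j * prob {\<omega>\<in>L. X (ennreal (s (j + k0))) \<omega> \<in> B j} \<le>
      prob {\<omega>\<in>L. X (ennreal (s (j + k0))) \<omega> \<in> B j \<and> (\<forall>i\<in>I j. X (ennreal (s (j + k0)) + i) \<omega> \<in> D j)}"
    proof (rule markov_stay[OF D B I(1,2) _ L])
      fix z assume "z \<in> B j"
      then obtain z' where z': "z = Some z'" "z' \<in> ball x (r (j + k0) / 4)" by (auto simp: B_def)
      show "p j \<le> measure (P z) {\<omega>\<in>\<Omega>. \<forall>i\<in>I j. X i \<omega> \<in> D j}"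
        unfolding p_def I_def D_def z'(1) using z'(2) rk
        by (intro stay_rational_probability n T_n kj) auto
    qed simp_all
    moreover have "{\<omega>\<in>L. X (ennreal (s (j + k0))) \<omega> \<in> B j} = L \<inter> G j" by (auto simp: L_def G_def)
    moreover have "{\<omega>\<in>L. X (ennreal (s (j + k0))) \<omega> \<in> B j \<and> (\<forall>i\<in>I j. X (ennreal (s (j + k0)) + i) \<omega> \<in> D j)} = L \<inter> G j \<inter> A j"
      by (auto simp: L_def G_def A_def)
    ultimately show "p j * prob ((space (P (Some x)) - (\<Union>i\<in>{j<..m}. A i)) \<inter> G j) \<le>
      prob ((space (P (Some x)) - (\<Union>i\<in>{j<..m}. A i)) \<inter> G j \<inter> A j)"
      by (simp add: L_def)
  qed
  moreover have "0 < C4 * exp (- C5) / 2" using const_pos by simp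
  ultimately have pos: "0 < prob (\<Inter>n. \<Union>k\<in>{n..}. A k)" by linarith
  note [measurable] = A_ev
  have "(\<Inter>n. \<Union>k\<in>{n..}. A k) \<in> events" by measurable
  moreover have "1 \<le> Limsup (at_right 0) (\<lambda>r. occupation_time X (ball x r) (ennreal (t r)) \<omega> / ennreal (t r))"
    if \<omega>: "\<omega> \<in> (\<Inter>n. \<Union>k\<in>{n..}. A k)" for \<omega>
  proof (rule ccontr)
    assume "\<not> ?thesis"
    then have "Limsup (at_right 0) (\<lambda>r. occupation_time X (ball x r) (ennreal (t r)) \<omega> / ennreal (t r)) < 1"
      by (simp add: not_le)
    from dense[OF this] obtain c where c: "Limsup (at_right 0) (\<lambda>r. occupation_time X (ball x r) (ennreal (t r)) \<omega> / ennreal (t r)) < c" "c < 1"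
      by blast
    have "\<forall>\<^sub>F r in at_right 0. occupation_time X (ball x r) (ennreal (t r)) \<omega> / ennreal (t r) < c"
      using Limsup_lessD[OF c(1)] .
    then obtain b where b: "0 < b" "\<And>r. 0 < r \<Longrightarrow> r < b \<Longrightarrow> occupation_time X (ball x r) (ennreal (t r)) \<omega> / ennreal (t r) < c"
      by (auto simp: eventually_at_right_field)
    obtain c' where c': "c = ennreal c'" "0 \<le> c'" "c' < 1" using c(2) by (cases c) auto
    define b' where "b' = min b \<rho>"
    have b': "0 < b'" "b' \<le> \<rho>" "b' \<le> b" using b(1) rho by (auto simp: b'_def)
    have pb: "0 < \<phi> x b'" using b' by (intro phi_pos[OF x_in]) auto
    have ev1: "\<forall>\<^sub>F k in sequentially. v k < \<phi> x b'"
    proof -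
      have "filterlim (\<lambda>k. (real k)\<^sup>2) at_top sequentially"
        by (intro filterlim_pow_at_top filterlim_real_sequentially) simp
      then have "(\<lambda>k. exp (- (real k)\<^sup>2)) \<longlonglongrightarrow> 0"
        by (intro filterlim_compose[OF exp_at_bot]) (simp add: filterlim_uminus_at_top[symmetric])
      then have "v \<longlonglongrightarrow> 0" unfolding v_def .
      then show ?thesis by (rule order_tendstoD(2)[OF _ pb])
    qed
    have ev2: "\<forall>\<^sub>F k in sequentially. 1 / (4 * \<kappa> * ln (real k)) < 1 - c'"
    proof -
      have "filterlim (\<lambda>k. 4 * \<kappa> * ln (real k)) at_top sequentially"
        using \<kappa>(1) by (intro filterlim_tendsto_pos_mult_at_top[OF tendsto_const] filterlim_compose[OF ln_at_top filterlim_real_sequentially]) simp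
      then have "(\<lambda>k. 1 / (4 * \<kappa> * ln (real k))) \<longlonglongrightarrow> 0"
        by (intro tendsto_divide_0[OF tendsto_const] filterlim_at_top_imp_at_infinity)
      then show ?thesis by (rule order_tendstoD(2)) (use c' in simp)
    qed
    obtain k1 where k1: "\<And>k. k1 \<le> k \<Longrightarrow> v k < \<phi> x b' \<and> 1 / (4 * \<kappa> * ln (real k)) < 1 - c'"
      using eventually_conj[OF ev1 ev2] by (auto simp: eventually_sequentially)
    obtain j where j: "k1 \<le> j" "\<omega> \<in> A j" using \<omega> by auto
    define k where "k = j + k0"
    have k: "k0 \<le> k" "k1 \<le> k" "1 < real k" using j k0 by (auto simp: k_def)
    note rk = r[OF k(1)] and sk = s_bounds[OF k(1)] and Tk = T_pos[OF k(1)]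
    have \<omega>\<Omega>: "\<omega> \<in> \<Omega>" using j by (simp add: A_def)
    have "r k < b"
    proof (rule ccontr)
      assume "\<not> r k < b"
      then have "\<phi> x b' \<le> \<phi> x (r k)" using b' rk by (intro phi_mono[OF x_in]) auto
      then show False using k1[OF k(2)] rk by simp
    qed
    have close: "trunc_dist x \<rho> (X (ennreal u) \<omega>) < r k" if u: "s k \<le> u" "u < s k + T k" for u
    proof -
      have "trunc_dist x \<rho> (X (ennreal u) \<omega>) \<le> r k / 2"
      proof (rule stay_imp_close[OF cpt \<omega>\<Omega> _ _ _ u])
        show "X (ennreal (s k) + ennreal (real_of_rat q)) \<omega> \<in> Some ` ball x (r k / 2)"
          if "0 < q" "real_of_rat q < T k" for q
          using j(2) that unfolding A_def I_def D_def k_def[symmetric] by auto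
      qed (use rk sk in auto)
      then show ?thesis using rk by simp
    qed
    \<comment> \<open>The window starts at 0 and the stay at s k, so only [s k, T k] is known to be
      spent in the ball; the loss s k / T k is at most 1 / (4 \<kappa> ln k) and tends to 0.\<close>
    have "ennreal (T k - s k) \<le> (\<integral>\<^sup>+ u. indicator {s k..T k} u \<partial>lborel)"
      using sk by (cases "s k \<le> T k") (auto simp: ennreal_neg)
    also have "\<dots> \<le> occupation_time X (ball x (r k)) (ennreal (T k)) \<omega>"
    proof -
      have *: "occupation_time X (ball x (r k)) (ennreal (T k)) \<omega> =
        (\<integral>\<^sup>+ u\<in>{u. 0 \<le> u \<and> ennreal u \<le> ennreal (T k)}. indicator {z. trunc_dist x \<rho> z < r k} (X (ennreal u) \<omega>) \<partial>lborel)"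
        using rk by (intro occupation_time_eq) auto
      show ?thesis unfolding *
        using close sk Tk by (intro nn_integral_mono) (auto intro: ennreal_leI split: split_indicator)
    qed
    finally have occ: "ennreal (T k - s k) \<le> occupation_time X (ball x (r k)) (ennreal (T k)) \<omega>" .
    have "s k / T k \<le> (v k / 2) / T k" using sk Tk by (intro divide_right_mono) auto
    also have "\<dots> = 1 / (4 * \<kappa> * ln (real k))" using v_pos[of k] by (simp add: T_def)
    finally have "c' < 1 - s k / T k" using k1[OF k(2)] by linarith
    then have "c' < (T k - s k) / T k" using Tk by (simp add: diff_divide_distrib)
    then have "c < ennreal ((T k - s k) / T k)" unfolding c' using c'(2) by (simp add: ennreal_less_iff)
    also have "\<dots> = ennreal (T k - s k) / ennreal (T k)"
    proof (cases "s k \<le> T k")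
      case True
      then show ?thesis using Tk by (simp add: divide_ennreal)
    next
      case False
      then show ?thesis using Tk by (simp add: ennreal_neg divide_nonpos_pos)
    qed
    also have "\<dots> \<le> occupation_time X (ball x (r k)) (ennreal (t (r k))) \<omega> / ennreal (t (r k))"
      unfolding t_r[OF k(1)] by (rule divide_right_mono_ennreal[OF occ])
    finally show False using b(2)[of "r k"] rk \<open>r k < b\<close> by auto
  qed
  ultimately show ?thesis using pos unfolding sets_P by blast
qed

end

section \<open>Upper bound for large time parameters\<close>

context multiscale_process
begin

text \<open>Origin of the constants: with \<eta> = \<delta>/12, the large deviation bound wants
  block means \<eta>/4 = \<delta>/48. The factor 12 pays for rounding to whole blocks (2) and to a
  discrete scale (6). The condition on \<kappa> says 6K \<le> \<kappa>\<eta>, which makes the bad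
  probabilities at most k^(-2).\<close>

lemma Limsup_occupation_le:
  assumes \<delta>: "0 < \<delta>" and m: "0 < m" "2 \<le> \<delta> / 48 * (1 + gain) ^ m"
  defines "K \<equiv> 4 * real m * scale_time * \<beta> ^ m / (\<delta> / 48)"
  assumes \<kappa>: "72 * K / \<delta> \<le> \<kappa>"
  defines "t \<equiv> \<lambda>r. \<kappa> * \<phi> x r * ln \<bar>ln (\<phi> x r)\<bar>"
  shows "AE \<omega> in P (Some x).
    Limsup (at_right 0) (\<lambda>r. occupation_time X (ball x r) (ennreal (t r)) \<omega> / ennreal (t r)) \<le> ennreal \<delta>"
proof -
  interpret prob_space "P (Some x)" by (rule prob_P)
  define \<eta> where "\<eta> = \<delta> / 12"
  have \<eta>: "0 < \<eta>" "\<delta> / 48 = \<eta> / 4" "\<delta> = 12 * \<eta>" using \<delta> by (simp_all add: \<eta>_def)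
  have b1: "1 < \<beta>" using lam(1) one_le_power[OF C2_ge_1, of 4] by linarith
  have K: "0 < K" unfolding K_def using m scale_time_pos b1 \<delta> by simp
  have \<kappa>0: "0 < \<kappa>" using \<kappa> K \<delta> by (smt (verit) divide_pos_pos mult_pos_pos)
  have \<kappa>K: "6 * K \<le> \<kappa> * \<eta>" using \<kappa> \<eta> by (simp add: field_simps)
  define M where "M = \<phi> x (\<rho> / 16)"
  have M: "0 < M" unfolding M_def using rho by (intro phi_pos[OF x_in]) auto
  \<comment> \<open>The second bound keeps all m coarser scales below \<rho>/16; the third makes T k
    at least one block long, so that rounding up at most doubles it.\<close>
  obtain k0 :: nat where k0: "3 \<le> k0" "exp 1 * \<beta> ^ m / M \<le> real k0" "3 * K / (2 * \<kappa>) \<le> ln (real k0)"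
  proof -
    obtain a b where ab: "exp 1 * \<beta> ^ m / M \<le> real a" "exp (3 * K / (2 * \<kappa>)) \<le> real b"
      using real_arch_simple by metis
    define k where "k = max 3 (max a b)"
    have "exp (3 * K / (2 * \<kappa>)) \<le> real k" using ab by (auto simp: k_def)
    moreover have "0 < real k" by (simp add: k_def)
    ultimately have "3 * K / (2 * \<kappa>) \<le> ln (real k)" by (simp add: ln_ge_iff)
    then show ?thesis using ab by (intro that[of k]) (auto simp: k_def)
  qed
  \<comment> \<open>The exponent is shifted by 1 so that \<phi>(x, s) \<le> exp(-k) < v k. Only a
    strict inequality between values of a weakly increasing function yields s < r k.\<close>
  define v where "v k = exp (1 - real k)" for k
  have v_pos: "0 < v k" for k by (simp add: v_def)
  have v_less: "\<beta> ^ m * v k < M" if "k0 \<le> k" for k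
  proof -
    have "exp 1 * \<beta> ^ m / M \<le> real k" using k0(2) that by linarith
    also have "real k < exp (real k)" using exp_ge_add_one_self[of "real k"] by linarith
    finally have "exp 1 * \<beta> ^ m < M * exp (real k)" using M by (simp add: field_simps)
    then show ?thesis by (simp add: v_def exp_diff field_simps)
  qed
  have "\<exists>r. 0 < r \<and> r \<le> \<rho> / 16 \<and> \<phi> x r = v k" if "k0 \<le> k" for k
  proof -
    have "1 * v k \<le> \<beta> ^ m * v k" using b1 v_pos[of k] by (intro mult_right_mono one_le_power) auto
    then show ?thesis using v_less[OF that] rho unfolding M_def by (intro phi_attains[OF v_pos]) auto
  qed
  then obtain r where r: "\<And>k. k0 \<le> k \<Longrightarrow> 0 < r k \<and> r k \<le> \<rho> / 16 \<and> \<phi> x (r k) = v k" by metis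
  define S where "S k = K * v k" for k
  \<comment> \<open>For \<phi>(x, s) = exp(-l) with k \<le> l < k + 1, the factor 2 makes T k an
    upper bound of the window, as ln l \<le> 2 ln k; it overshoots by at most 2 times 3, the 3
    bounding exp 1.\<close>
  define T where "T k = 2 * \<kappa> * exp (- real k) * ln (real k)" for k
  define n where "n k = nat \<lceil>T k / S k\<rceil>" for k
  have S: "0 < S k" for k using K v_pos by (simp add: S_def)
  have ln_k: "0 < ln (real k)" if "k0 \<le> k" for k using that k0 by simp
  have ratio: "T k / S k = 2 * \<kappa> * ln (real k) / (K * exp 1)" for k
    unfolding T_def S_def v_def using K by (simp add: exp_diff exp_minus field_simps)
  have n: "T k \<le> real (n k) * S k" "real (n k) * S k \<le> 2 * T k" "2 * \<kappa> * ln (real k) / (K * exp 1) \<le> real (n k)" if "k0 \<le> k" for k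
  proof -
    have nonneg: "0 \<le> T k / S k" unfolding ratio using \<kappa>0 K ln_k[OF that] by simp
    have le: "T k / S k \<le> real (n k)" and le1: "real (n k) \<le> T k / S k + 1"
      unfolding n_def using nonneg by linarith+
    show "2 * \<kappa> * ln (real k) / (K * exp 1) \<le> real (n k)" using le unfolding ratio .
    show "T k \<le> real (n k) * S k" using le S[of k] by (simp add: field_simps)
    have "3 * K / (2 * \<kappa>) \<le> ln (real k)"
      using k0 that by (intro order_trans[OF k0(3)]) simp
    then have "3 * K \<le> 2 * \<kappa> * ln (real k)" using \<kappa>0 by (simp add: field_simps)
    moreover have "K * exp 1 \<le> 3 * K" using exp_le K by simp
    ultimately have "K * exp 1 \<le> 2 * \<kappa> * ln (real k)" by linarith
    then have "1 \<le> T k / S k" unfolding ratio using K by (simp add: field_simps)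
    then have "real (n k) \<le> 2 * (T k / S k)" using le1 by linarith
    then have "real (n k) * S k \<le> 2 * (T k / S k) * S k" using S[of k] by (intro mult_right_mono) auto
    then show "real (n k) * S k \<le> 2 * T k" using S[of k] by simp
  qed
  define Bad where "Bad k = (if k < k0 then {} else {\<omega>\<in>\<Omega>. ennreal (\<eta> * (real (n k) * S k)) \<le>
    (\<integral>\<^sup>+ u\<in>{0..real (n k) * S k}. cut (r k) (X (ennreal u) \<omega>) \<partial>lborel)})" for k
  have Bad_ev: "Bad k \<in> events" for k
  proof (cases "k < k0")
    case False
    then have rk: "0 < r k" using r[of k] by simp
    have "0 \<le> real (n k) * S k" using S[of k] by simp
    from measurable_F_mono[OF _ measurable_path_integral[OF right_cont_cut[OF rk] order_refl this], of \<infinity>]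
    have [measurable]: "(\<lambda>\<omega>. \<integral>\<^sup>+ u\<in>{0..real (n k) * S k}. cut (r k) (X (ennreal u) \<omega>) \<partial>lborel) \<in> borel_measurable (F \<infinity>)"
      by simp
    have "{\<omega>\<in>space (F \<infinity>). ennreal (\<eta> * (real (n k) * S k)) \<le>
      (\<integral>\<^sup>+ u\<in>{0..real (n k) * S k}. cut (r k) (X (ennreal u) \<omega>) \<partial>lborel)} \<in> sets (F \<infinity>)" by measurable
    then show ?thesis using False unfolding Bad_def sets_P space_F by simp
  qed (simp add: Bad_def)
  have Bad_prob: "prob (Bad k) \<le> inverse ((real k)\<^sup>2)" for k
  proof (cases "k < k0")
    case False
    then have k: "k0 \<le> k" by simp
    note rk = r[OF k]
    have "prob (Bad k) \<le> exp (- (real (n k) * \<eta> / 2))"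
      unfolding Bad_def using False
    proof (simp only: if_False, intro block_large_deviation right_cont_cut cut_le_1 S \<eta>(1))
      fix z
      have "cut_time (r k) z (K * \<phi> x (r k)) \<le> ennreal (\<delta> / 48 * (K * \<phi> x (r k)))"
        unfolding K_def using rk v_less[OF k] \<delta> by (intro ball_occupation_expectation m) (auto simp: M_def)
      then show "(\<integral>\<^sup>+ v\<in>{0..S k}. (\<integral>\<^sup>+ \<omega>. cut (r k) (X (ennreal v) \<omega>) \<partial>P z) \<partial>lborel) \<le> ennreal (\<eta> / 4 * S k)"
        using rk by (simp add: cut_time_def S_def \<eta>(2))
    qed (use rk in simp)
    also have "\<dots> \<le> exp (- (2 * ln (real k)))"
    proof -
      have "3 * (2 * K * exp 1) \<le> 3 * (6 * K)" using exp_le K by simp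
      then have "2 * K * exp 1 \<le> \<kappa> * \<eta>" using \<kappa>K by linarith
      then have "2 \<le> \<kappa> * \<eta> / (K * exp 1)" using K by (simp add: field_simps)
      then have "2 * ln (real k) \<le> \<kappa> * \<eta> / (K * exp 1) * ln (real k)" using ln_k[OF k] by (intro mult_right_mono) auto
      also have "\<dots> = (2 * \<kappa> * ln (real k) / (K * exp 1)) * (\<eta> / 2)" by simp
      also have "\<dots> \<le> real (n k) * (\<eta> / 2)" using n(3)[OF k] \<eta> by (intro mult_right_mono) auto
      finally show ?thesis by simp
    qed
    also have "exp (- (2 * ln (real k))) = inverse ((real k)\<^sup>2)"
    proof -
      have "0 < real k" using k k0 by simp
      then have "exp (ln (real k) + ln (real k)) = (real k)\<^sup>2"
        unfolding exp_add by (simp add: power2_eq_square)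
      then show ?thesis unfolding exp_minus by (simp only: mult_2)
    qed
    finally show ?thesis .
  qed (simp add: Bad_def)
  have "summable (\<lambda>k. prob (Bad k))"
    by (rule summable_comparison_test'[OF inverse_power_summable[of 2]]) (use Bad_prob in auto)
  then have "AE \<omega> in P (Some x). \<forall>\<^sub>F k in sequentially. \<omega> \<in> space (P (Some x)) - Bad k"
    using Bad_ev by (intro borel_cantelli_AE1) (auto simp: emeasure_eq_measure)
  then show ?thesis
  proof eventually_elim
    case (elim \<omega>)
    then obtain k1 where k1: "\<And>k. k1 \<le> k \<Longrightarrow> \<omega> \<in> \<Omega> - Bad k"
      by (auto simp: eventually_sequentially)
    define k2 where "k2 = max k0 k1"
    show ?case
    proof (rule Limsup_bounded)
      have "\<forall>\<^sub>F s in at_right 0. 0 < s \<and> s < \<rho> \<and> 0 < \<phi> x s \<and> \<phi> x s < exp (- real k2)"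
        by (rule eventually_small_phi[OF rho]) simp
      then show "\<forall>\<^sub>F s in at_right 0. occupation_time X (ball x s) (ennreal (t s)) \<omega> / ennreal (t s) \<le> ennreal \<delta>"
      proof eventually_elim
        case (elim s)
        define l where "l = - ln (\<phi> x s)"
        have ps: "\<phi> x s = exp (- l)" using elim by (simp add: l_def)
        have lk2: "real k2 < l" using elim by (simp add: ps)
        define k where "k = nat \<lfloor>l\<rfloor>"
        have kl: "real k \<le> l" "l < real k + 1" unfolding k_def using lk2 by linarith+
        have "real k2 < real k + 1" using lk2 kl by linarith
        then have "k2 \<le> k" by linarith
        then have k: "k0 \<le> k" "k1 \<le> k" "3 \<le> k" using k0 by (auto simp: k2_def)
        note rk = r[OF k(1)]
        have "s < r k"
        proof (rule ccontr)
          assume "\<not> s < r k"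
          then have "\<phi> x (r k) \<le> \<phi> x s" using rk elim by (intro phi_mono[OF x_in]) auto
          then show False using rk kl by (simp add: ps v_def)
        qed
        have lnl: "ln (real k) \<le> ln l" "ln l \<le> 2 * ln (real k)"
        proof -
          show "ln (real k) \<le> ln l" using k kl by (subst ln_le_cancel_iff) auto
          have "real k * 2 \<le> real k * real k" using k by (intro mult_left_mono) auto
          then have "l \<le> (real k)\<^sup>2" using kl k unfolding power2_eq_square by linarith
          then have "ln l \<le> ln ((real k)\<^sup>2)" using k kl by (subst ln_le_cancel_iff) auto
          then show "ln l \<le> 2 * ln (real k)" using k by (simp add: ln_realpow)
        qed
        have ts: "t s = \<kappa> * exp (- l) * ln l"
          unfolding t_def ps using lk2 by simp
        have upper: "t s \<le> T k"
        proof -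
          have "\<kappa> * exp (- l) * ln l \<le> \<kappa> * exp (- real k) * (2 * ln (real k))"
            using kl lnl ln_k[OF k(1)] \<kappa>0 by (intro mult_mono) auto
          then show ?thesis by (simp add: ts T_def)
        qed
        have lower: "T k \<le> 6 * t s"
        proof -
          have "exp (- real k) = exp 1 * exp (- real k - 1)" by (simp add: exp_add[symmetric])
          also have "\<dots> \<le> 3 * exp (- l)" using kl exp_le by (intro mult_mono) auto
          finally have "exp (- real k) \<le> 3 * exp (- l)" .
          then have "(2 * \<kappa>) * exp (- real k) * ln (real k) \<le> (2 * \<kappa>) * (3 * exp (- l)) * ln l"
            using lnl ln_k[OF k(1)] \<kappa>0 by (intro mult_mono) auto
          then show ?thesis by (simp add: ts T_def)
        qed
        have T: "0 < T k" using ln_k[OF k(1)] \<kappa>0 by (simp add: T_def)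
        have ts_pos: "0 < t s" using lower T by linarith
        have "occupation_time X (ball x s) (ennreal (t s)) \<omega> \<le> occupation_time X (ball x (r k)) (ennreal (T k)) \<omega>"
          using \<open>s < r k\<close> upper by (intro occupation_time_mono ennreal_leI) auto
        also have "\<dots> = (\<integral>\<^sup>+ u\<in>{u. 0 \<le> u \<and> ennreal u \<le> ennreal (T k)}. indicator {z. trunc_dist x \<rho> z < r k} (X (ennreal u) \<omega>) \<partial>lborel)"
          using rk rho by (intro occupation_time_eq) auto
        also have "\<dots> \<le> (\<integral>\<^sup>+ u\<in>{0..real (n k) * S k}. cut (r k) (X (ennreal u) \<omega>) \<partial>lborel)"
        proof (intro nn_integral_mono mult_mono)
          fix u :: real
          show "(indicator {z. trunc_dist x \<rho> z < r k} (X (ennreal u) \<omega>) :: ennreal) \<le> cut (r k) (X (ennreal u) \<omega>)"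
            using cut_eq_1[of "r k" "X (ennreal u) \<omega>"] rk by (auto split: split_indicator)
          show "(indicator {u. 0 \<le> u \<and> ennreal u \<le> ennreal (T k)} u :: ennreal) \<le> indicator {0..real (n k) * S k} u"
            using n(1)[OF k(1)] T by (auto simp: ennreal_le_iff split: split_indicator)
        qed auto
        also have "\<dots> < ennreal (\<eta> * (real (n k) * S k))"
          using k1[OF k(2)] k by (auto simp: Bad_def not_le)
        also have "\<dots> \<le> ennreal (\<delta> * t s)"
        proof (rule ennreal_leI)
          have "\<eta> * (real (n k) * S k) \<le> \<eta> * (2 * (6 * t s))"
            using n(2)[OF k(1)] lower \<eta> by (intro mult_left_mono) auto
          then show "\<eta> * (real (n k) * S k) \<le> \<delta> * t s" by (simp add: \<eta>(3))
        qed
        finally have "occupation_time X (ball x s) (ennreal (t s)) \<omega> / ennreal (t s) \<le> ennreal (\<delta> * t s) / ennreal (t s)"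
          by (intro divide_right_mono_ennreal less_imp_le)
        also have "\<dots> = ennreal \<delta>" using ts_pos \<delta> by (simp add: divide_ennreal)
        finally show ?case .
      qed
    qed
  qed
qed

end

section \<open>Dependence on the time parameter\<close>

text \<open>Writing \<phi> = exp(-a), the window is \<kappa> exp(-a) ln a. From 3 on, ln a \<ge> 1,
  so passing from a to b multiplies the logarithm by at most 1 + (b - a), which is at most exp(b -
  a).\<close>

lemma exp_ln_decreasing:
  fixes a b :: real
  assumes "3 \<le> a" "a \<le> b"
  shows "exp (- b) * ln b \<le> exp (- a) * ln a"
proof -
  have "ln (exp 1) \<le> ln (3::real)" using exp_le by (subst ln_le_cancel_iff) auto
  moreover have "ln (3::real) \<le> ln a" using assms by (subst ln_le_cancel_iff) auto
  ultimately have ln_a: "1 \<le> ln a" by simp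
  have "ln b - ln a = ln (b / a)" using assms by (simp add: ln_div)
  also have "\<dots> \<le> b / a - 1" using assms by (intro ln_le_minus_one) simp
  also have "\<dots> = (b - a) / a" using assms by (simp add: field_simps)
  also have "\<dots> \<le> (b - a) / 1" using assms by (intro divide_left_mono) auto
  also have "\<dots> \<le> (b - a) * ln a" using ln_a assms mult_left_mono[of 1 "ln a" "b - a"] by simp
  finally have "ln b \<le> ln a * (1 + (b - a))" by (simp add: algebra_simps)
  also have "\<dots> \<le> ln a * exp (b - a)" using ln_a by (intro mult_left_mono exp_ge_add_one_self) simp
  finally have "exp (- b) * ln b \<le> exp (- b) * (ln a * exp (b - a))" by (intro mult_left_mono) auto
  also have "\<dots> = exp (- a) * ln a" by (simp add: exp_diff exp_minus field_simps)
  finally show ?thesis .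
qed

context scaled_process
begin

lemma time_scale:
  assumes \<kappa>: "0 < \<kappa>"
  defines "t \<equiv> \<lambda>r. \<kappa> * \<phi> x r * ln \<bar>ln (\<phi> x r)\<bar>"
  obtains d where "0 < d" "d \<le> \<rho>" "mono_on {0<..<d} t" "continuous_on {0<..<d} t"
    "\<And>r. 0 < r \<Longrightarrow> r < d \<Longrightarrow> 0 < t r" "(t \<longlongrightarrow> 0) (at_right 0)"
proof -
  \<comment> \<open>Below exp(-3) the exponent a exceeds 3, where the window is positive and
    \<open>exp_ln_decreasing\<close> makes it increasing in r.\<close>
  have "\<forall>\<^sub>F r in at_right 0. 0 < r \<and> r < \<rho> \<and> 0 < \<phi> x r \<and> \<phi> x r < exp (- 3)"
    by (rule eventually_small_phi[OF rho]) simp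
  then obtain b where b: "0 < b" "\<And>r. 0 < r \<Longrightarrow> r < b \<Longrightarrow> 0 < \<phi> x r \<and> \<phi> x r < exp (- 3)"
    by (auto simp: eventually_at_right_field)
  define d where "d = min b \<rho>"
  have d: "0 < d" "d \<le> \<rho>" using b rho by (auto simp: d_def)
  define a where "a r = - ln (\<phi> x r)" for r
  have a: "3 < a r" "\<phi> x r = exp (- a r)" "t r = \<kappa> * (exp (- a r) * ln (a r))" if "0 < r" "r < d" for r
  proof -
    have *: "0 < \<phi> x r" "\<phi> x r < exp (- 3)" using b(2)[of r] that by (auto simp: d_def)
    have "ln (\<phi> x r) < ln (exp (- 3))" using * by (subst ln_less_cancel_iff) auto
    then show "3 < a r" by (simp add: a_def)
    show "\<phi> x r = exp (- a r)" using * by (simp add: a_def)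
    then show "t r = \<kappa> * (exp (- a r) * ln (a r))" using \<open>3 < a r\<close> by (simp add: t_def)
  qed
  have pos: "0 < t r" if "0 < r" "r < d" for r
    using a[OF that] \<kappa> by simp
  have mono: "mono_on {0<..<d} t"
  proof (rule mono_onI)
    fix r s assume rs: "r \<in> {0<..<d}" "s \<in> {0<..<d}" "r \<le> s"
    have "\<phi> x r \<le> \<phi> x s" using rs d by (intro phi_mono[OF x_in]) auto
    then have "a s \<le> a r" using a(2)[of r] a(2)[of s] rs by simp
    then have "exp (- a r) * ln (a r) \<le> exp (- a s) * ln (a s)"
      using a(1)[of s] rs by (intro exp_ln_decreasing) auto
    then show "t r \<le> t s" using a(3)[of r] a(3)[of s] rs \<kappa> by simp
  qed
  have cont: "continuous_on {0<..<d} t"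
  proof -
    have "continuous_on {0<..<d} (\<phi> x)" using d by (intro continuous_on_subset[OF phi_cont]) auto
    moreover have "\<phi> x r \<noteq> 0 \<and> ln (\<phi> x r) \<noteq> 0" if "r \<in> {0<..<d}" for r
      using a(1,2)[of r] that by auto
    ultimately show ?thesis
      unfolding t_def by (intro continuous_intros) auto
  qed
  have "(t \<longlongrightarrow> 0) (at_right 0)"
  proof (rule tendsto_sandwich)
    have ev: "\<forall>\<^sub>F r in at_right 0. 0 < r \<and> r < d" using d by (auto simp: eventually_at_right_field)
    show "\<forall>\<^sub>F r in at_right 0. 0 \<le> t r" using ev by eventually_elim (simp add: pos less_imp_le)
    \<comment> \<open>ln a \<le> a \<le> 2 exp(a/2), so half of the exponential decay
      survives.\<close>
    show "\<forall>\<^sub>F r in at_right 0. t r \<le> 2 * \<kappa> * sqrt (\<phi> x r)"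
      using ev
    proof eventually_elim
      case (elim r)
      note ar = a[of r]
      have "ln (a r) \<le> a r" using ar elim ln_le_minus_one[of "a r"] by simp
      also have "\<dots> \<le> 2 * exp (a r / 2)" using exp_ge_add_one_self[of "a r / 2"] by linarith
      finally have "exp (- a r) * ln (a r) \<le> exp (- a r) * (2 * exp (a r / 2))" by (intro mult_left_mono) auto
      also have "\<dots> = 2 * exp (- a r / 2)" by (simp add: exp_add[symmetric] mult.left_commute)
      also have "exp (- a r / 2) = sqrt (\<phi> x r)"
      proof (rule real_sqrt_unique[symmetric])
        show "(exp (- a r / 2))\<^sup>2 = \<phi> x r" using ar elim by (simp add: power2_eq_square exp_add[symmetric])
      qed simp
      finally show ?case using ar elim \<kappa> by simp
    qed
    have "((\<lambda>r. 2 * \<kappa> * sqrt (\<phi> x r)) \<longlongrightarrow> 2 * \<kappa> * sqrt 0) (at_right 0)"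
      by (intro tendsto_intros phi_lim)
    then show "((\<lambda>r. 2 * \<kappa> * sqrt (\<phi> x r)) \<longlongrightarrow> 0) (at_right 0)" by simp
  qed simp
  then show thesis using that d mono cont pos by blast
qed

lemma limsup_occupation_eq:
  "limsup_occupation X \<phi> x \<kappa> \<omega> = Limsup (at_right 0) (\<lambda>r. occupation_time X (ball x r)
     (ennreal (\<kappa> * \<phi> x r * ln \<bar>ln (\<phi> x r)\<bar>)) \<omega> / ennreal (\<kappa> * \<phi> x r * ln \<bar>ln (\<phi> x r)\<bar>))"
  by (simp add: limsup_occupation_def Let_def)

lemma limsup_occupation_constant:
  assumes "0 < \<kappa>"
  shows "\<exists>!c. c \<in> {0..1} \<and> (AE \<omega> in P (Some x). limsup_occupation X \<phi> x \<kappa> \<omega> = ennreal c)"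
proof -
  interpret prob_space "P (Some x)" by (rule prob_P)
  obtain d where d: "0 < d" "d \<le> \<rho>" "mono_on {0<..<d} (\<lambda>r. \<kappa> * \<phi> x r * ln \<bar>ln (\<phi> x r)\<bar>)"
    "continuous_on {0<..<d} (\<lambda>r. \<kappa> * \<phi> x r * ln \<bar>ln (\<phi> x r)\<bar>)"
    "\<And>r. 0 < r \<Longrightarrow> r < d \<Longrightarrow> 0 < \<kappa> * \<phi> x r * ln \<bar>ln (\<phi> x r)\<bar>"
    "((\<lambda>r. \<kappa> * \<phi> x r * ln \<bar>ln (\<phi> x r)\<bar>) \<longlongrightarrow> 0) (at_right 0)"
    using time_scale[OF assms] by blast
  obtain c where c: "c \<in> {0..1}" "AE \<omega> in P (Some x). limsup_occupation X \<phi> x \<kappa> \<omega> = ennreal c"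
    using Limsup_occupation_constant[OF cpt d, of "Some x"] unfolding limsup_occupation_eq by blast
  have "c' = c" if "c' \<in> {0..1}" "AE \<omega> in P (Some x). limsup_occupation X \<phi> x \<kappa> \<omega> = ennreal c'" for c'
  proof -
    have "AE \<omega> in P (Some x). ennreal c' = ennreal c"
      using that(2) c(2) by eventually_elim simp
    then show ?thesis using that c by simp
  qed
  then show ?thesis using c by blast
qed

lemma limsup_occupation_antimono:
  assumes \<kappa>: "0 < \<kappa>" "\<kappa> < \<kappa>'"
  shows "limsup_occupation X \<phi> x \<kappa>' \<omega> \<le> limsup_occupation X \<phi> x \<kappa> \<omega>"
proof (rule ccontr)
  define t where "t r = \<kappa> * \<phi> x r * ln \<bar>ln (\<phi> x r)\<bar>" for r
  have t': "\<kappa>' * \<phi> x r * ln \<bar>ln (\<phi> x r)\<bar> = \<kappa>' / \<kappa> * t r" for r using \<kappa> by (simp add: t_def)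
  define g where "g r = occupation_time X (ball x r) (ennreal (t r)) \<omega> / ennreal (t r)" for r
  define g' where "g' r = occupation_time X (ball x r) (ennreal (\<kappa>' / \<kappa> * t r)) \<omega> / ennreal (\<kappa>' / \<kappa> * t r)" for r
  obtain d where d: "0 < d" "d \<le> \<rho>" "continuous_on {0<..<d} t"
    "\<And>r. 0 < r \<Longrightarrow> r < d \<Longrightarrow> 0 < t r" "(t \<longlongrightarrow> 0) (at_right 0)"
    using time_scale[OF \<kappa>(1)] unfolding t_def by blast
  assume "\<not> ?thesis"
  then have "Limsup (at_right 0) g < Limsup (at_right 0) g'"
    unfolding limsup_occupation_eq t' t_def[symmetric] g_def g'_def by (simp add: not_le)
  from dense[OF this] obtain c where c: "Limsup (at_right 0) g < c" "c < Limsup (at_right 0) g'" by blast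
  obtain b where b: "0 < b" "\<And>r. 0 < r \<Longrightarrow> r < b \<Longrightarrow> g r < c"
    using Limsup_lessD[OF c(1)] by (auto simp: eventually_at_right_field)
  define e where "e = min b d / 2"
  have e: "0 < e" "e < b" "e < d" using b d by (auto simp: e_def)
  have "0 < t e * (\<kappa> / \<kappa>')" using d(4)[of e] e \<kappa> by simp
  then have "\<forall>\<^sub>F s in at_right 0. t s < t e * (\<kappa> / \<kappa>')" by (rule order_tendstoD(2)[OF d(5)])
  moreover have "\<forall>\<^sub>F s in at_right 0. 0 < s \<and> s < e" using e by (auto simp: eventually_at_right_field)
  ultimately have "\<forall>\<^sub>F s in at_right 0. g' s \<le> c"
  proof eventually_elim
    case (elim s)
    have ts: "0 < t s" using d(4)[of s] elim e by simp
    have "1 * t s \<le> \<kappa>' / \<kappa> * t s" using ts \<kappa> by (intro mult_right_mono) (auto simp: field_simps)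
    moreover have "\<kappa>' / \<kappa> * t s \<le> t e" using elim \<kappa> by (simp add: field_simps)
    moreover have "continuous_on {s..e} t" using elim e by (intro continuous_on_subset[OF d(3)]) auto
    ultimately obtain r where r: "s \<le> r" "r \<le> e" "t r = \<kappa>' / \<kappa> * t s"
      using IVT'[of t s "\<kappa>' / \<kappa> * t s" e] elim by auto
    have "g' s \<le> g r"
      unfolding g'_def g_def r(3) using r(1) by (intro divide_right_mono_ennreal occupation_time_mono) auto
    also have "g r < c" using r e elim by (intro b(2)) auto
    finally show ?case by simp
  qed
  then have "Limsup (at_right 0) g' \<le> c" by (rule Limsup_bounded)
  then show False using c(2) by simp
qed

text \<open>The window of \<kappa> is contained in that of \<kappa>', and their lengths have a fixed
  ratio. A negligible occupation of the longer window is thus at most half of the shorter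
  one.\<close>

lemma limsup_occupation_pos:
  assumes \<kappa>: "0 < \<kappa>" "\<kappa> \<le> \<kappa>'" and zero: "limsup_occupation X \<phi> x \<kappa>' \<omega> = 0"
  shows "limsup_occupation X \<phi> x \<kappa> \<omega> < 1"
proof -
  define t where "t r = \<kappa> * \<phi> x r * ln \<bar>ln (\<phi> x r)\<bar>" for r
  have t': "\<kappa>' * \<phi> x r * ln \<bar>ln (\<phi> x r)\<bar> = \<kappa>' / \<kappa> * t r" for r using \<kappa> by (simp add: t_def)
  obtain d where d: "0 < d" "\<And>r. 0 < r \<Longrightarrow> r < d \<Longrightarrow> 0 < t r"
    using time_scale[OF \<kappa>(1)] unfolding t_def by blast
  define c where "c = \<kappa> / (2 * \<kappa>')"
  have c: "0 < c" "c * (\<kappa>' / \<kappa>) = 1 / 2" using \<kappa> by (simp_all add: c_def)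
  have "Limsup (at_right 0) (\<lambda>r. occupation_time X (ball x r) (ennreal (\<kappa>' / \<kappa> * t r)) \<omega> / ennreal (\<kappa>' / \<kappa> * t r)) < ennreal c"
    using c(1) unfolding zero[unfolded limsup_occupation_eq t'] by simp
  then have "\<forall>\<^sub>F r in at_right 0. occupation_time X (ball x r) (ennreal (\<kappa>' / \<kappa> * t r)) \<omega> / ennreal (\<kappa>' / \<kappa> * t r) < ennreal c"
    by (rule Limsup_lessD)
  moreover have "\<forall>\<^sub>F r in at_right 0. 0 < r \<and> r < d" using d by (auto simp: eventually_at_right_field)
  ultimately have "\<forall>\<^sub>F r in at_right 0. occupation_time X (ball x r) (ennreal (t r)) \<omega> / ennreal (t r) \<le> ennreal (1 / 2)"
  proof eventually_elim
    case (elim r)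
    have tr: "0 < t r" using d(2)[of r] elim by simp
    define t'' where "t'' = \<kappa>' / \<kappa> * t r"
    have t'': "0 < t''" "t r \<le> t''" unfolding t''_def using tr \<kappa> by (auto simp: field_simps)
    obtain oc where oc: "occupation_time X (ball x r) (ennreal (t r)) \<omega> = ennreal oc" "0 \<le> oc"
      using occupation_time_le[of "t r" X "ball x r" \<omega>] tr by (cases "occupation_time X (ball x r) (ennreal (t r)) \<omega>") (auto simp: top_unique)
    have "ennreal oc / ennreal t'' \<le> occupation_time X (ball x r) (ennreal t'') \<omega> / ennreal t''"
      unfolding oc(1)[symmetric] using t'' by (intro divide_right_mono_ennreal occupation_time_mono ennreal_leI) auto
    also have "\<dots> < ennreal c" using elim by (simp add: t''_def)
    finally have "oc / t'' < c" using t'' oc c by (simp add: divide_ennreal ennreal_less_iff)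
    then have "oc < c * t''" using t'' by (simp add: field_simps)
    also have "\<dots> = t r / 2" unfolding t''_def mult.assoc[symmetric] c(2) by simp
    finally have "oc / t r \<le> 1 / 2" using tr by (simp add: field_simps)
    then have "ennreal (oc / t r) \<le> ennreal (1 / 2)" by (rule ennreal_leI)
    then show ?case unfolding oc(1) divide_ennreal[OF oc(2) tr] .
  qed
  then have "limsup_occupation X \<phi> x \<kappa> \<omega> \<le> ennreal (1 / 2)"
    unfolding limsup_occupation_eq t_def[symmetric] by (rule Limsup_bounded)
  also have "\<dots> < ennreal 1" by (rule ennreal_lessI) simp_all
  also have "ennreal 1 = 1" by simp
  finally show ?thesis .
qed

end

section \<open>From the global hypotheses to the local ones, and the theorem\<close>

lemma compact_cball_exists:
  fixes x :: "'m::metric_space"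
  assumes "locally_compact_space (euclidean :: 'm topology)"
  obtains r where "0 < r" "compact (cball x r)"
proof -
  have "\<exists>V K. open V \<and> compact K \<and> x \<in> V \<and> V \<subseteq> K"
    using assms by (simp add: locally_compact_space_def)
  then obtain V K where V: "open V" "compact K" "x \<in> V" "V \<subseteq> K"
    by blast
  obtain e where e: "0 < e" "cball x e \<subseteq> V"
    using V open_contains_cball by blast
  have "cball x e = K \<inter> cball x e" using e V by auto
  moreover have "compact (K \<inter> cball x e)" using V by (intro compact_Int_closed) auto
  ultimately show thesis using e that by metis
qed

lemma scaled_process_exists:
  fixes X :: "ennreal \<Rightarrow> 'w \<Rightarrow> 'm::{metric_space, second_countable_topology} option"
    and U :: "'m set" and \<phi> :: "'m \<Rightarrow> real \<Rightarrow> real"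
  assumes bsp: "borel_standard_process \<Omega> F X P" and levy: "levy_system X P J" and U: "open U"
    and pos: "0 < R0" "0 < C0" "C0 < 1" "1 < C1" "0 < C2" "0 < C3" "0 < C4" "0 < C5" "0 < C6" "0 < C7"
    and phi_pos: "\<And>z r. z \<in> U \<Longrightarrow> 0 < r \<Longrightarrow> r < R0 \<Longrightarrow> 0 < \<phi> z r"
    and phi_mono: "\<And>z. z \<in> U \<Longrightarrow> mono_on {0<..<R0} (\<phi> z)"
    and phi_cont: "\<And>z. z \<in> U \<Longrightarrow> continuous_on {0<..<R0} (\<phi> z)"
    and CE: "\<And>x r y. x \<in> U \<Longrightarrow> 0 < r \<Longrightarrow> ereal r < min (ereal R0) (ereal C0 * dist_compl U x) \<Longrightarrow>
      y \<in> ball x r \<Longrightarrow> inverse C1 * \<phi> y r \<le> \<phi> x r \<and> \<phi> x r \<le> C1 * \<phi> y r"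
    and US: "\<And>x r. x \<in> U \<Longrightarrow> 0 < r \<Longrightarrow> ereal r < min (ereal R0) (ereal C0 * dist_compl U x) \<Longrightarrow>
      (\<phi> x \<longlongrightarrow> 0) (at_right 0) \<and> \<phi> x r \<le> C2 * \<phi> x (r / 2)"
    and Tail: "\<And>x r. x \<in> U \<Longrightarrow> 0 < r \<Longrightarrow> ereal r < min (ereal R0) (ereal C0 * dist_compl U x) \<Longrightarrow>
      emeasure (J x) (UNIV - Some ` ball x r) \<le> ennreal (C3 / \<phi> x r)"
    and SP: "\<And>x r n. x \<in> U \<Longrightarrow> 0 < r \<Longrightarrow> ereal r < min (ereal R0) (ereal C0 * dist_compl U x) \<Longrightarrow>
      1 \<le> (n::nat) \<Longrightarrow>
      C4 * exp (- C5 * real n)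
        \<le> measure (P (Some x)) {\<omega>\<in>\<Omega>. ennreal (real n * \<phi> x r) \<le> exit_time X (ball x r) \<omega>} \<and>
      measure (P (Some x)) {\<omega>\<in>\<Omega>. ennreal (real n * \<phi> x r) \<le> exit_time X (ball x r) \<omega>}
        \<le> C6 * exp (- C7 * real n)"
    and x: "x \<in> U"
  shows "\<exists>\<rho>. scaled_process \<Omega> F X P J \<phi> x \<rho> C1 C2 C3 C4 C5 C6 C7"
proof -
  interpret borel_standard_process \<Omega> F X P by (rule bsp)
  obtain r0 where r0: "0 < r0" "compact (cball x r0)"
    using compact_cball_exists[OF locally_compact] by blast
  obtain e where e: "0 < e" "ball x e \<subseteq> U"
    using U x open_contains_ball by blast
  \<comment> \<open>With B(x, e) in U, centres within e/2 of x keep distance at least e/2 from the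
    complement of U, so radii below C0 e/2 are admissible for all of them at once. The other entries
    give compactness and r < R0.\<close>
  define \<rho> where "\<rho> = Min {r0, R0 / 2, e / 2, C0 * e / 4}"
  have \<rho>: "0 < \<rho>" "\<rho> \<le> r0" "\<rho> < R0" "\<rho> \<le> e / 2" "\<rho> < C0 * (e / 2)"
  proof -
    have le: "\<rho> \<le> r0" "\<rho> \<le> R0 / 2" "\<rho> \<le> e / 2" "\<rho> \<le> C0 * e / 4" by (simp_all add: \<rho>_def)
    have "0 < C0 * e" using pos e by simp
    then show "0 < \<rho>" using r0 pos e by (simp add: \<rho>_def)
    show "\<rho> \<le> r0" "\<rho> < R0" "\<rho> \<le> e / 2" "\<rho> < C0 * (e / 2)" using le pos \<open>0 < C0 * e\<close> by auto
  qed
  have yU: "y \<in> U" if "y \<in> cball x \<rho>" for y using that \<rho> e by auto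
  have scale: "ereal r < min (ereal R0) (ereal C0 * dist_compl U y)" if y: "y \<in> cball x \<rho>" and r: "r \<le> \<rho>" for y r
  proof -
    have "ereal (e / 2) \<le> dist_compl U y"
      unfolding dist_compl_def
    proof (rule INF_greatest)
      fix z assume "z \<in> - U"
      then have "e \<le> dist x z" using e(2) by (auto simp: subset_iff not_less[symmetric])
      moreover have "dist x z \<le> dist x y + dist y z" by (rule dist_triangle)
      ultimately show "ereal (e / 2) \<le> ereal (dist y z)" using y \<rho> by simp
    qed
    then have le: "ereal C0 * ereal (e / 2) \<le> ereal C0 * dist_compl U y"
      using pos by (intro ereal_mult_left_mono) auto
    have "ereal r < ereal C0 * ereal (e / 2)" using r \<rho> by simp
    from less_le_trans[OF this le] show ?thesis using r \<rho> by simp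
  qed
  have "scaled_process \<Omega> F X P J \<phi> x \<rho> C1 C2 C3 C4 C5 C6 C7"
  proof (intro scaled_process.intro bsp scaled_process_axioms.intro levy pos \<rho>(1))
    have "cball x \<rho> = cball x r0 \<inter> cball x \<rho>" using \<rho> by auto
    moreover have "compact (cball x r0 \<inter> cball x \<rho>)" using r0 by (intro compact_Int_closed) auto
    ultimately show "compact (cball x \<rho>)" by metis
    show "0 < \<phi> y r" if "y \<in> cball x \<rho>" "0 < r" "r \<le> \<rho>" for y r
      using that \<rho> by (intro phi_pos yU) auto
    show "\<phi> y r \<le> \<phi> y s" if "y \<in> cball x \<rho>" "0 < r" "r \<le> s" "s \<le> \<rho>" for y r s
      using that \<rho> by (intro mono_onD[OF phi_mono[OF yU]]) auto
    show "continuous_on {0<..\<rho>} (\<phi> x)"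
      using \<rho> by (intro continuous_on_subset[OF phi_cont[OF x]]) auto
    show "(\<phi> x \<longlongrightarrow> 0) (at_right 0)"
      using US[OF x \<rho>(1) scale] \<rho>(1) by simp
    show "\<phi> z r \<le> C1 * \<phi> y r \<and> \<phi> y r \<le> C1 * \<phi> z r" if "y \<in> cball x \<rho>" "0 < r" "r \<le> \<rho>" "z \<in> ball y r" for y r z
      using CE[OF yU[OF that(1)] that(2) scale[OF that(1,3)] that(4)] pos(4) by (simp add: field_simps)
    show "\<phi> y r \<le> C2 * \<phi> y (r / 2)" if "y \<in> cball x \<rho>" "0 < r" "r \<le> \<rho>" for y r
      using US[OF yU[OF that(1)] that(2) scale[OF that(1,3)]] by simp
    show "emeasure (J y) (UNIV - Some ` ball y r) \<le> ennreal (C3 / \<phi> y r)" if "y \<in> cball x \<rho>" "0 < r" "r \<le> \<rho>" for y r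
      by (rule Tail[OF yU[OF that(1)] that(2) scale[OF that(1,3)]])
    show "C4 * exp (- C5 * real n) \<le> measure (P (Some y)) {\<omega>\<in>\<Omega>. ennreal (real n * \<phi> y r) \<le> exit_time X (ball y r) \<omega>}"
      "measure (P (Some y)) {\<omega>\<in>\<Omega>. ennreal (real n * \<phi> y r) \<le> exit_time X (ball y r) \<omega>} \<le> C6 * exp (- C7 * real n)"
      if "y \<in> cball x \<rho>" "0 < r" "r \<le> \<rho>" "1 \<le> n" for y r n
      using SP[OF yU[OF that(1)] that(2) scale[OF that(1,3)] that(4)] by auto
  qed
  then show ?thesis by blast
qed

theorem theorem2p4:
  fixes \<mu> :: "'m::{metric_space, second_countable_topology} measure"
    and \<Omega> :: "'w set" and F :: "ennreal \<Rightarrow> 'w measure"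
    and X :: "ennreal \<Rightarrow> 'w \<Rightarrow> 'm option" and P :: "'m option \<Rightarrow> 'w measure"
    and J :: "'m \<Rightarrow> 'm option measure"
    and U :: "'m set" and \<phi> :: "'m \<Rightarrow> real \<Rightarrow> real"
    and R0 C0 C1 C2 C3 C4 C5 C6 C7 :: real
  assumes "radon_measure \<mu>" and "full_support \<mu>"
    and "borel_standard_process \<Omega> F X P" and "levy_system X P J"
    and "open U"
    and "0 < R0" and "0 < C0" and "C0 < 1" and "1 < C1"
    and "0 < C2" and "0 < C3" and "0 < C4" and "0 < C5" and "0 < C6" and "0 < C7"
    and phi_pos: "\<And>z r. z \<in> U \<Longrightarrow> 0 < r \<Longrightarrow> r < R0 \<Longrightarrow> 0 < \<phi> z r"
    and phi_mono: "\<And>z. z \<in> U \<Longrightarrow> mono_on {0<..<R0} (\<phi> z)"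
    and phi_cont: "\<And>z. z \<in> U \<Longrightarrow> continuous_on {0<..<R0} (\<phi> z)"
    and CE: "\<And>x r y. x \<in> U \<Longrightarrow> 0 < r \<Longrightarrow> ereal r < min (ereal R0) (ereal C0 * dist_compl U x) \<Longrightarrow>
      y \<in> ball x r \<Longrightarrow> inverse C1 * \<phi> y r \<le> \<phi> x r \<and> \<phi> x r \<le> C1 * \<phi> y r"
    and US: "\<And>x r. x \<in> U \<Longrightarrow> 0 < r \<Longrightarrow> ereal r < min (ereal R0) (ereal C0 * dist_compl U x) \<Longrightarrow>
      (\<phi> x \<longlongrightarrow> 0) (at_right 0) \<and> \<phi> x r \<le> C2 * \<phi> x (r / 2)"
    and Tail: "\<And>x r. x \<in> U \<Longrightarrow> 0 < r \<Longrightarrow> ereal r < min (ereal R0) (ereal C0 * dist_compl U x) \<Longrightarrow>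
      emeasure (J x) (UNIV - Some ` ball x r) \<le> ennreal (C3 / \<phi> x r)"
    and SP: "\<And>x r n. x \<in> U \<Longrightarrow> 0 < r \<Longrightarrow> ereal r < min (ereal R0) (ereal C0 * dist_compl U x) \<Longrightarrow>
      1 \<le> (n::nat) \<Longrightarrow>
      C4 * exp (- C5 * real n)
        \<le> measure (P (Some x)) {\<omega>\<in>\<Omega>. ennreal (real n * \<phi> x r) \<le> exit_time X (ball x r) \<omega>} \<and>
      measure (P (Some x)) {\<omega>\<in>\<Omega>. ennreal (real n * \<phi> x r) \<le> exit_time X (ball x r) \<omega>}
        \<le> C6 * exp (- C7 * real n)"
  shows "(\<forall>x\<in>U. \<forall>\<kappa>>0. \<exists>!c. c \<in> {0..1} \<and>
            (AE \<omega> in P (Some x). limsup_occupation X \<phi> x \<kappa> \<omega> = ennreal c)) \<and>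
         (\<forall>f0::'m \<Rightarrow> real \<Rightarrow> real.
            (\<forall>x\<in>U. \<forall>\<kappa>>0. f0 x \<kappa> \<in> {0..1} \<and>
               (AE \<omega> in P (Some x). limsup_occupation X \<phi> x \<kappa> \<omega> = ennreal (f0 x \<kappa>))) \<longrightarrow>
            (\<forall>x\<in>U. (\<forall>\<kappa>>0. 0 < f0 x \<kappa>) \<and> antimono_on {0<..} (f0 x)) \<and>
            (\<exists>\<kappa>0>0. \<forall>x\<in>U. \<forall>\<kappa>. 0 < \<kappa> \<and> \<kappa> \<le> \<kappa>0 \<longrightarrow> f0 x \<kappa> = 1) \<and>
            uniform_limit U (\<lambda>\<kappa> x. f0 x \<kappa>) (\<lambda>_. 0) at_top)"
proof -
  interpret borel_standard_process \<Omega> F X P by fact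
  note prob = prob_P[THEN prob_space.AE_const]
  have local_process: "\<exists>\<rho>. scaled_process \<Omega> F X P J \<phi> x \<rho> C1 C2 C3 C4 C5 C6 C7" if "x \<in> U" for x
    by (rule scaled_process_exists[OF assms(3-15) phi_pos phi_mono phi_cont CE US Tail SP that])
  have unique: "\<exists>!c. c \<in> {0..1} \<and> (AE \<omega> in P (Some x). limsup_occupation X \<phi> x \<kappa> \<omega> = ennreal c)"
    if "x \<in> U" "0 < \<kappa>" for x \<kappa>
    using scaled_process.limsup_occupation_constant[OF _ that(2)] local_process[OF that(1)] by blast
  \<comment> \<open>The largest value that \<open>Limsup_occupation_ge_1\<close> admits; it does not
    depend on x.\<close>
  define \<kappa>0 where "\<kappa>0 = 1 / (2 * C1 * C2 ^ 2 * C5)"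
  have \<kappa>0: "0 < \<kappa>0" unfolding \<kappa>0_def using assms(6-15) by simp
  have main: "(\<forall>x\<in>U. (\<forall>\<kappa>>0. 0 < f0 x \<kappa>) \<and> antimono_on {0<..} (f0 x)) \<and>
      (\<exists>\<kappa>0>0. \<forall>x\<in>U. \<forall>\<kappa>. 0 < \<kappa> \<and> \<kappa> \<le> \<kappa>0 \<longrightarrow> f0 x \<kappa> = 1) \<and>
      uniform_limit U (\<lambda>\<kappa> x. f0 x \<kappa>) (\<lambda>_. 0) at_top"
    if f0: "\<forall>x\<in>U. \<forall>\<kappa>>0. f0 x \<kappa> \<in> {0..1} \<and>
      (AE \<omega> in P (Some x). limsup_occupation X \<phi> x \<kappa> \<omega> = ennreal (f0 x \<kappa>))" for f0 :: "'m \<Rightarrow> real \<Rightarrow> real"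
  proof -
    have f0_range: "0 \<le> f0 x \<kappa>" "f0 x \<kappa> \<le> 1" and f0_AE: "AE \<omega> in P (Some x). limsup_occupation X \<phi> x \<kappa> \<omega> = ennreal (f0 x \<kappa>)"
      if "x \<in> U" "0 < \<kappa>" for x \<kappa>
      using f0 that by auto
    have one: "f0 x \<kappa> = 1" if x: "x \<in> U" and \<kappa>: "0 < \<kappa>" "\<kappa> \<le> \<kappa>0" for x \<kappa>
    proof -
      obtain \<rho> where "scaled_process \<Omega> F X P J \<phi> x \<rho> C1 C2 C3 C4 C5 C6 C7" using local_process[OF x] by blast
      then interpret S: scaled_process \<Omega> F X P J \<phi> x \<rho> C1 C2 C3 C4 C5 C6 C7 .
      interpret prob_space "P (Some x)" by (rule prob_P)
      have "\<kappa> * (2 * C1 * C2 ^ 2 * C5) \<le> \<kappa>0 * (2 * C1 * C2 ^ 2 * C5)" using \<kappa> assms(6-15) by (intro mult_right_mono) auto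
      then have "2 * \<kappa> * C1 * C2 ^ 2 * C5 \<le> 1" using assms(6-15) by (simp add: \<kappa>0_def ac_simps)
      from S.Limsup_occupation_ge_1[OF \<kappa>(1) this]
      obtain E where E: "E \<in> sets (F \<infinity>)" "0 < prob E" "\<And>\<omega>. \<omega> \<in> E \<Longrightarrow> 1 \<le> limsup_occupation X \<phi> x \<kappa> \<omega>"
        unfolding S.limsup_occupation_eq by blast
      have "\<not> f0 x \<kappa> < 1"
      proof
        assume "f0 x \<kappa> < 1"
        then have less: "ennreal (f0 x \<kappa>) < 1" by (simp add: ennreal_less_one_iff)
        have "AE \<omega> in P (Some x). \<omega> \<notin> E"
          using f0_AE[OF x \<kappa>(1)]
        proof eventually_elim
          case (elim \<omega>)
          then show ?case using E(3)[of \<omega>] less by auto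
        qed
        then have "prob E = 0" using E(1) by (subst prob_eq_0) (simp_all add: sets_P)
        then show False using E(2) by simp
      qed
      then show ?thesis using f0_range[OF x \<kappa>(1)] by simp
    qed
    have pos: "0 < f0 x \<kappa>" if x: "x \<in> U" and \<kappa>: "0 < \<kappa>" for x \<kappa>
    proof (rule ccontr)
      assume "\<not> 0 < f0 x \<kappa>"
      then have zero: "f0 x \<kappa> = 0" using f0_range[OF x \<kappa>] by simp
      \<comment> \<open>Otherwise the value would be 1. So the window of \<kappa>0 is the shorter
        one, and \<open>limsup_occupation_pos\<close> contradicts the value 1 at \<kappa>0.\<close>
      then have "\<kappa>0 \<le> \<kappa>" using one[OF x \<kappa>] by (cases "\<kappa> \<le> \<kappa>0") auto
      obtain \<rho> where "scaled_process \<Omega> F X P J \<phi> x \<rho> C1 C2 C3 C4 C5 C6 C7" using local_process[OF x] by blast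
      then interpret S: scaled_process \<Omega> F X P J \<phi> x \<rho> C1 C2 C3 C4 C5 C6 C7 .
      have "AE \<omega> in P (Some x). False"
        using f0_AE[OF x \<kappa>] f0_AE[OF x \<kappa>0]
      proof eventually_elim
        case (elim \<omega>)
        then show ?case
          using S.limsup_occupation_pos[OF \<kappa>0 \<open>\<kappa>0 \<le> \<kappa>\<close>, of \<omega>] one[OF x \<kappa>0 order_refl] zero by simp
      qed
      then show False unfolding prob .
    qed
    have anti: "antimono_on {0<..} (f0 x)" if x: "x \<in> U" for x
    proof (rule monotone_onI)
      fix \<kappa> \<kappa>' :: real assume \<kappa>: "\<kappa> \<in> {0<..}" "\<kappa>' \<in> {0<..}" "\<kappa> \<le> \<kappa>'"
      obtain \<rho> where "scaled_process \<Omega> F X P J \<phi> x \<rho> C1 C2 C3 C4 C5 C6 C7" using local_process[OF x] by blast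
      then interpret S: scaled_process \<Omega> F X P J \<phi> x \<rho> C1 C2 C3 C4 C5 C6 C7 .
      show "f0 x \<kappa>' \<le> f0 x \<kappa>"
      proof (cases "\<kappa> = \<kappa>'")
        case False
        then have less: "0 < \<kappa>" "0 < \<kappa>'" "\<kappa> < \<kappa>'" using \<kappa> by auto
        have "AE \<omega> in P (Some x). ennreal (f0 x \<kappa>') \<le> ennreal (f0 x \<kappa>)"
          using f0_AE[OF x less(1)] f0_AE[OF x less(2)]
        proof eventually_elim
          case (elim \<omega>)
          then show ?case using S.limsup_occupation_antimono[OF less(1,3), of \<omega>] by simp
        qed
        then have "ennreal (f0 x \<kappa>') \<le> ennreal (f0 x \<kappa>)" unfolding prob .
        then show ?thesis using f0_range[OF x less(1)] by (simp add: ennreal_le_iff)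
      qed simp
    qed
    obtain N :: nat where N: "1 \<le> N" "C6 * exp (- C7 * real N) \<le> 1 / 4"
    proof -
      obtain a where a: "4 * C6 / C7 \<le> real a" using real_arch_simple by blast
      define N where "N = max 1 a"
      have "4 * C6 / C7 \<le> real N" using a by (simp add: N_def)
      then have "4 * C6 \<le> C7 * real N" using assms(6-15) by (simp add: field_simps)
      also have "\<dots> \<le> exp (C7 * real N)" using exp_ge_add_one_self[of "C7 * real N"] by linarith
      finally have "C6 * exp (- C7 * real N) \<le> 1 / 4" by (simp add: exp_minus field_simps)
      then show ?thesis by (intro that[of N]) (auto simp: N_def)
    qed
    define \<beta> where "\<beta> = C2 ^ 4 + 1 + 4 * (real N * C1 ^ 2 * C2 ^ 5 * C3)"
    have "0 \<le> 4 * (real N * C1 ^ 2 * C2 ^ 5 * C3)" "0 \<le> C2 ^ 4" using assms(10,11) by simp_all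
    then have \<beta>: "C2 ^ 4 < \<beta>" "4 * (real N * C1 ^ 2 * C2 ^ 5 * C3) \<le> \<beta>" unfolding \<beta>_def by linarith+
    \<comment> \<open>\<sigma> and \<gamma> are \<open>scale_time\<close> and \<open>gain\<close>
      written without reference to x: m and K have to be fixed before x for the convergence to be
      uniform.\<close>
    define \<sigma> where "\<sigma> = real N * C1 * C2 ^ 3 + 1 / (C1 * C2 ^ 2)"
    define \<gamma> where "\<gamma> = C4 * exp (- C5) / (2 * C1 * C2 ^ 2 * \<sigma>)"
    have \<sigma>: "0 < \<sigma>" unfolding \<sigma>_def using assms(6-15) by (intro add_nonneg_pos) auto
    have \<gamma>: "0 < \<gamma>" unfolding \<gamma>_def using assms(6-15) \<sigma> by simp
    have "uniform_limit U (\<lambda>\<kappa> x. f0 x \<kappa>) (\<lambda>_. 0) at_top"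
      unfolding uniform_limit_iff
    proof (intro allI impI)
      fix e :: real assume "0 < e"
      define \<delta> where "\<delta> = e / 2"
      have \<delta>: "0 < \<delta>" "\<delta> < e" using \<open>0 < e\<close> by (simp_all add: \<delta>_def)
      obtain m where m: "0 < m" "2 \<le> \<delta> / 48 * (1 + \<gamma>) ^ m"
      proof -
        obtain a where "2 * 48 / \<delta> < (1 + \<gamma>) ^ a" using real_arch_pow[of "1 + \<gamma>"] \<gamma> by auto
        also have "\<dots> \<le> (1 + \<gamma>) ^ Suc a" using \<gamma> by (intro power_increasing) auto
        finally have "2 \<le> \<delta> / 48 * (1 + \<gamma>) ^ Suc a" using \<delta> by (simp add: field_simps)
        then show ?thesis by (intro that[of "Suc a"]) auto
      qed
      define K where "K = 4 * real m * \<sigma> * \<beta> ^ m / (\<delta> / 48)"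
      have "f0 x \<kappa> \<le> \<delta>" if x: "x \<in> U" and \<kappa>: "0 < \<kappa>" "72 * K / \<delta> \<le> \<kappa>" for x \<kappa>
      proof -
        obtain \<rho> where "scaled_process \<Omega> F X P J \<phi> x \<rho> C1 C2 C3 C4 C5 C6 C7" using local_process[OF x] by blast
        then interpret M: multiscale_process \<Omega> F X P J \<phi> x \<rho> C1 C2 C3 C4 C5 C6 C7 N \<beta>
          by (intro multiscale_process.intro multiscale_process_axioms.intro N \<beta>)
        have eqs: "M.scale_time = \<sigma>" "M.gain = \<gamma>"
          by (simp_all add: M.scale_time_def M.gain_def \<sigma>_def \<gamma>_def)
        have "AE \<omega> in P (Some x). limsup_occupation X \<phi> x \<kappa> \<omega> \<le> ennreal \<delta>"
          unfolding M.limsup_occupation_eq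
          by (rule M.Limsup_occupation_le[OF \<delta>(1) m(1), unfolded eqs, OF m(2) \<kappa>(2)[unfolded K_def]])
        then have "AE \<omega> in P (Some x). ennreal (f0 x \<kappa>) \<le> ennreal \<delta>"
          using f0_AE[OF x \<kappa>(1)] by eventually_elim simp
        then have "ennreal (f0 x \<kappa>) \<le> ennreal \<delta>" unfolding prob .
        then show ?thesis using \<delta> by (simp add: ennreal_le_iff)
      qed
      then have small: "dist (f0 x \<kappa>) 0 < e" if "x \<in> U" "0 < \<kappa>" "72 * K / \<delta> \<le> \<kappa>" for x \<kappa>
        using that f0_range[of x \<kappa>] \<delta> by fastforce
      show "\<forall>\<^sub>F \<kappa> in at_top. \<forall>x\<in>U. dist (f0 x \<kappa>) 0 < e"
        using eventually_ge_at_top[of "72 * K / \<delta>"] eventually_gt_at_top[of 0]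
        by eventually_elim (use small in auto)
    qed
    then show ?thesis using pos anti one \<kappa>0 by blast
  qed
  show ?thesis using unique main by blast
qed

end
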